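(* Let $I\subset S=K[x_1,\ldots,x_n]$ be a monomial complete intersection, i.e. a nonzero proper monomial ideal whose minimal monomial generators form a regular sequence. Then $\operatorname{fdepth}S/I=\operatorname{depth}S/I$ and $\operatorname{fdepth}I=\operatorname{depth}I$. In particular, Stanley's conjecture holds for $S/I$ and $I$, that is, $\operatorname{depth}S/I\le\operatorname{sdepth}S/I$ and $\operatorname{depth}I\le\operatorname{sdepth}I$.
   Context: $K$ is a field and $S=K[x_1,\ldots,x_n]$ with its $\mathbb{Z}^n$-grading. Let $M$ be a nonzero finitely generated $\mathbb{Z}^n$-graded $S$-module; $\operatorname{depth}M$ is the depth with respect to $(x_1,\ldots,x_n)$. For a homogeneous $u\in M$ and $Z\subset\{x_1,\ldots,x_n\}$, $uK[Z]$ denotes the $K$-subspace of $M$ generated by all $uv$ with $v$ a monomial in $K[Z]$; it is a Stanley space of dimension $|Z|$ if it is a free $K[Z]$-module. A Stanley decomposition of $M$ is a presentation $\mathcal{D}: M=\bigoplus_{i=1}^m u_iK[Z_i]$ of $M$ as a finite direct sum of Stanley spaces, as $\mathbb{Z}^n$-graded $K$-vector spaces; $\operatorname{sdepth}\mathcal{D}=\min\{|Z_i|\}$, and $\operatorname{sdepth}M$ is the maximum of $\operatorname{sdepth}\mathcal{D}$ over all Stanley decompositions $\mathcal{D}$ of $M$. A prime filtration $\mathcal{F}$ of $M$ is a chain of $\mathbb{Z}^n$-graded submodules $0=M_0\subset M_1\subset\cdots\subset M_m=M$ with $M_i/M_{i-1}\cong(S/P_i)(-a_i)$, $a_i\in\mathbb{Z}^n$,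 $P_i$ a monomial prime ideal. Set $\operatorname{fdepth}\mathcal{F}=\min\{\dim S/P_i: i=1,\ldots,m\}$, and let $\operatorname{fdepth}M$ be the maximum of $\operatorname{fdepth}\mathcal{F}$ over all prime filtrations $\mathcal{F}$ of $M$. *)

theory Defs
  imports
    "HOL-Library.Poly_Mapping"
    "HOL-Library.Extended_Nat"
    "HOL-Library.Function_Algebras"
    "HOL-Algebra.Algebraic_Closure_Type"
begin

section \<open>Modules, Krull dimension and depth over a commutative ring\<close>

definition quot_module ::
  "('s, 'm, 'x) module_scheme \<Rightarrow> 'm set \<Rightarrow> ('s, 'm set) module"
  where \<comment> \<open>the ring multiplication and unit inherited by the module record carry no meaning\<close>
  "quot_module M N = \<lparr>carrier = a_rcosets\<^bsub>M\<^esub> N, monoid.mult = undefined, one = undefined,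
     zero = N, add = set_add M, module.smult = (\<lambda>s A. \<Union>x\<in>A. N +>\<^bsub>M\<^esub> (s \<odot>\<^bsub>M\<^esub> x))\<rparr>"

definition ideal_smult ::
  "('s, 'y) ring_scheme \<Rightarrow> 's set \<Rightarrow> ('s, 'm, 'x) module_scheme \<Rightarrow> 'm set"
  where "ideal_smult R J M =
    \<Inter>{N. submodule N R M \<and> (\<forall>s\<in>J. \<forall>x\<in>carrier M. s \<odot>\<^bsub>M\<^esub> x \<in> N)}"

definition nonzerodivisor_on :: "'s \<Rightarrow> ('s, 'm, 'x) module_scheme \<Rightarrow> bool"
  where "nonzerodivisor_on s M \<longleftrightarrow>
    (\<forall>x\<in>carrier M. s \<odot>\<^bsub>M\<^esub> x = \<zero>\<^bsub>M\<^esub> \<longrightarrow> x = \<zero>\<^bsub>M\<^esub>)"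

definition regular_sequence ::
  "('s, 'y) ring_scheme \<Rightarrow> ('s, 'm, 'x) module_scheme \<Rightarrow> 's list \<Rightarrow> bool"
  where "regular_sequence R M fs \<longleftrightarrow> set fs \<subseteq> carrier R \<and>
    (\<forall>i<length fs. nonzerodivisor_on (fs ! i)
       (quot_module M (ideal_smult R (Idl\<^bsub>R\<^esub> (set (take i fs))) M))) \<and>
    ideal_smult R (Idl\<^bsub>R\<^esub> (set fs)) M \<noteq> carrier M"

definition depth ::
  "('s, 'y) ring_scheme \<Rightarrow> 's set \<Rightarrow> ('s, 'm, 'x) module_scheme \<Rightarrow> enat"
  where "depth R J M = Sup {enat (length fs) | fs. set fs \<subseteq> J \<and> regular_sequence R M fs}"

definition krull_dim :: "('s, 'y) ring_scheme \<Rightarrow> enat"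
  where "krull_dim R = Sup {enat k | k. \<exists>Q. (\<forall>i\<le>k. primeideal (Q i) R) \<and>
    (\<forall>i<k. Q i \<subset> Q (Suc i))}"

definition free_module :: "('s, 'y) ring_scheme \<Rightarrow> ('s, 'm, 'x) module_scheme \<Rightarrow> bool"
  where "free_module R M \<longleftrightarrow> (\<exists>B\<subseteq>carrier M. \<forall>x\<in>carrier M.
    \<exists>!c. range c \<subseteq> carrier R \<and> finite {b. c b \<noteq> \<zero>\<^bsub>R\<^esub>} \<and> {b. c b \<noteq> \<zero>\<^bsub>R\<^esub>} \<subseteq> B \<and>
      x = (\<Oplus>\<^bsub>M\<^esub>b\<in>{b. c b \<noteq> \<zero>\<^bsub>R\<^esub>}. c b \<odot>\<^bsub>M\<^esub> b))"

section \<open>The polynomial ring and its multigraded modules\<close>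

text \<open>The variables are indexed by a finite type \<open>'n\<close>; exponent vectors are the finitely supported
  functions \<open>'n \<Rightarrow>\<^sub>0 nat\<close>, and multidegrees are the functions \<open>'n \<Rightarrow> int\<close> with pointwise addition.\<close>

type_synonym ('k, 'n) mpoly = "('n \<Rightarrow>\<^sub>0 nat) \<Rightarrow>\<^sub>0 'k"

record ('s, 'm, 'n) gmodule = "('s, 'm) module" +
  gr :: "('n \<Rightarrow> int) \<Rightarrow> 'm set"

abbreviation polyring :: "('k::field, 'n::finite) mpoly ring"
  where "polyring \<equiv> ring_of_type_algebra"

definition polymod :: "(('k::field, 'n::finite) mpoly, ('k, 'n) mpoly, 'n) gmodule"
  where "polymod = \<lparr>carrier = UNIV, monoid.mult = (*), one = 1, zero = 0, add = (+), module.smult = (*),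
    gr = (\<lambda>a. {p. \<forall>v\<in>Poly_Mapping.keys p. (\<lambda>i. int (Poly_Mapping.lookup v i)) = a})\<rparr>"

definition indet :: "'n \<Rightarrow> ('k::field, 'n::finite) mpoly"
  where "indet i = Poly_Mapping.single (Poly_Mapping.single i 1) 1"

definition max_ideal :: "('k::field, 'n::finite) mpoly set"
  where "max_ideal = Idl\<^bsub>polyring\<^esub> (range indet)"

definition monomials :: "('k::field, 'n::finite) mpoly set"
  where "monomials = range (\<lambda>v. Poly_Mapping.single v 1)"

definition poly_subring :: "'n set \<Rightarrow> ('k::field, 'n::finite) mpoly set"
  where "poly_subring Z = {p. \<forall>v\<in>Poly_Mapping.keys p. Poly_Mapping.keys v \<subseteq> Z}"

definition monomial_ideal :: "('k::field, 'n::finite) mpoly set \<Rightarrow> bool"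
  where "monomial_ideal I \<longleftrightarrow> (\<exists>G\<subseteq>monomials. I = Idl\<^bsub>polyring\<^esub> G)"

definition minimal_monomial_generators ::
  "('k::field, 'n::finite) mpoly set \<Rightarrow> ('k, 'n) mpoly set"
  where "minimal_monomial_generators I =
    {u \<in> monomials \<inter> I. \<forall>v \<in> monomials \<inter> I. v dvd u \<longrightarrow> v = u}"

definition graded_module :: "(('k::field, 'n::finite) mpoly, 'm, 'n) gmodule \<Rightarrow> bool"
  where "graded_module M \<longleftrightarrow> module polyring M \<and>
    (\<forall>a. subgroup (gr M a) (add_monoid M)) \<and>
    (\<forall>a b. \<forall>p\<in>gr polymod a. \<forall>x\<in>gr M b. p \<odot>\<^bsub>M\<^esub> x \<in> gr M (a + b)) \<and>
    (\<forall>x\<in>carrier M. \<exists>!f. (\<forall>a. f a \<in> gr M a) \<and> finite {a. f a \<noteq> \<zero>\<^bsub>M\<^esub>} \<and>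
       x = (\<Oplus>\<^bsub>M\<^esub>a\<in>{a. f a \<noteq> \<zero>\<^bsub>M\<^esub>}. f a))"

definition gsub :: "('s, 'm, 'n) gmodule \<Rightarrow> 'm set \<Rightarrow> ('s, 'm, 'n) gmodule"
  where "gsub M N = M\<lparr>carrier := N, gr := \<lambda>a. gr M a \<inter> N\<rparr>"

definition gquot :: "('s, 'm, 'n) gmodule \<Rightarrow> 'm set \<Rightarrow> ('s, 'm set, 'n) gmodule"
  where "gquot M N = module.extend (quot_module M N)
    \<lparr>gr = \<lambda>a. (\<lambda>x. N +>\<^bsub>M\<^esub> x) ` gr M a\<rparr>"

definition graded_submodule ::
  "(('k::field, 'n::finite) mpoly, 'm, 'n) gmodule \<Rightarrow> 'm set \<Rightarrow> bool"
  where "graded_submodule M N \<longleftrightarrow> submodule N polyring M \<and> graded_module (gsub M N)"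

text \<open>\<open>gshift M a\<close> is $M(-a)$.\<close>

definition gshift :: "('s, 'm, 'n) gmodule \<Rightarrow> ('n \<Rightarrow> int) \<Rightarrow> ('s, 'm, 'n) gmodule"
  where "gshift M a = M\<lparr>gr := \<lambda>b. gr M (b - a)\<rparr>"

definition graded_iso ::
  "(('k::field, 'n::finite) mpoly, 'm, 'n) gmodule \<Rightarrow> (('k, 'n) mpoly, 'l, 'n) gmodule \<Rightarrow> bool"
  where "graded_iso M N \<longleftrightarrow> (\<exists>\<phi>. bij_betw \<phi> (carrier M) (carrier N) \<and>
    (\<forall>x\<in>carrier M. \<forall>y\<in>carrier M. \<phi> (x \<oplus>\<^bsub>M\<^esub> y) = \<phi> x \<oplus>\<^bsub>N\<^esub> \<phi> y) \<and>
    (\<forall>s. \<forall>x\<in>carrier M. \<phi> (s \<odot>\<^bsub>M\<^esub> x) = s \<odot>\<^bsub>N\<^esub> \<phi> x) \<and>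
    (\<forall>a. \<phi> ` gr M a = gr N a))"

section \<open>Prime filtrations and Stanley decompositions\<close>

text \<open>The list \<open>Ns\<close> holds the submodules $M_0, \ldots, M_m$; the lists \<open>Ps\<close> and \<open>as\<close> hold the primes
  and the shifts for the steps $1, \ldots, m$, so they are offset by one.\<close>

definition prime_filtration ::
  "(('k::field, 'n::finite) mpoly, 'm, 'n) gmodule \<Rightarrow>
    'm set list \<Rightarrow> ('k, 'n) mpoly set list \<Rightarrow> ('n \<Rightarrow> int) list \<Rightarrow> bool"
  where "prime_filtration M Ns Ps as \<longleftrightarrow>
    length Ns = Suc (length Ps) \<and> length as = length Ps \<and>
    (\<forall>N\<in>set Ns. graded_submodule M N) \<and>
    Ns ! 0 = {\<zero>\<^bsub>M\<^esub>} \<and> Ns ! length Ps = carrier M \<and>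
    (\<forall>i<length Ps. Ns ! i \<subset> Ns ! Suc i \<and>
       primeideal (Ps ! i) polyring \<and> monomial_ideal (Ps ! i) \<and>
       graded_iso (gquot (gsub M (Ns ! Suc i)) (Ns ! i))
         (gshift (gquot polymod (Ps ! i)) (as ! i)))"

definition fdepth :: "(('k::field, 'n::finite) mpoly, 'm, 'n) gmodule \<Rightarrow> enat"
  where "fdepth M = Sup {Min ((\<lambda>P. krull_dim (polyring Quot P)) ` set Ps) | Ns Ps as.
    prime_filtration M Ns Ps as}"

definition K_subspace ::
  "(('k::field, 'n::finite) mpoly, 'm, 'n) gmodule \<Rightarrow> 'm set \<Rightarrow> bool"
  where "K_subspace M W \<longleftrightarrow> subgroup W (add_monoid M) \<and>
    (\<forall>c. \<forall>x\<in>W. Poly_Mapping.single 0 c \<odot>\<^bsub>M\<^esub> x \<in> W)"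

definition stanley_span ::
  "(('k::field, 'n::finite) mpoly, 'm, 'n) gmodule \<Rightarrow> 'm \<Rightarrow> 'n set \<Rightarrow> 'm set"
  where "stanley_span M u Z =
    \<Inter>{W. K_subspace M W \<and> (\<forall>v \<in> monomials \<inter> poly_subring Z. v \<odot>\<^bsub>M\<^esub> u \<in> W)}"

text \<open>The condition that \<open>u\<close> is nonzero excludes the zero module, which is free but not of
  dimension $|Z|$.\<close>

definition stanley_space ::
  "(('k::field, 'n::finite) mpoly, 'm, 'n) gmodule \<Rightarrow> 'm \<Rightarrow> 'n set \<Rightarrow> bool"
  where "stanley_space M u Z \<longleftrightarrow> (\<exists>a. u \<in> gr M a) \<and> u \<noteq> \<zero>\<^bsub>M\<^esub> \<and>
    free_module (polyring\<lparr>carrier := poly_subring Z\<rparr>) (M\<lparr>carrier := stanley_span M u Z\<rparr>)"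

text \<open>Since each \<open>u\<close> is homogeneous, the summands are graded subspaces, so that the decomposition
  is automatically one of graded vector spaces.\<close>

definition stanley_decomposition ::
  "(('k::field, 'n::finite) mpoly, 'm, 'n) gmodule \<Rightarrow> ('m \<times> 'n set) list \<Rightarrow> bool"
  where "stanley_decomposition M D \<longleftrightarrow> (\<forall>(u, Z) \<in> set D. stanley_space M u Z) \<and>
    (\<forall>x\<in>carrier M. \<exists>!f. f \<in> (\<Pi>\<^sub>E i\<in>{..<length D}. stanley_span M (fst (D ! i)) (snd (D ! i))) \<and>
       x = (\<Oplus>\<^bsub>M\<^esub>i\<in>{..<length D}. f i))"

definition sdepth :: "(('k::field, 'n::finite) mpoly, 'm, 'n) gmodule \<Rightarrow> enat"
  where "sdepth M = Sup {Min ((\<lambda>(u, Z). enat (card Z)) ` set D) | D. stanley_decomposition M D}"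

section \<open>Monomial complete intersections\<close>

definition monomial_complete_intersection :: "('k::field, 'n::finite) mpoly set \<Rightarrow> bool"
  where "monomial_complete_intersection I \<longleftrightarrow>
    monomial_ideal I \<and> I \<noteq> {0} \<and> I \<noteq> UNIV \<and>
    (\<exists>us. distinct us \<and> set us = minimal_monomial_generators I \<and>
       regular_sequence polyring polymod us)"

end

theory Submission
  imports Defs
begin

text \<open>
  Let $u_1, \ldots, u_m$ be the minimal monomial generators of $I$ and let $n$ be the number of
  variables. Both depth and fdepth are $n - m$ for $S/I$ and $n - m + 1$ for $I$, and these numbers
  are lower bounds for sdepth.
  A regular sequence of monomials that minimally generate an ideal consists of pairwise coprime
  monomials (\<open>monomial_complete_intersection_exponents\<close>), and everything combinatorial below rests on
  that. For a set $T$ of variables let $P_T$ be the prime generated by $T$.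

  \<^emph>\<open>Lower bounds.\<close> Write $u_1 = x_{k_1} \cdots x_{k_s}$ with repetitions. The chain of ideals generated by
  $u_2, \ldots, u_m$ and $x_{k_1} \cdots x_{k_i}$, for $i = s, s - 1, \ldots, 0$, has the quotients
  $S/(x_{k_i}, u_2, \ldots, u_m)$ up to a shift. Iterating gives a
  prime filtration of $S/I$ in which every prime is a $P_T$ with $T$ a transversal of the supports of
  the $u_j$, so $|T| = m$ (\<open>box_filtration_quotient\<close>). The ideal $I$ is filtered by the
  $(u_1, \ldots, u_j)$, whose quotients are shifted copies of $S/(u_1, \ldots, u_{j - 1})$; here
  $|T| \<le> m - 1$ (\<open>box_filtration_ideal\<close>). On the level of exponents such a filtration adds one
  set $g + {v : \mathrm{supp}\, v \<inter> T = \<emptyset>}$ at a time, so it is a Stanley decomposition as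
  well as a prime filtration, and it bounds fdepth and sdepth from below. For the depth it suffices to
  find one sequence that is regular on $S/P_T$ for all these $T$ (\<open>weakly_regular_box_filtration\<close>):
  choose one variable in the support of each $u_j$ and take the differences $x_a - x_r$, where
  $r \<noteq> a$ is the chosen variable of the support that contains $a$, and the variables $x_a$ that lie in no
  support. For $I$ the chosen variable of the last support can be appended, because no $T$ meets that
  support.

  \<^emph>\<open>Upper bounds.\<close> Koszul homology $H_j(M)$ with respect to all variables controls both depth and
  fdepth. If $f$ lies in the maximal ideal and is regular on $M$, then $H_j(M) \<noteq> 0$ implies
  $H_{j + 1}(M/fM) \<noteq> 0$ (\<open>depth_sensitivity\<close>). Hence $H_j(M) \<noteq> 0$ forces every regular sequence
  to have length at most $n - j$, and applied to $M = S$ and $u_1, \ldots, u_m$ it shows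
  $H_m(S/I) \<noteq> 0$; the connecting map then gives $H_{m - 1}(I) \<noteq> 0$. Since $H_j$ of an extension
  vanishes when $H_j$ of both ends does, every prime filtration of $M$ contains some $S/P_T$ with
  $H_j(S/P_T) \<noteq> 0$, hence $|T| \<ge> j$, hence $\dim S/P_T \<le> n - j$. The last step is the dimension
  theory of polynomial rings (\<open>krull_dim_quot_var_prime\<close>).

  Every module that occurs is a quotient $B/A$ of two ideals of $S$. The homological arguments are
  therefore carried out with ideals, and \<open>presented\<close> transfers them to module records.
\<close>

section \<open>Weakly regular sequences on quotients of ideals\<close>

definition is_ideal :: "'a::comm_ring_1 set \<Rightarrow> bool"
  where "is_ideal I \<longleftrightarrow> 0 \<in> I \<and> (\<forall>a\<in>I. \<forall>b\<in>I. a + b \<in> I) \<and> (\<forall>s. \<forall>a\<in>I. s * a \<in> I)"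

lemma is_idealI:
  assumes "0 \<in> I" "\<And>a b. a \<in> I \<Longrightarrow> b \<in> I \<Longrightarrow> a + b \<in> I" "\<And>s a. a \<in> I \<Longrightarrow> s * a \<in> I"
  shows "is_ideal I"
  using assms unfolding is_ideal_def by auto

lemma
  assumes "is_ideal I"
  shows ideal_0: "0 \<in> I" and ideal_add: "a \<in> I \<Longrightarrow> b \<in> I \<Longrightarrow> a + b \<in> I"
    and ideal_mult: "a \<in> I \<Longrightarrow> s * a \<in> I" and ideal_mult2: "a \<in> I \<Longrightarrow> a * s \<in> I"
    and ideal_uminus: "a \<in> I \<Longrightarrow> - a \<in> I" and ideal_diff: "a \<in> I \<Longrightarrow> b \<in> I \<Longrightarrow> a - b \<in> I"
proof -
  show "0 \<in> I" and add: "a \<in> I \<Longrightarrow> b \<in> I \<Longrightarrow> a + b \<in> I" and mult: "a \<in> I \<Longrightarrow> s * a \<in> I" for a b s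
    using assms unfolding is_ideal_def by auto
  show "a \<in> I \<Longrightarrow> a * s \<in> I" using mult by (simp add: mult.commute)
  show m: "a \<in> I \<Longrightarrow> - a \<in> I" for a using mult[of a "-1"] by simp
  show "a \<in> I \<Longrightarrow> b \<in> I \<Longrightarrow> a - b \<in> I" using add[of a "-b"] m[of b] by simp
qed

lemma ideal_sum:
  assumes "is_ideal I" "\<And>i. i \<in> F \<Longrightarrow> f i \<in> I"
  shows "sum f F \<in> I"
  using assms(2) by (induction F rule: infinite_finite_induct)
    (auto intro: ideal_0[OF assms(1)] ideal_add[OF assms(1)])

lemma ideal_add_cancel:
  assumes "is_ideal I" "a \<in> I"
  shows "a + b \<in> I \<longleftrightarrow> b \<in> I" "b + a \<in> I \<longleftrightarrow> b \<in> I"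
  using ideal_add[OF assms(1)] ideal_diff[OF assms(1)] assms(2)
  by (metis add_diff_cancel_left', metis add_diff_cancel_right')

lemma ideal_UNIV [simp]: "is_ideal UNIV"
  by (rule is_idealI) auto

lemma ideal_zero [simp]: "is_ideal {0}"
  by (rule is_idealI) auto

text \<open>The ideal $A + fB$, the kernel of $B \to (B/A)/f(B/A)$.\<close>

definition ideal_plus :: "'a::comm_ring_1 set \<Rightarrow> 'a \<Rightarrow> 'a set \<Rightarrow> 'a set"
  where "ideal_plus A f B = {a + f * b |a b. a \<in> A \<and> b \<in> B}"

lemma ideal_plusI: "a \<in> A \<Longrightarrow> b \<in> B \<Longrightarrow> a + f * b \<in> ideal_plus A f B"
  unfolding ideal_plus_def by auto

lemma ideal_plusE:
  assumes "p \<in> ideal_plus A f B"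
  obtains a b where "a \<in> A" "b \<in> B" "p = a + f * b"
  using assms unfolding ideal_plus_def by auto

lemma is_ideal_plus:
  assumes A: "is_ideal A" and B: "is_ideal B"
  shows "is_ideal (ideal_plus A f B)"
proof (rule is_idealI)
  show "0 \<in> ideal_plus A f B"
    using ideal_plusI[OF ideal_0[OF A] ideal_0[OF B], of f] by simp
  show "p + q \<in> ideal_plus A f B" if pq: "p \<in> ideal_plus A f B" "q \<in> ideal_plus A f B" for p q
  proof -
    obtain a b where "a \<in> A" "b \<in> B" "p = a + f * b" using pq(1) by (rule ideal_plusE)
    moreover obtain a' b' where "a' \<in> A" "b' \<in> B" "q = a' + f * b'"
      using pq(2) by (rule ideal_plusE)
    ultimately show ?thesis
      using ideal_plusI[of "a + a'" A "b + b'" B f] ideal_add[OF A] ideal_add[OF B]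
      by (simp add: algebra_simps)
  qed
  show "s * p \<in> ideal_plus A f B" if p: "p \<in> ideal_plus A f B" for s p
  proof -
    obtain a b where "a \<in> A" "b \<in> B" "p = a + f * b" using p by (rule ideal_plusE)
    then show ?thesis
      using ideal_plusI[of "s * a" A "s * b" B f] ideal_mult[OF A] ideal_mult[OF B]
      by (simp add: algebra_simps)
  qed
qed

lemma ideal_plus_superset: "is_ideal B \<Longrightarrow> A \<subseteq> ideal_plus A f B"
  using ideal_plusI[of _ A 0 B f] ideal_0 by fastforce

lemma ideal_plus_mult: "is_ideal A \<Longrightarrow> b \<in> B \<Longrightarrow> f * b \<in> ideal_plus A f B"
  using ideal_plusI[of 0 A b B f] ideal_0 by fastforce

lemma ideal_plus_subset:
  assumes "is_ideal C" "A \<subseteq> C" "\<And>b. b \<in> B \<Longrightarrow> f * b \<in> C"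
  shows "ideal_plus A f B \<subseteq> C"
  using assms ideal_add[OF assms(1)] by (auto elim!: ideal_plusE)

lemma ideal_plus_le:
  assumes "is_ideal B" "A \<subseteq> B" shows "ideal_plus A f B \<subseteq> B"
  by (rule ideal_plus_subset) (use assms ideal_mult in auto)

lemma ideal_plus_mono:
  assumes "A \<subseteq> A'" "B \<subseteq> B'" shows "ideal_plus A f B \<subseteq> ideal_plus A' f B'"
  using assms unfolding ideal_plus_def by blast

fun ideal_plus_list :: "'a::comm_ring_1 list \<Rightarrow> 'a set \<Rightarrow> 'a set \<Rightarrow> 'a set"
  where "ideal_plus_list [] A B = A"
  | "ideal_plus_list (f # fs) A B = ideal_plus_list fs (ideal_plus A f B) B"

text \<open>Regularity of a sequence on $B/A$, without the condition that the last quotient is nonzero.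
  Passing to the quotient by $f$ replaces $A$ by $A + fB$ and keeps $B$, so the recursion stays
  within quotients of ideals.\<close>

fun weakly_regular :: "'a::comm_ring_1 list \<Rightarrow> 'a set \<Rightarrow> 'a set \<Rightarrow> bool"
  where "weakly_regular [] A B = True"
  | "weakly_regular (f # fs) A B \<longleftrightarrow>
      (\<forall>b\<in>B. f * b \<in> A \<longrightarrow> b \<in> A) \<and> weakly_regular fs (ideal_plus A f B) B"

lemma is_ideal_plus_list:
  assumes "is_ideal A" "is_ideal B" shows "is_ideal (ideal_plus_list fs A B)"
  using assms by (induction fs arbitrary: A) (auto intro: is_ideal_plus)

lemma ideal_plus_list_superset:
  assumes "is_ideal A" "is_ideal B" shows "A \<subseteq> ideal_plus_list fs A B"
  using assms
  by (induction fs arbitrary: A)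
    (auto intro: is_ideal_plus dest: subsetD[OF ideal_plus_superset])

lemma ideal_plus_list_mult:
  assumes "is_ideal A" "is_ideal B" "f \<in> set fs" "b \<in> B"
  shows "f * b \<in> ideal_plus_list fs A B"
  using assms
proof (induction fs arbitrary: A)
  case (Cons g fs)
  have I: "is_ideal (ideal_plus A g B)" using Cons.prems by (simp add: is_ideal_plus)
  show ?case
  proof (cases "f = g")
    case True
    then have "f * b \<in> ideal_plus A g B" using ideal_plus_mult[OF Cons.prems(1,4)] by simp
    then show ?thesis using ideal_plus_list_superset[OF I Cons.prems(2)] by auto
  next
    case False
    then show ?thesis using Cons.IH[OF I Cons.prems(2)] Cons.prems by simp
  qed
qed simp

lemma ideal_plus_list_least:
  assumes "is_ideal C" "A \<subseteq> C" "\<And>f b. f \<in> set fs \<Longrightarrow> b \<in> B \<Longrightarrow> f * b \<in> C"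
  shows "ideal_plus_list fs A B \<subseteq> C"
  using assms
proof (induction fs arbitrary: A)
  case (Cons g fs)
  have "ideal_plus A g B \<subseteq> C" using Cons.prems by (intro ideal_plus_subset) auto
  then show ?case using Cons by simp
qed simp

lemma weakly_regular_append:
  "weakly_regular (fs @ gs) A B \<longleftrightarrow>
    weakly_regular fs A B \<and> weakly_regular gs (ideal_plus_list fs A B) B"
  by (induction fs arbitrary: A) auto

lemma weakly_regular_nth:
  "weakly_regular fs A B \<longleftrightarrow> (\<forall>i<length fs. \<forall>b\<in>B. fs ! i * b \<in> ideal_plus_list (take i fs) A B \<longrightarrow>
     b \<in> ideal_plus_list (take i fs) A B)"
proof (induction fs arbitrary: A)
  case (Cons f fs)
  show ?case unfolding weakly_regular.simps Cons
    by (auto simp: less_Suc_eq_0_disj)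
qed simp

text \<open>The inclusion $B \subseteq B + A'$ induces an isomorphism $B/A \cong (B + A')/A'$ as soon as $A'
  \<inter> B = A$, and by the modular law this situation persists after dividing by $f$.\<close>

lemma weakly_regular_transport:
  assumes "is_ideal A" "is_ideal B" "is_ideal A'" "A \<subseteq> A'" "A' \<inter> B \<subseteq> A" "A \<subseteq> B"
    and "B' = {b + a |b a. b \<in> B \<and> a \<in> A'}" and "weakly_regular fs A B"
  shows "weakly_regular fs A' B'"
  using assms
proof (induction fs arbitrary: A A')
  case (Cons f fs)
  note A = Cons.prems(1) and B = Cons.prems(2) and A' = Cons.prems(3)
  have reg: "b \<in> A" if "b \<in> B" "f * b \<in> A" for b using Cons.prems(8) that by simp
  have B': "b + a \<in> B'" if "b \<in> B" "a \<in> A'" for a b using that Cons.prems(7) by auto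
  have first: "c \<in> A'" if c: "c \<in> B'" "f * c \<in> A'" for c
  proof -
    obtain b a where ba: "b \<in> B" "a \<in> A'" "c = b + a" using c Cons.prems(7) by auto
    then have "f * b + f * a \<in> A'" using that by (simp add: algebra_simps)
    then have "f * b \<in> A'" using ideal_add_cancel(2)[OF A' ideal_mult[OF A' ba(2)]] by blast
    then have "b \<in> A" using reg ba(1) ideal_mult[OF B] Cons.prems(5) by blast
    then show ?thesis using ba ideal_add[OF A'] Cons.prems(4) by blast
  qed
  have plus: "ideal_plus A' f B' = ideal_plus A' f B"
  proof
    show "ideal_plus A' f B' \<subseteq> ideal_plus A' f B"
    proof (rule ideal_plus_subset)
      fix c assume "c \<in> B'"
      then obtain b a where ba: "b \<in> B" "a \<in> A'" "c = b + a" using Cons.prems(7) by auto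
      then show "f * c \<in> ideal_plus A' f B"
        using ideal_plusI[OF ideal_mult[OF A' ba(2)] ba(1), of f f] by (simp add: algebra_simps)
    qed (use is_ideal_plus[OF A' B] ideal_plus_superset[OF B] in auto)
    show "ideal_plus A' f B \<subseteq> ideal_plus A' f B'"
      using B'[OF _ ideal_0[OF A']] by (intro ideal_plus_mono) auto
  qed
  have "weakly_regular fs (ideal_plus A' f B) B'"
  proof (rule Cons.IH[of "ideal_plus A f B"])
    show "ideal_plus A f B \<subseteq> ideal_plus A' f B"
      using Cons.prems(4) by (intro ideal_plus_mono) auto
    show "ideal_plus A' f B \<inter> B \<subseteq> ideal_plus A f B"
    proof
      fix c assume c: "c \<in> ideal_plus A' f B \<inter> B"
      then obtain a b where ab: "a \<in> A'" "b \<in> B" "c = a + f * b" by (auto elim: ideal_plusE)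
      then have "a \<in> B" using c ideal_add_cancel(2)[OF B ideal_mult[OF B ab(2)]] by blast
      then have "a \<in> A" using ab Cons.prems(5) by blast
      then show "c \<in> ideal_plus A f B" using ab by (auto intro: ideal_plusI)
    qed
    show "B' = {b + a |b a. b \<in> B \<and> a \<in> ideal_plus A' f B}"
    proof
      show "B' \<subseteq> {b + a |b a. b \<in> B \<and> a \<in> ideal_plus A' f B}"
        using Cons.prems(7) ideal_plus_superset[OF B, of A' f] by blast
      show "{b + a |b a. b \<in> B \<and> a \<in> ideal_plus A' f B} \<subseteq> B'"
      proof clarify
        fix b p assume "b \<in> B" "p \<in> ideal_plus A' f B"
        then obtain a b' where "a \<in> A'" "b' \<in> B" "p = a + f * b'" by (auto elim: ideal_plusE)
        then show "b + p \<in> B'"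
          using B'[of "b + f * b'" a] ideal_add[OF B] ideal_mult[OF B] \<open>b \<in> B\<close>
          by (simp add: algebra_simps)
      qed
    qed
  qed (use Cons.prems is_ideal_plus ideal_plus_le[of B A f] in auto)
  then show ?case using first plus by simp
qed simp

text \<open>Regularity of $f$ on $C/B$ gives $(A + fC) \<inter> B = A + fB$. So the quotients by $f$ form
  again a short exact sequence, whose left term $B/(A + fB)$ is identified with $(B + fC)/(A +
  fC)$.\<close>

lemma weakly_regular_extension:
  assumes "is_ideal A" "is_ideal B" "is_ideal C" "A \<subseteq> B" "B \<subseteq> C"
    and "weakly_regular fs A B" "weakly_regular fs B C"
  shows "weakly_regular fs A C"
  using assms
proof (induction fs arbitrary: A B)
  case (Cons f fs)
  note A = Cons.prems(1) and B = Cons.prems(2) and C = Cons.prems(3)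
  have first: "c \<in> A" if "c \<in> C" "f * c \<in> A" for c
    using that Cons.prems(4,6,7) by auto
  let ?A' = "ideal_plus A f C" and ?B' = "ideal_plus B f C"
  have "weakly_regular fs ?A' ?B'"
  proof (rule weakly_regular_transport[of "ideal_plus A f B" B])
    show "ideal_plus A f B \<subseteq> ?A'"
      using Cons.prems(5) by (intro ideal_plus_mono) auto
    show "?A' \<inter> B \<subseteq> ideal_plus A f B"
    proof
      fix p assume p: "p \<in> ?A' \<inter> B"
      then obtain a c where ac: "a \<in> A" "c \<in> C" "p = a + f * c" by (auto elim: ideal_plusE)
      then have "f * c \<in> B" using p ideal_add_cancel(1)[OF B] Cons.prems(4) by blast
      then have "c \<in> B" using Cons.prems(7) ac(2) by simp
      then show "p \<in> ideal_plus A f B" using ac by (auto intro: ideal_plusI)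
    qed
    show "?B' = {b + a |b a. b \<in> B \<and> a \<in> ?A'}"
    proof
      show "?B' \<subseteq> {b + a |b a. b \<in> B \<and> a \<in> ?A'}"
      proof
        fix p assume "p \<in> ?B'"
        then obtain b c where "b \<in> B" "c \<in> C" "p = b + f * c" by (rule ideal_plusE)
        then show "p \<in> {b + a |b a. b \<in> B \<and> a \<in> ?A'}" using ideal_plus_mult[OF A] by blast
      qed
      show "{b + a |b a. b \<in> B \<and> a \<in> ?A'} \<subseteq> ?B'"
      proof clarify
        fix b p assume "b \<in> B" "p \<in> ?A'"
        then obtain a c where "a \<in> A" "c \<in> C" "p = a + f * c" by (auto elim: ideal_plusE)
        then show "b + p \<in> ?B'"
          using ideal_plusI[of "b + a" B c C f] ideal_add[OF B] Cons.prems(4) \<open>b \<in> B\<close>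
          by (auto simp: algebra_simps)
      qed
    qed
  qed (use Cons.prems is_ideal_plus ideal_plus_le[of B A f] in auto)
  moreover have "?A' \<subseteq> ?B'" using Cons.prems(4) by (intro ideal_plus_mono) auto
  moreover have "weakly_regular fs ?B' C" using Cons.prems(7) by simp
  moreover have "?B' \<subseteq> C" using Cons.prems(5) by (intro ideal_plus_le C)
  ultimately have "weakly_regular fs ?A' C"
    using Cons.IH[of ?A' ?B'] A B C by (simp add: is_ideal_plus)
  then show ?case using first by simp
qed simp

text \<open>Multiplication by $g$ is an isomorphism from $S/(B : g)$ onto $(B + gS)/B$.\<close>

lemma weakly_regular_colon:
  assumes "is_ideal B" "weakly_regular fs {s. g * s \<in> B} UNIV"
  shows "weakly_regular fs B (ideal_plus B g UNIV)"
  using assms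
proof (induction fs arbitrary: B)
  case (Cons f fs)
  note B = Cons.prems(1)
  let ?C = "ideal_plus B g UNIV"
  have first: "c \<in> B" if c: "c \<in> ?C" "f * c \<in> B" for c
  proof -
    obtain b s where bs: "b \<in> B" "c = b + g * s" using c by (auto elim: ideal_plusE)
    then have "f * b + g * (f * s) \<in> B" using that by (simp add: algebra_simps)
    then have "g * (f * s) \<in> B" using ideal_add_cancel(1)[OF B ideal_mult[OF B bs(1)]] by blast
    then have "g * s \<in> B" using Cons.prems(2) by simp
    then show ?thesis using bs ideal_add[OF B] by simp
  qed
  define B' where "B' = ideal_plus B (f * g) UNIV"
  have B': "is_ideal B'" unfolding B'_def using B by (simp add: is_ideal_plus)
  have "ideal_plus B f ?C = B'"
  proof
    show "ideal_plus B f ?C \<subseteq> B'"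
    proof
      fix p assume "p \<in> ideal_plus B f ?C"
      then obtain b b' s where "b \<in> B" "b' \<in> B" "p = b + f * (b' + g * s)"
        by (auto elim!: ideal_plusE)
      then show "p \<in> B'" unfolding B'_def
        using ideal_plusI[of "b + f * b'" B s UNIV "f * g"] ideal_add[OF B] ideal_mult[OF B]
        by (simp add: algebra_simps)
    qed
    show "B' \<subseteq> ideal_plus B f ?C"
    proof
      fix p assume "p \<in> B'"
      then obtain b s where "b \<in> B" "p = b + f * g * s" unfolding B'_def by (auto elim: ideal_plusE)
      then show "p \<in> ideal_plus B f ?C"
        using ideal_plusI[of b B "g * s" ?C f] ideal_plus_mult[OF B, of s UNIV g]
        by (simp add: algebra_simps)
    qed
  qed
  moreover have "ideal_plus B' g UNIV = ?C"
  proof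
    show "ideal_plus B' g UNIV \<subseteq> ?C"
    proof
      fix p assume "p \<in> ideal_plus B' g UNIV"
      then obtain b s t where "b \<in> B" "p = b + f * g * s + g * t"
        unfolding B'_def by (auto elim!: ideal_plusE)
      then show "p \<in> ?C" using ideal_plusI[of b B "f * s + t" UNIV g] by (simp add: algebra_simps)
    qed
    show "?C \<subseteq> ideal_plus B' g UNIV"
      using ideal_plus_superset[of UNIV B "f * g"] unfolding B'_def by (intro ideal_plus_mono) auto
  qed
  moreover have "{s. g * s \<in> B'} = ideal_plus {s. g * s \<in> B} f UNIV"
  proof
    show "{s. g * s \<in> B'} \<subseteq> ideal_plus {s. g * s \<in> B} f UNIV"
    proof clarify
      fix s assume "g * s \<in> B'"
      then obtain b t where bt: "b \<in> B" "g * s = b + f * g * t"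
        unfolding B'_def by (auto elim: ideal_plusE)
      then have "g * (s - f * t) = b" by (simp add: algebra_simps)
      then show "s \<in> ideal_plus {s. g * s \<in> B} f UNIV"
        using ideal_plusI[of "s - f * t" "{s. g * s \<in> B}" t UNIV f] bt by simp
    qed
    show "ideal_plus {s. g * s \<in> B} f UNIV \<subseteq> {s. g * s \<in> B'}"
    proof clarify
      fix s assume "s \<in> ideal_plus {s. g * s \<in> B} f UNIV"
      then obtain a t where "g * a \<in> B" "s = a + f * t" by (auto elim: ideal_plusE)
      then show "g * s \<in> B'" unfolding B'_def
        using ideal_plusI[of "g * a" B t UNIV "f * g"] by (simp add: algebra_simps)
    qed
  qed
  ultimately have "weakly_regular fs (ideal_plus B f ?C) ?C"
    using Cons.IH[OF B'] Cons.prems(2) by simp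
  then show ?case using first by simp
qed simp

section \<open>The Koszul complex and depth sensitivity\<close>

text \<open>Chains of the Koszul complex are functions from sets of indices to the ring, the value at
  $\sigma$ being the coefficient of the wedge of the $e_i$ with $i \<in> \sigma$. The numbering
  \<open>idx\<close> only fixes the signs.\<close>

locale koszul =
  fixes x :: "'n::finite \<Rightarrow> 'a::comm_ring_1" and idx :: "'n \<Rightarrow> nat"
  assumes inj_idx: "inj idx"
begin

text \<open>The sign for moving $e_i$ to its place in the wedge of $\sigma \cup {i}$.\<close>

definition sg :: "'n \<Rightarrow> 'n set \<Rightarrow> 'a"
  where "sg i \<sigma> = (- 1) ^ card {k \<in> \<sigma>. idx k < idx i}"

definition d :: "('n set \<Rightarrow> 'a) \<Rightarrow> 'n set \<Rightarrow> 'a"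
  where "d z \<sigma> = (\<Sum>i\<in>- \<sigma>. sg i \<sigma> * x i * z (insert i \<sigma>))"

text \<open>Left multiplication by $e_j$.\<close>

definition h :: "'n \<Rightarrow> ('n set \<Rightarrow> 'a) \<Rightarrow> 'n set \<Rightarrow> 'a"
  where "h j w \<sigma> = (if j \<in> \<sigma> then sg j (\<sigma> - {j}) * w (\<sigma> - {j}) else 0)"

lemma sg_sq: "sg i \<sigma> * sg i \<sigma> = 1"
  unfolding sg_def by (simp flip: power_add mult_2 power_mult_distrib add: power_mult)

lemma sg_insert:
  assumes "j \<notin> \<sigma>"
  shows "sg i (insert j \<sigma>) = (if idx j < idx i then - sg i \<sigma> else sg i \<sigma>)"
proof (cases "idx j < idx i")
  case True
  then have "{k \<in> insert j \<sigma>. idx k < idx i} = insert j {k \<in> \<sigma>. idx k < idx i}" by auto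
  then show ?thesis using assms True unfolding sg_def by simp
next
  case False
  then have "{k \<in> insert j \<sigma>. idx k < idx i} = {k \<in> \<sigma>. idx k < idx i}" by auto
  then show ?thesis using False unfolding sg_def by simp
qed

lemma sg_swap:
  assumes "i \<noteq> j" "i \<notin> \<sigma>" "j \<notin> \<sigma>"
  shows "sg i (insert j \<sigma>) * sg j (insert i \<sigma>) = - (sg i \<sigma> * sg j \<sigma>)"
  using assms inj_idx by (auto simp: sg_insert inj_eq)

lemma d_add: "d (\<lambda>\<sigma>. z \<sigma> + w \<sigma>) = (\<lambda>\<sigma>. d z \<sigma> + d w \<sigma>)"
  by (rule ext) (simp add: d_def algebra_simps sum.distrib)

lemma d_scale: "d (\<lambda>\<sigma>. f * z \<sigma>) = (\<lambda>\<sigma>. f * d z \<sigma>)"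
  by (rule ext) (simp add: d_def algebra_simps sum_distrib_left)

lemma d_diff: "d (\<lambda>\<sigma>. z \<sigma> - w \<sigma>) = (\<lambda>\<sigma>. d z \<sigma> - d w \<sigma>)"
  by (rule ext) (simp add: d_def algebra_simps sum_subtractf)

lemma d_sum: "d (\<lambda>\<sigma>. \<Sum>j\<in>J. c j * z j \<sigma>) = (\<lambda>\<sigma>. \<Sum>j\<in>J. c j * d (z j) \<sigma>)"
proof (rule ext)
  fix \<sigma>
  have "d (\<lambda>\<sigma>. \<Sum>j\<in>J. c j * z j \<sigma>) \<sigma> = (\<Sum>i\<in>-\<sigma>. \<Sum>j\<in>J. c j * (sg i \<sigma> * x i * z j (insert i \<sigma>)))"
    unfolding d_def by (simp add: sum_distrib_left algebra_simps)
  also have "\<dots> = (\<Sum>j\<in>J. c j * d (z j) \<sigma>)"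
    unfolding d_def by (subst sum.swap) (simp add: sum_distrib_left)
  finally show "d (\<lambda>\<sigma>. \<Sum>j\<in>J. c j * z j \<sigma>) \<sigma> = (\<Sum>j\<in>J. c j * d (z j) \<sigma>)" .
qed

lemma d_closed: "is_ideal B \<Longrightarrow> (\<And>\<sigma>. z \<sigma> \<in> B) \<Longrightarrow> d z \<sigma> \<in> B"
  unfolding d_def by (intro ideal_sum ideal_mult) auto

lemma h_closed: "is_ideal B \<Longrightarrow> (\<And>\<sigma>. z \<sigma> \<in> B) \<Longrightarrow> h j z \<sigma> \<in> B"
  unfolding h_def by (auto intro: ideal_mult ideal_0)

text \<open>Exchanging the two removed indices changes the sign (\<open>sg_swap\<close>). The summands are
  paired off, rather than the sum being compared with its negative, so that the argument covers
  characteristic 2.\<close>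

lemma d_d: "d (d z) \<sigma> = 0"
proof -
  define F where "F i j = sg i \<sigma> * x i * (sg j (insert i \<sigma>) * x j * z (insert j (insert i \<sigma>)))" for i j
  let ?L = "{(i, j). i \<notin> \<sigma> \<and> j \<notin> \<sigma> \<and> idx i < idx j}"
  let ?R = "{(i, j). i \<notin> \<sigma> \<and> j \<notin> \<sigma> \<and> idx j < idx i}"
  have anti: "F j i = - F i j" if "i \<notin> \<sigma>" "j \<notin> \<sigma>" "i \<noteq> j" for i j
  proof -
    have "sg j \<sigma> * sg i (insert j \<sigma>) = - (sg i \<sigma> * sg j (insert i \<sigma>))"
    proof -
      have "sg j \<sigma> * sg i (insert j \<sigma>) =
          (sg i (insert j \<sigma>) * sg j (insert i \<sigma>)) * (sg j \<sigma> * sg j (insert i \<sigma>))"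
        using sg_sq[of j "insert i \<sigma>"] by (simp add: algebra_simps)
      also have "\<dots> = - (sg i \<sigma> * sg j (insert i \<sigma>)) * (sg j \<sigma> * sg j \<sigma>)"
        using sg_swap[of i j \<sigma>] that by (simp add: algebra_simps)
      finally show ?thesis by (simp add: sg_sq)
    qed
    then have "sg j \<sigma> * sg i (insert j \<sigma>) * (x i * x j * z (insert i (insert j \<sigma>))) =
      - (sg i \<sigma> * sg j (insert i \<sigma>)) * (x i * x j * z (insert i (insert j \<sigma>)))" by simp
    then show ?thesis unfolding F_def by (simp add: insert_commute algebra_simps)
  qed
  have "d (d z) \<sigma> = (\<Sum>i\<in>-\<sigma>. \<Sum>j\<in>- insert i \<sigma>. F i j)"
    unfolding d_def F_def by (simp add: sum_distrib_left)
  also have "\<dots> = (\<Sum>(i, j)\<in>Sigma (-\<sigma>) (\<lambda>i. - insert i \<sigma>). F i j)"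
    by (rule sum.Sigma) auto
  also have "Sigma (-\<sigma>) (\<lambda>i. - insert i \<sigma>) = ?L \<union> ?R"
  proof -
    have "i \<noteq> j \<longleftrightarrow> idx i < idx j \<or> idx j < idx i" for i j
      using inj_idx by (metis inj_eq linorder_neq_iff)
    then show ?thesis by auto
  qed
  also have "(\<Sum>(i, j)\<in>?L \<union> ?R. F i j) = (\<Sum>(i, j)\<in>?L. F i j) + (\<Sum>(i, j)\<in>?R. F i j)"
    by (rule sum.union_disjoint) auto
  also have "(\<Sum>(i, j)\<in>?R. F i j) = (\<Sum>(i, j)\<in>?L. F j i)"
    by (rule sum.reindex_bij_witness[of _ "\<lambda>(i, j). (j, i)" "\<lambda>(i, j). (j, i)"]) auto
  also have "\<dots> = (\<Sum>(i, j)\<in>?L. - F i j)"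
    by (rule sum.cong) (use anti in auto)
  also have "(\<Sum>(i, j)\<in>?L. F i j) + (\<Sum>(i, j)\<in>?L. - F i j) = 0"
    by (simp add: split_def sum_negf)
  finally show ?thesis .
qed

text \<open>Hence each $x_j$, and with it every element of the ideal generated by them, acts as zero on
  Koszul homology.\<close>

lemma homotopy: "d (h j w) \<sigma> + h j (d w) \<sigma> = x j * w \<sigma>"
proof (cases "j \<in> \<sigma>")
  case False
  have "d (h j w) \<sigma> = (\<Sum>i\<in>-\<sigma>. if i = j then x j * w \<sigma> else 0)"
    unfolding d_def h_def
  proof (rule sum.cong)
    fix i assume "i \<in> -\<sigma>"
    have "sg j \<sigma> * x j * (sg j \<sigma> * w \<sigma>) = (sg j \<sigma> * sg j \<sigma>) * (x j * w \<sigma>)"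
      by (simp only: algebra_simps)
    then have "sg j \<sigma> * x j * (sg j \<sigma> * w \<sigma>) = x j * w \<sigma>" by (simp add: sg_sq)
    then show "sg i \<sigma> * x i * (if j \<in> insert i \<sigma> then sg j (insert i \<sigma> - {j}) * w (insert i \<sigma> - {j}) else 0)
        = (if i = j then x j * w \<sigma> else 0)"
      using False by auto
  qed simp
  then show ?thesis using False by (simp add: h_def)
next
  case True
  define \<tau> where "\<tau> = \<sigma> - {j}"
  have \<sigma>: "\<sigma> = insert j \<tau>" "j \<notin> \<tau>" using True \<tau>_def by auto
  have "h j (d w) \<sigma> = (\<Sum>i\<in>-\<tau>. sg j \<tau> * (sg i \<tau> * x i * w (insert i \<tau>)))"
    using True by (simp add: h_def \<tau>_def[symmetric] d_def sum_distrib_left)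
  also have "-\<tau> = insert j (-\<sigma>)" using \<sigma> by auto
  also have "(\<Sum>i\<in>insert j (-\<sigma>). sg j \<tau> * (sg i \<tau> * x i * w (insert i \<tau>))) =
      (sg j \<tau> * sg j \<tau>) * (x j * w \<sigma>) + (\<Sum>i\<in>-\<sigma>. sg j \<tau> * (sg i \<tau> * x i * w (insert i \<tau>)))"
    using True by (subst sum.insert) (simp_all add: \<sigma>(1)[symmetric] mult.assoc)
  finally have hd: "h j (d w) \<sigma> = x j * w \<sigma> + (\<Sum>i\<in>-\<sigma>. (sg i \<tau> * sg j \<tau>) * (x i * w (insert i \<tau>)))"
    by (simp add: sg_sq algebra_simps)
  have "d (h j w) \<sigma> = (\<Sum>i\<in>-\<sigma>. - (sg i \<tau> * sg j \<tau>) * (x i * w (insert i \<tau>)))"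
    unfolding d_def
  proof (rule sum.cong)
    fix i assume "i \<in> -\<sigma>"
    then have i: "i \<noteq> j" "i \<notin> \<tau>" using \<sigma> by auto
    have "insert i \<sigma> - {j} = insert i \<tau>" using i \<sigma> by auto
    then have "sg i \<sigma> * x i * h j w (insert i \<sigma>) =
        (sg i (insert j \<tau>) * sg j (insert i \<tau>)) * (x i * w (insert i \<tau>))"
      using True i unfolding h_def \<sigma>(1) by (simp add: algebra_simps)
    then show "sg i \<sigma> * x i * h j w (insert i \<sigma>) = - (sg i \<tau> * sg j \<tau>) * (x i * w (insert i \<tau>))"
      using sg_swap[OF i(1) i(2) \<sigma>(2)] by simp
  qed simp
  then show ?thesis unfolding hd by (simp add: sum_negf)
qed

text \<open>Vanishing of $H_j(x; B/A)$, expressed by chains with values in $B$ that are cycles or boundaries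
  modulo $A$. The chain \<open>w\<close> may have components in all degrees; only its part in
  degree $j + 1$ matters (\<open>acyclic_atE\<close>).\<close>

definition acyclic_at :: "nat \<Rightarrow> 'a set \<Rightarrow> 'a set \<Rightarrow> bool"
  where "acyclic_at j A B \<longleftrightarrow>
    (\<forall>z. (\<forall>\<sigma>. z \<sigma> \<in> B) \<longrightarrow> (\<forall>\<sigma>. card \<sigma> \<noteq> j \<longrightarrow> z \<sigma> = 0) \<longrightarrow> (\<forall>\<sigma>. d z \<sigma> \<in> A) \<longrightarrow>
      (\<exists>w. (\<forall>\<sigma>. w \<sigma> \<in> B) \<and> (\<forall>\<sigma>. z \<sigma> - d w \<sigma> \<in> A)))"

lemma d_degree:
  assumes "\<And>\<sigma>. card \<sigma> \<noteq> Suc j \<Longrightarrow> z \<sigma> = 0" "card \<sigma> \<noteq> j"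
  shows "d z \<sigma> = 0"
  unfolding d_def
proof (rule sum.neutral, rule ballI)
  fix i assume "i \<in> -\<sigma>"
  then have "card (insert i \<sigma>) = Suc (card \<sigma>)" by simp
  then have "z (insert i \<sigma>) = 0" using assms by simp
  then show "sg i \<sigma> * x i * z (insert i \<sigma>) = 0" by simp
qed

lemma d_restrict:
  "d (\<lambda>\<sigma>. if card \<sigma> = Suc j then w \<sigma> else 0) \<sigma> = (if card \<sigma> = j then d w \<sigma> else 0)"
proof (cases "card \<sigma> = j")
  case True
  then show ?thesis unfolding d_def by (auto intro!: sum.cong)
qed (auto intro!: d_degree)

lemma acyclic_atE:
  assumes "acyclic_at j A B" "is_ideal A" "is_ideal B"
    and "\<And>\<sigma>. z \<sigma> \<in> B" "\<And>\<sigma>. card \<sigma> \<noteq> j \<Longrightarrow> z \<sigma> = 0" "\<And>\<sigma>. d z \<sigma> \<in> A"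
  obtains w where "\<And>\<sigma>. w \<sigma> \<in> B" "\<And>\<sigma>. card \<sigma> \<noteq> Suc j \<Longrightarrow> w \<sigma> = 0" "\<And>\<sigma>. z \<sigma> - d w \<sigma> \<in> A"
proof -
  obtain w where w: "\<And>\<sigma>. w \<sigma> \<in> B" "\<And>\<sigma>. z \<sigma> - d w \<sigma> \<in> A"
    using assms unfolding acyclic_at_def by meson
  let ?w = "\<lambda>\<sigma>. if card \<sigma> = Suc j then w \<sigma> else 0"
  show thesis
  proof
    show "?w \<sigma> \<in> B" for \<sigma> using w ideal_0[OF assms(3)] by auto
    show "z \<sigma> - d ?w \<sigma> \<in> A" for \<sigma>
      using w assms(5)[of \<sigma>] ideal_0[OF assms(2)] unfolding d_restrict by auto
  qed auto
qed

text \<open>For a cycle $z$ on $B/A$ the chain $y$ obtained from $z$ by the homotopy for $f$ satisfies $dy =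
  fz$ modulo $A$, so it is a cycle on $B/(A + fB)$. If it is a boundary there, say $y = dw + a +
  fb$, then $f(z - db)$ vanishes modulo $A$, and regularity of $f$ makes $z$ a boundary.\<close>

lemma depth_sensitivity:
  assumes A: "is_ideal A" and B: "is_ideal B"
    and f: "f = (\<Sum>j\<in>UNIV. c j * x j)"
    and reg: "\<And>b. b \<in> B \<Longrightarrow> f * b \<in> A \<Longrightarrow> b \<in> A"
    and acyc: "acyclic_at (Suc j) (ideal_plus A f B) B"
  shows "acyclic_at j A B"
  unfolding acyclic_at_def
proof (intro allI impI)
  fix z assume zB: "\<forall>\<sigma>. z \<sigma> \<in> B" and zj: "\<forall>\<sigma>. card \<sigma> \<noteq> j \<longrightarrow> z \<sigma> = 0" and dz: "\<forall>\<sigma>. d z \<sigma> \<in> A"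
  let ?C = "ideal_plus A f B"
  define y where "y \<sigma> = (\<Sum>k\<in>UNIV. c k * h k z \<sigma>)" for \<sigma>
  define e where "e \<sigma> = (\<Sum>k\<in>UNIV. c k * h k (d z) \<sigma>)" for \<sigma>
  have y_eq: "y = (\<lambda>\<sigma>. \<Sum>k\<in>UNIV. c k * h k z \<sigma>)" by (rule ext) (simp add: y_def)
  have dy: "d y \<sigma> = f * z \<sigma> - e \<sigma>" for \<sigma>
  proof -
    have "d y \<sigma> + e \<sigma> = (\<Sum>k\<in>UNIV. c k * (d (h k z) \<sigma> + h k (d z) \<sigma>))"
      unfolding y_eq d_sum e_def by (simp add: algebra_simps sum.distrib)
    also have "\<dots> = f * z \<sigma>" unfolding homotopy f by (simp add: sum_distrib_right mult.assoc)
    finally show ?thesis by (simp add: algebra_simps)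
  qed
  have e: "e \<sigma> \<in> A" for \<sigma>
    unfolding e_def by (intro ideal_sum ideal_mult A h_closed) (use dz in auto)
  have "\<exists>w. (\<forall>\<sigma>. w \<sigma> \<in> B) \<and> (\<forall>\<sigma>. y \<sigma> - d w \<sigma> \<in> ?C)"
  proof (rule acyc[unfolded acyclic_at_def, rule_format])
    show "y \<sigma> \<in> B" for \<sigma>
      unfolding y_def by (intro ideal_sum ideal_mult B h_closed) (use zB in auto)
    show "y \<sigma> = 0" if "card \<sigma> \<noteq> Suc j" for \<sigma>
    proof -
      have "h k z \<sigma> = 0" for k
      proof (cases "k \<in> \<sigma>")
        case True
        then have "card \<sigma> = Suc (card (\<sigma> - {k}))" by (intro card.remove) auto
        then have "z (\<sigma> - {k}) = 0" using zj that by (metis nat.inject)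
        then show ?thesis unfolding h_def by simp
      qed (simp add: h_def)
      then show ?thesis unfolding y_def by simp
    qed
    show "d y \<sigma> \<in> ?C" for \<sigma>
      using ideal_plusI[of "- e \<sigma>" A "z \<sigma>" B f] ideal_uminus[OF A e] zB unfolding dy by (simp add: add.commute)
  qed
  then obtain w where w: "\<And>\<sigma>. w \<sigma> \<in> B" "\<And>\<sigma>. y \<sigma> - d w \<sigma> \<in> ?C" by blast
  have "\<exists>a b. a \<in> A \<and> b \<in> B \<and> y \<sigma> - d w \<sigma> = a + f * b" for \<sigma>
    using w(2)[of \<sigma>] unfolding ideal_plus_def by blast
  then obtain a b where ab: "\<And>\<sigma>. a \<sigma> \<in> A" "\<And>\<sigma>. b \<sigma> \<in> B" "\<And>\<sigma>. y \<sigma> - d w \<sigma> = a \<sigma> + f * b \<sigma>"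
    by metis
  have "z \<sigma> - d b \<sigma> \<in> A" for \<sigma>
  proof (rule reg)
    show "z \<sigma> - d b \<sigma> \<in> B" using zB d_closed[OF B] ab(2) by (intro ideal_diff B) auto
    have "(\<lambda>\<sigma>. y \<sigma> - d w \<sigma>) = (\<lambda>\<sigma>. a \<sigma> + f * b \<sigma>)" using ab(3) by auto
    then have "d (\<lambda>\<sigma>. y \<sigma> - d w \<sigma>) = d (\<lambda>\<sigma>. a \<sigma> + f * b \<sigma>)" by simp
    then have "d y \<sigma> - d (d w) \<sigma> = d a \<sigma> + f * d b \<sigma>"
      unfolding d_diff d_add d_scale by (rule fun_cong)
    then have "d y \<sigma> = d a \<sigma> + f * d b \<sigma>" by (simp only: d_d diff_zero)
    then have "f * (z \<sigma> - d b \<sigma>) = d a \<sigma> + e \<sigma>" unfolding dy by (simp add: algebra_simps)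
    then show "f * (z \<sigma> - d b \<sigma>) \<in> A"
      using ideal_add[OF A d_closed[OF A ab(1)] e] by simp
  qed
  then show "\<exists>w. (\<forall>\<sigma>. w \<sigma> \<in> B) \<and> (\<forall>\<sigma>. z \<sigma> - d w \<sigma> \<in> A)" using ab(2) by blast
qed

lemma depth_sensitivity_list:
  assumes "is_ideal A" "is_ideal B" "weakly_regular fs A B"
    and "\<And>f. f \<in> set fs \<Longrightarrow> \<exists>c. f = (\<Sum>j\<in>UNIV. c j * x j)"
    and "acyclic_at (j + length fs) (ideal_plus_list fs A B) B"
  shows "acyclic_at j A B"
  using assms
proof (induction fs arbitrary: A j)
  case (Cons f fs)
  obtain c where f: "f = (\<Sum>j\<in>UNIV. c j * x j)" using Cons.prems(4) by auto
  have "acyclic_at (Suc j) (ideal_plus A f B) B"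
    by (rule Cons.IH) (use Cons.prems in \<open>auto intro: is_ideal_plus\<close>)
  then show ?case
    using depth_sensitivity[OF Cons.prems(1,2) f] Cons.prems(3) by auto
qed simp

lemma acyclic_above: "card (UNIV :: 'n set) < j \<Longrightarrow> is_ideal A \<Longrightarrow> is_ideal B \<Longrightarrow> acyclic_at j A B"
  unfolding acyclic_at_def
proof (intro allI impI)
  fix z :: "'n set \<Rightarrow> 'a" assume "card (UNIV :: 'n set) < j" "is_ideal A" "is_ideal B" and zj: "\<forall>\<sigma>. card \<sigma> \<noteq> j \<longrightarrow> z \<sigma> = 0"
  have "z \<sigma> = 0" for \<sigma>
    using zj \<open>card (UNIV :: 'n set) < j\<close> card_mono[OF finite_UNIV subset_UNIV, of \<sigma>] by auto
  then show "\<exists>w. (\<forall>\<sigma>. w \<sigma> \<in> B) \<and> (\<forall>\<sigma>. z \<sigma> - d w \<sigma> \<in> A)"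
    using ideal_0[OF \<open>is_ideal A\<close>] ideal_0[OF \<open>is_ideal B\<close>]
    by (intro exI[of _ "\<lambda>_. 0"]) (simp add: d_def)
qed

lemma weakly_regular_length_le:
  assumes "is_ideal A" "is_ideal B" "weakly_regular fs A B"
    and "\<And>f. f \<in> set fs \<Longrightarrow> \<exists>c. f = (\<Sum>j\<in>UNIV. c j * x j)"
    and "\<not> acyclic_at j A B"
  shows "j + length fs \<le> card (UNIV :: 'n set)"
proof (rule ccontr)
  assume "\<not> j + length fs \<le> card (UNIV :: 'n set)"
  then have "acyclic_at (j + length fs) (ideal_plus_list fs A B) B"
    using assms by (intro acyclic_above is_ideal_plus_list) auto
  then show False using depth_sensitivity_list[OF assms(1-4)] assms(5) by simp
qed

lemma acyclic_extension:
  assumes A: "is_ideal A" and B: "is_ideal B" and C: "is_ideal C" and AB: "A \<subseteq> B" "B \<subseteq> C"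
    and acyc: "acyclic_at j A B" "acyclic_at j B C"
  shows "acyclic_at j A C"
  unfolding acyclic_at_def
proof (intro allI impI)
  fix z assume z: "\<forall>\<sigma>. z \<sigma> \<in> C" "\<forall>\<sigma>. card \<sigma> \<noteq> j \<longrightarrow> z \<sigma> = 0" "\<forall>\<sigma>. d z \<sigma> \<in> A"
  obtain w where w: "\<And>\<sigma>. w \<sigma> \<in> C" "\<And>\<sigma>. card \<sigma> \<noteq> Suc j \<Longrightarrow> w \<sigma> = 0" "\<And>\<sigma>. z \<sigma> - d w \<sigma> \<in> B"
    by (rule acyclic_atE[OF acyc(2) B C, of z]) (use z AB in auto)
  obtain v where v: "\<And>\<sigma>. v \<sigma> \<in> B" "\<And>\<sigma>. z \<sigma> - d w \<sigma> - d v \<sigma> \<in> A"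
  proof (rule acyclic_atE[OF acyc(1) A B, of "\<lambda>\<sigma>. z \<sigma> - d w \<sigma>"])
    show "z \<sigma> - d w \<sigma> = 0" if "card \<sigma> \<noteq> j" for \<sigma> using d_degree[OF w(2)] that z by simp
    show "d (\<lambda>\<sigma>. z \<sigma> - d w \<sigma>) \<sigma> \<in> A" for \<sigma> using z by (simp add: d_diff d_d)
  qed (use w in blast)+
  have "z \<sigma> - d (\<lambda>\<sigma>. w \<sigma> + v \<sigma>) \<sigma> \<in> A" for \<sigma> using v(2)[of \<sigma>] by (simp add: d_add algebra_simps)
  moreover have "w \<sigma> + v \<sigma> \<in> C" for \<sigma> using v w AB ideal_add[OF C] by blast
  ultimately show "\<exists>w. (\<forall>\<sigma>. w \<sigma> \<in> C) \<and> (\<forall>\<sigma>. z \<sigma> - d w \<sigma> \<in> A)"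
    by (intro exI[of _ "\<lambda>\<sigma>. w \<sigma> + v \<sigma>"]) simp
qed

lemma acyclic_colon:
  assumes B: "is_ideal B" and acyc: "acyclic_at j {s. g * s \<in> B} UNIV"
  shows "acyclic_at j B (ideal_plus B g UNIV)"
  unfolding acyclic_at_def
proof (intro allI impI)
  fix z assume z: "\<forall>\<sigma>. z \<sigma> \<in> ideal_plus B g UNIV" "\<forall>\<sigma>. card \<sigma> \<noteq> j \<longrightarrow> z \<sigma> = 0" "\<forall>\<sigma>. d z \<sigma> \<in> B"
  have "\<exists>b s. b \<in> B \<and> (card \<sigma> \<noteq> j \<longrightarrow> s = 0) \<and> z \<sigma> = b + g * s" for \<sigma>
  proof (cases "card \<sigma> = j")
    case True
    have "\<exists>b\<in>B. \<exists>s. z \<sigma> = b + g * s" using z(1) unfolding ideal_plus_def by blast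
    then show ?thesis using True by blast
  next
    case False
    then show ?thesis using z ideal_0[OF B] by (intro exI[of _ 0]) auto
  qed
  then obtain b s where bs: "\<And>\<sigma>. b \<sigma> \<in> B" "\<And>\<sigma>. card \<sigma> \<noteq> j \<Longrightarrow> s \<sigma> = 0" "\<And>\<sigma>. z \<sigma> = b \<sigma> + g * s \<sigma>"
    by metis
  have z_eq: "z = (\<lambda>\<sigma>. b \<sigma> + g * s \<sigma>)" using bs(3) by auto
  have ds: "g * d s \<sigma> \<in> B" for \<sigma>
  proof -
    have "d z \<sigma> = d b \<sigma> + g * d s \<sigma>" unfolding z_eq d_add d_scale ..
    then have "d b \<sigma> + g * d s \<sigma> \<in> B" using z(3) by metis
    then show ?thesis using ideal_add_cancel(1)[OF B d_closed[OF B bs(1)]] by simp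
  qed
  obtain w where w: "\<And>\<sigma>. g * (s \<sigma> - d w \<sigma>) \<in> B"
    using acyc[unfolded acyclic_at_def, rule_format, of s] bs(2) ds unfolding mem_Collect_eq
    by blast
  have "z \<sigma> - d (\<lambda>\<sigma>. g * w \<sigma>) \<sigma> \<in> B" for \<sigma>
    using ideal_add[OF B bs(1)[of \<sigma>] w[of \<sigma>]] by (simp add: bs(3) d_scale algebra_simps)
  moreover have "g * w \<sigma> \<in> ideal_plus B g UNIV" for \<sigma> by (rule ideal_plus_mult[OF B]) simp
  ultimately show "\<exists>w. (\<forall>\<sigma>. w \<sigma> \<in> ideal_plus B g UNIV) \<and> (\<forall>\<sigma>. z \<sigma> - d w \<sigma> \<in> B)"
    by (intro exI[of _ "\<lambda>\<sigma>. g * w \<sigma>"]) simp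
qed

text \<open>Part of the long exact sequence of $0 \to I \to S \to S/I \to 0$: if $H_{j + 1}(S) = 0$ then
  $H_{j + 1}(S/I)$ embeds into $H_j(I)$.\<close>

lemma acyclic_connecting:
  assumes I: "is_ideal I" and acyc: "acyclic_at j {0} I" "acyclic_at (Suc j) {0} UNIV"
  shows "acyclic_at (Suc j) I UNIV"
  unfolding acyclic_at_def
proof (intro allI impI)
  fix z assume z: "\<forall>\<sigma>. card \<sigma> \<noteq> Suc j \<longrightarrow> z \<sigma> = 0" "\<forall>\<sigma>. d z \<sigma> \<in> I"
  obtain y where y: "\<And>\<sigma>. y \<sigma> \<in> I" "\<And>\<sigma>. card \<sigma> \<noteq> Suc j \<Longrightarrow> y \<sigma> = 0" "\<And>\<sigma>. d z \<sigma> - d y \<sigma> \<in> {0}"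
    by (rule acyclic_atE[OF acyc(1) _ I, of "d z"]) (use z d_degree[of j z] in \<open>auto simp: d_d\<close>)
  obtain w where w: "\<And>\<sigma>. z \<sigma> - y \<sigma> - d w \<sigma> \<in> {0}"
    by (rule acyclic_atE[OF acyc(2) _ _, of "\<lambda>\<sigma>. z \<sigma> - y \<sigma>"]) (use z y in \<open>auto simp: d_diff\<close>)
  have "z \<sigma> - d w \<sigma> \<in> I" for \<sigma> using w[of \<sigma>] y(1)[of \<sigma>] by (simp add: algebra_simps)
  then show "\<exists>w. (\<forall>\<sigma>. w \<sigma> \<in> UNIV) \<and> (\<forall>\<sigma>. z \<sigma> - d w \<sigma> \<in> I)" by auto
qed

text \<open>$H_0(S/A)$ is $S/(A + (x))$, so its vanishing is witnessed by the chain with value 1 at the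
  empty set.\<close>

lemma acyclic_at_0:
  assumes A: "is_ideal A" and "acyclic_at 0 A UNIV"
  shows "\<exists>c. 1 - (\<Sum>i\<in>UNIV. c i * x i) \<in> A"
proof -
  define z :: "'n set \<Rightarrow> 'a" where "z \<sigma> = (if \<sigma> = {} then 1 else 0)" for \<sigma>
  have "d z \<sigma> = 0" for \<sigma> unfolding d_def z_def by simp
  moreover have "z \<sigma> = 0" if "card \<sigma> \<noteq> 0" for \<sigma> using that unfolding z_def by auto
  ultimately obtain w where w: "\<And>\<sigma>. z \<sigma> - d w \<sigma> \<in> A"
    using acyclic_atE[OF assms(2) A ideal_UNIV, of z] ideal_0[OF A] by (metis UNIV_I)
  have "z {} - d w {} = 1 - (\<Sum>i\<in>UNIV. (sg i {} * w {i}) * x i)"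
    unfolding z_def d_def by (simp add: algebra_simps)
  then show ?thesis using w[of "{}"] by (intro exI[of _ "\<lambda>i. sg i {} * w {i}"]) simp
qed

end

section \<open>Polynomials and monomial ideals\<close>

abbreviation keys :: "('a \<Rightarrow>\<^sub>0 'b::zero) \<Rightarrow> 'a set" where "keys \<equiv> Poly_Mapping.keys"
abbreviation lookup :: "('a \<Rightarrow>\<^sub>0 'b::zero) \<Rightarrow> 'a \<Rightarrow> 'b" where "lookup \<equiv> Poly_Mapping.lookup"
abbreviation single :: "'a \<Rightarrow> 'b \<Rightarrow> 'a \<Rightarrow>\<^sub>0 'b::zero" where "single \<equiv> Poly_Mapping.single"

lemma poly_mapping_sum_single: "p = (\<Sum>v\<in>keys p. single v (lookup p v))"
proof (rule poly_mapping_eqI)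
  fix k
  show "lookup p k = lookup (\<Sum>v\<in>keys p. single v (lookup p v)) k"
    by (auto simp: lookup_sum lookup_single when_def in_keys_iff)
qed

lemma lookup_mult_sum:
  fixes p q :: "('a::monoid_add \<Rightarrow>\<^sub>0 'b::semiring_0)"
  shows "lookup (p * q) k = (\<Sum>v\<in>keys p. \<Sum>w\<in>keys q. (lookup p v * lookup q w when v + w = k))"
proof -
  have "p * q = (\<Sum>v\<in>keys p. single v (lookup p v)) * (\<Sum>w\<in>keys q. single w (lookup q w))"
    using poly_mapping_sum_single[of p] poly_mapping_sum_single[of q] by simp
  also have "\<dots> = (\<Sum>v\<in>keys p. \<Sum>w\<in>keys q. single (v + w) (lookup p v * lookup q w))"
    by (simp add: sum_product mult_single)
  finally show ?thesis by (simp add: lookup_sum lookup_single)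
qed

lemma lookup_monomial_mult:
  fixes q :: "('n \<Rightarrow>\<^sub>0 nat) \<Rightarrow>\<^sub>0 'b::semiring_0"
  shows "lookup (single v c * q) (v + w) = c * lookup q w"
proof (cases "c = 0")
  case False
  have "lookup (single v c * q) (v + w) = (\<Sum>w'\<in>keys q. (c * lookup q w' when w' = w))"
    using False by (simp add: lookup_mult_sum)
  then show ?thesis by (auto simp: when_def in_keys_iff)
qed simp

lemma keys_monomial_mult:
  fixes q :: "('n \<Rightarrow>\<^sub>0 nat) \<Rightarrow>\<^sub>0 'b::semiring_1"
  shows "keys (single v 1 * q) = (+) v ` keys q"
proof
  show "keys (single v 1 * q) \<subseteq> (+) v ` keys q"
    using keys_mult[of "single v 1" q] by (auto split: if_splits)
  show "(+) v ` keys q \<subseteq> keys (single v 1 * q)"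
    by (auto simp: in_keys_iff lookup_monomial_mult)
qed

lemma expo_minus:
  fixes v w :: "'n \<Rightarrow>\<^sub>0 nat"
  assumes "\<And>i. lookup w i \<le> lookup v i" shows "v = w + (v - w)"
  using assms by (auto intro!: poly_mapping_eqI simp: lookup_add lookup_minus)

lemma expo_minus_single:
  fixes v :: "'n \<Rightarrow>\<^sub>0 nat"
  assumes "i \<in> keys v" shows "v = single i 1 + (v - single i 1)"
proof (rule expo_minus)
  show "lookup (single i 1) j \<le> lookup v j" for j
    using assms by (auto simp: lookup_single when_def in_keys_iff)
qed

lemma keys_expo_add:
  fixes v w :: "'n \<Rightarrow>\<^sub>0 nat" shows "keys (v + w) = keys v \<union> keys w"
  by (auto simp: in_keys_iff lookup_add)

text \<open>Exponent sets of monomial ideals.\<close>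

definition up_closed :: "('n \<Rightarrow>\<^sub>0 nat) set \<Rightarrow> bool"
  where "up_closed U \<longleftrightarrow> (\<forall>v\<in>U. \<forall>w. v + w \<in> U)"

definition mono_ideal :: "('n \<Rightarrow>\<^sub>0 nat) set \<Rightarrow> ('k::field, 'n::finite) mpoly set"
  where "mono_ideal U = {p. keys p \<subseteq> U}"

lemma up_closedD: "up_closed U \<Longrightarrow> v \<in> U \<Longrightarrow> v + w \<in> U"
  unfolding up_closed_def by blast

lemma up_closedD2: "up_closed U \<Longrightarrow> w \<in> U \<Longrightarrow> v + w \<in> U"
  using up_closedD[of U w v] by (simp add: add.commute)

lemma is_ideal_mono_ideal:
  fixes U :: "('n::finite \<Rightarrow>\<^sub>0 nat) set"
  assumes "up_closed U" shows "is_ideal (mono_ideal U :: ('k::field, 'n) mpoly set)"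
proof (rule is_idealI)
  show "p + q \<in> mono_ideal U" if "p \<in> mono_ideal U" "q \<in> mono_ideal U" for p q :: "('k, 'n) mpoly"
    using that keys_add[of p q] unfolding mono_ideal_def by blast
  show "s * p \<in> mono_ideal U" if p: "p \<in> mono_ideal U" for s p :: "('k, 'n) mpoly"
    unfolding mono_ideal_def mem_Collect_eq
  proof
    fix v assume "v \<in> keys (s * p)"
    then obtain a b where "v = a + b" "b \<in> keys p" using keys_mult[of s p] by blast
    then show "v \<in> U" using p up_closedD2[OF assms] unfolding mono_ideal_def by blast
  qed
qed (simp add: mono_ideal_def)

lemma single_in_mono_ideal [simp]: "single v (1 :: 'k::field) \<in> mono_ideal U \<longleftrightarrow> v \<in> U"
  unfolding mono_ideal_def by simp

lemma in_ideal_if_monomials_in_ideal: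
  fixes I :: "('k::field, 'n::finite) mpoly set"
  assumes I: "is_ideal I" and "\<And>v. v \<in> keys p \<Longrightarrow> single v 1 \<in> I"
  shows "p \<in> I"
proof -
  have "single v (lookup p v) \<in> I" if "v \<in> keys p" for v
    using ideal_mult[OF I assms(2)[OF that], of "single 0 (lookup p v)"] by (simp add: mult_single)
  then have "(\<Sum>v\<in>keys p. single v (lookup p v)) \<in> I" by (intro ideal_sum[OF I])
  then show ?thesis by (simp flip: poly_mapping_sum_single)
qed

lemma mono_ideal_subset_iff:
  "mono_ideal U \<subseteq> (mono_ideal V :: ('k::field, 'n::finite) mpoly set) \<longleftrightarrow> U \<subseteq> V"
  using single_in_mono_ideal[where 'k='k] unfolding mono_ideal_def by blast

lemma mono_ideal_eq_iff:
  "mono_ideal U = (mono_ideal V :: ('k::field, 'n::finite) mpoly set) \<longleftrightarrow> U = V"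
  using mono_ideal_subset_iff[where 'k='k and 'n='n] by (simp add: set_eq_subset)

lemma mono_ideal_psubset_iff:
  "mono_ideal U \<subset> (mono_ideal V :: ('k::field, 'n::finite) mpoly set) \<longleftrightarrow> U \<subset> V"
  using mono_ideal_subset_iff[where 'k='k and 'n='n] by (simp add: psubset_eq mono_ideal_eq_iff)

lemma mono_ideal_empty [simp]: "mono_ideal {} = {0}"
  unfolding mono_ideal_def by auto

lemma mono_ideal_UNIV [simp]: "mono_ideal UNIV = UNIV"
  unfolding mono_ideal_def by auto

subsection \<open>The primes generated by variables\<close>

text \<open>The exponents of the monomials in the prime generated by the variables in $T$.\<close>

definition var_exponents :: "'n set \<Rightarrow> ('n \<Rightarrow>\<^sub>0 nat) set"
  where "var_exponents T = {v. keys v \<inter> T \<noteq> {}}"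

abbreviation var_prime :: "'n set \<Rightarrow> ('k::field, 'n::finite) mpoly set"
  where "var_prime T \<equiv> mono_ideal (var_exponents T)"

lemma up_closed_var_exponents [simp]: "up_closed (var_exponents T)"
  unfolding up_closed_def var_exponents_def by (auto simp: keys_expo_add)

lemma is_ideal_var_prime [simp]: "is_ideal (var_prime T)"
  by (rule is_ideal_mono_ideal) simp

lemma var_exponents_empty [simp]: "var_exponents {} = {}"
  unfolding var_exponents_def by simp

lemma single_in_var_exponents [simp]: "single i (Suc 0) \<in> var_exponents T \<longleftrightarrow> i \<in> T"
  unfolding var_exponents_def by simp

lemma var_exponents_mono: "T \<subseteq> T' \<Longrightarrow> var_exponents T \<subseteq> var_exponents T'"
  unfolding var_exponents_def by auto

lemma var_exponents_subset_iff: "var_exponents T \<subseteq> var_exponents T' \<longleftrightarrow> T \<subseteq> T'"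
  by (metis single_in_var_exponents var_exponents_mono subset_iff)

text \<open>Minimize the coordinates of the elements of both sets one after the other. A pair with sum $v +
  w$ attains both minima in each coordinate, so it survives every stage and agrees with $(v, w)$
  in the end. This replaces a monomial order, which would require an order on the variables.\<close>

lemma unique_extremal_sum:
  fixes A B :: "('n::finite \<Rightarrow>\<^sub>0 nat) set"
  assumes "finite A" "A \<noteq> {}" "finite B" "B \<noteq> {}"
  shows "\<exists>v\<in>A. \<exists>w\<in>B. \<forall>v'\<in>A. \<forall>w'\<in>B. v' + w' = v + w \<longrightarrow> v' = v \<and> w' = w"
proof -
  have "\<exists>v\<in>A. \<exists>w\<in>B. \<forall>v'\<in>A. \<forall>w'\<in>B. v' + w' = v + w \<longrightarrow>
      (\<forall>i\<in>F. lookup v' i = lookup v i \<and> lookup w' i = lookup w i)" if "finite F" for F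
    using that assms
  proof (induction F arbitrary: A B rule: finite_induct)
    case (insert i F)
    define m where "m Z = Min ((\<lambda>v. lookup v i) ` Z)" for Z :: "('n \<Rightarrow>\<^sub>0 nat) set"
    define L where "L Z = {v \<in> Z. lookup v i = m Z}" for Z
    have m: "m Z \<le> lookup v i" if "finite Z" "v \<in> Z" for Z v
      unfolding m_def using that by (intro Min_le) auto
    have L: "finite (L Z)" "L Z \<noteq> {}" if Z: "finite Z" "Z \<noteq> {}" for Z
    proof -
      have "m Z \<in> (\<lambda>v. lookup v i) ` Z" unfolding m_def using Z by (intro Min_in) auto
      then show "L Z \<noteq> {}" unfolding L_def by auto
      show "finite (L Z)" unfolding L_def using Z by simp
    qed
    obtain v w where vw: "v \<in> L A" "w \<in> L B"
      and uniq: "\<And>v' w'. v' \<in> L A \<Longrightarrow> w' \<in> L B \<Longrightarrow> v' + w' = v + w \<Longrightarrow>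
        \<forall>i\<in>F. lookup v' i = lookup v i \<and> lookup w' i = lookup w i"
      using insert.IH[OF L[OF insert.prems(1,2)] L[OF insert.prems(3,4)]] by blast
    have "\<forall>j\<in>insert i F. lookup v' j = lookup v j \<and> lookup w' j = lookup w j"
      if v': "v' \<in> A" "w' \<in> B" "v' + w' = v + w" for v' w'
    proof -
      have "lookup v' i + lookup w' i = lookup v i + lookup w i"
        using v'(3) by (metis lookup_add)
      moreover have "lookup v i = m A" "lookup w i = m B" using vw unfolding L_def by auto
      moreover have "m A \<le> lookup v' i" "m B \<le> lookup w' i" using m v' insert.prems by auto
      ultimately have "lookup v' i = m A" "lookup w' i = m B" by linarith+
      then show ?thesis using uniq[of v' w'] v' vw unfolding L_def by auto
    qed
    then show ?case using vw unfolding L_def by blast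
  qed auto
  from this[OF finite_UNIV] show ?thesis by (simp add: all_conj_distrib) (meson poly_mapping_eqI)
qed

text \<open>The coefficient of $pq$ at the sum of the extremal exponents outside $P_T$ is a product of two
  nonzero coefficients.\<close>

lemma var_prime_prime:
  fixes p q :: "('k::field, 'n::finite) mpoly"
  assumes "p * q \<in> var_prime T" shows "p \<in> var_prime T \<or> q \<in> var_prime T"
proof (rule ccontr)
  assume neg: "\<not> ?thesis"
  let ?U = "var_exponents T"
  obtain v w where vw: "v \<in> keys p - ?U" "w \<in> keys q - ?U"
    and uniq: "\<And>v' w'. v' \<in> keys p - ?U \<Longrightarrow> w' \<in> keys q - ?U \<Longrightarrow> v' + w' = v + w \<Longrightarrow> v' = v \<and> w' = w"
    using unique_extremal_sum[of "keys p - ?U" "keys q - ?U"] neg unfolding mono_ideal_def by auto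
  have notin: "v + w \<notin> ?U" using vw unfolding var_exponents_def by (auto simp: keys_expo_add)
  have "lookup (p * q) (v + w) =
      (\<Sum>v'\<in>keys p. \<Sum>w'\<in>keys q. (lookup p v' * lookup q w' when v' + w' = v + w))"
    by (rule lookup_mult_sum)
  also have "\<dots> = (\<Sum>v'\<in>keys p. \<Sum>w'\<in>keys q. (if v' = v \<and> w' = w then lookup p v * lookup q w else 0))"
  proof (intro sum.cong refl)
    fix v' w' assume k: "v' \<in> keys p" "w' \<in> keys q"
    have "v' = v \<and> w' = w" if "v' + w' = v + w"
    proof -
      have "v' \<notin> ?U" "w' \<notin> ?U"
        using notin that up_closedD[OF up_closed_var_exponents] up_closedD2[OF up_closed_var_exponents]
        by metis+
      then show ?thesis using uniq k that by simp
    qed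
    then show "(lookup p v' * lookup q w' when v' + w' = v + w) =
        (if v' = v \<and> w' = w then lookup p v * lookup q w else 0)" by (auto simp: when_def)
  qed
  also have "\<dots> = (\<Sum>v'\<in>keys p. if v' = v then lookup p v * lookup q w else 0)"
    using vw by (intro sum.cong) auto
  also have "\<dots> = lookup p v * lookup q w" using vw by simp
  finally have "v + w \<in> keys (p * q)" using vw by (simp add: in_keys_iff)
  then show False using assms notin unfolding mono_ideal_def by blast
qed

lemma mpoly_mult_eq_0:
  fixes p q :: "('k::field, 'n::finite) mpoly"
  assumes "p * q = 0" shows "p = 0 \<or> q = 0"
  using var_prime_prime[of p q "{}"] assms by simp

subsection \<open>Substitution\<close>

lemma monomial_prod_indet:
  fixes v :: "'n::finite \<Rightarrow>\<^sub>0 nat"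
  shows "single v (1 :: 'k::field) = (\<Prod>i\<in>UNIV. indet i ^ lookup v i)"
proof -
  have pow: "indet i ^ k = (single (single i k) 1 :: ('k, 'n) mpoly)" for i k
    by (induction k) (simp_all add: indet_def mult_single flip: single_add)
  have "(\<Prod>i\<in>F. single (single i (lookup v i)) 1 :: ('k, 'n) mpoly) =
      single (\<Sum>i\<in>F. single i (lookup v i)) 1" if "finite F" for F
    using that by induction (simp_all add: mult_single)
  moreover have "(\<Sum>i\<in>UNIV. single i (lookup v i)) = v"
    by (rule poly_mapping_eqI) (simp add: lookup_sum lookup_single when_def)
  ultimately show ?thesis by (simp add: pow)
qed

lemma mpoly_induct [case_names const indet add mult]:
  fixes p :: "('k::field, 'n::finite) mpoly"
  assumes const: "\<And>c. P (single 0 c)" and indet: "\<And>i. P (indet i)"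
    and add: "\<And>p q. P p \<Longrightarrow> P q \<Longrightarrow> P (p + q)" and mult: "\<And>p q. P p \<Longrightarrow> P q \<Longrightarrow> P (p * q)"
  shows "P p"
proof -
  have one: "P 1" using const[of 1] by simp
  have pow: "P (indet i ^ k)" for i k by (induction k) (use one indet mult in auto)
  have "P (\<Prod>i\<in>F. indet i ^ lookup v i)" if "finite F" for F v
    using that by induction (use one pow mult in auto)
  then have mono: "P (single v 1)" for v unfolding monomial_prod_indet by simp
  have sing: "P (single v c)" for v c
    using mult[OF const[of c] mono[of v]] by (simp add: mult_single)
  have "P (\<Sum>v\<in>F. single v (lookup p v))" if "finite F" for F
    using that by induction (use const[of 0] add sing in auto)
  then show ?thesis by (subst poly_mapping_sum_single) simp
qed

definition subst :: "('n \<Rightarrow> ('k, 'n) mpoly) \<Rightarrow> ('k::field, 'n::finite) mpoly \<Rightarrow> ('k, 'n) mpoly"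
  where "subst s p = (\<Sum>v\<in>keys p. single 0 (lookup p v) * (\<Prod>i\<in>UNIV. s i ^ lookup v i))"

lemma subst_add: "subst s (p + q) = subst s p + subst s q"
  unfolding subst_def
  by (rule setsum_keys_plus_distrib[of "\<lambda>v c. single 0 c * (\<Prod>i\<in>UNIV. s i ^ lookup v i)"])
    (simp_all add: single_add distrib_right)

lemma subst_0 [simp]: "subst s 0 = 0" unfolding subst_def by simp

lemma subst_sum: "subst s (\<Sum>i\<in>F. f i) = (\<Sum>i\<in>F. subst s (f i))"
  by (induction F rule: infinite_finite_induct) (auto simp: subst_add)

lemma subst_single: "subst s (single v c) = single 0 c * (\<Prod>i\<in>UNIV. s i ^ lookup v i)"
  unfolding subst_def by simp

lemma subst_mult:
  fixes p q :: "('k::field, 'n::finite) mpoly"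
  shows "subst s (p * q) = subst s p * subst s q"
proof -
  have "p * q = (\<Sum>v\<in>keys p. single v (lookup p v)) * (\<Sum>w\<in>keys q. single w (lookup q w))"
    using poly_mapping_sum_single[of p] poly_mapping_sum_single[of q] by simp
  also have "\<dots> = (\<Sum>v\<in>keys p. \<Sum>w\<in>keys q. single (v + w) (lookup p v * lookup q w))"
    by (simp add: sum_product mult_single)
  finally have "subst s (p * q) =
      (\<Sum>v\<in>keys p. \<Sum>w\<in>keys q. subst s (single (v + w) (lookup p v * lookup q w)))"
    by (simp add: subst_sum)
  also have "\<dots> = (\<Sum>v\<in>keys p. \<Sum>w\<in>keys q. subst s (single v (lookup p v)) * subst s (single w (lookup q w)))"
  proof (intro sum.cong refl)
    fix v w
    have "single 0 (lookup p v * lookup q w) =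
        (single 0 (lookup p v) * single 0 (lookup q w) :: ('k, 'n) mpoly)"
      by (simp add: mult_single)
    then show "subst s (single (v + w) (lookup p v * lookup q w)) =
        subst s (single v (lookup p v)) * subst s (single w (lookup q w))"
      by (simp add: subst_single lookup_add power_add prod.distrib mult_ac)
  qed
  also have "\<dots> = subst s p * subst s q"
    unfolding subst_def[of s p] subst_def[of s q] by (simp add: sum_product subst_single)
  finally show ?thesis .
qed

lemma subst_indet [simp]: "subst s (indet i) = s i"
proof -
  have "(\<Prod>j\<in>UNIV. s j ^ lookup (single i 1) j) = (\<Prod>j\<in>UNIV. if j = i then s i else 1)"
    by (rule prod.cong) (auto simp: lookup_single when_def)
  then show ?thesis unfolding indet_def subst_single by simp
qed

lemma subst_const [simp]: "subst s (single 0 c) = single 0 c"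
  unfolding subst_single by simp

lemma subst_uminus: "subst s (- p) = - subst s p"
  using subst_add[of s p "- p"] by (simp add: eq_neg_iff_add_eq_0 add.commute)

lemma subst_diff: "subst s (p - q) = subst s p - subst s q"
  using subst_add[of s p "- q"] by (simp add: subst_uminus)

text \<open>Modulo $J$ the substitution is the identity on variables, hence everywhere.\<close>

lemma subst_congruent:
  assumes J: "is_ideal J" and "\<And>i. indet i - s i \<in> J"
  shows "p - subst s p \<in> J"
proof (induction p rule: mpoly_induct)
  case (add p q)
  then show ?case using ideal_add[OF J add] by (simp add: subst_add algebra_simps)
next
  case (mult p q)
  have "p * q - subst s (p * q) = q * (p - subst s p) + subst s p * (q - subst s q)"
    by (simp add: subst_mult algebra_simps)
  then show ?case using ideal_add[OF J ideal_mult[OF J mult(1)] ideal_mult[OF J mult(2)]] by metis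
qed (use assms ideal_0[OF J] in auto)

lemma is_ideal_subst_kernel: "is_ideal {p. subst s p = 0}"
  by (rule is_idealI) (auto simp: subst_add subst_mult)

text \<open>By the congruence, a substitution that kills $J$ has kernel exactly $J$. So $S/J$ embeds into
  the domain $S$, and an element acts as a nonzerodivisor when its image does not vanish.\<close>

lemma nonzerodivisor_by_subst:
  assumes J: "is_ideal J" and "\<And>i. indet i - s i \<in> J" and "J \<subseteq> {p. subst s p = 0}"
    and "subst s f \<noteq> 0" "f * b \<in> J"
  shows "b \<in> J"
proof -
  have "subst s f * subst s b = 0" using assms by (auto simp flip: subst_mult)
  then have "subst s b = 0" using mpoly_mult_eq_0 assms by blast
  then show ?thesis using subst_congruent[OF J assms(2), of b] by simp
qed

subsection \<open>The ideal of all variables\<close>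

lemma monomial_split_indet:
  assumes "i \<in> keys v"
  shows "single v (1::'k::field) = single (v - single i 1) 1 * indet i"
  using expo_minus_single[OF assms] unfolding indet_def by (simp add: mult_single add.commute)

lemma var_prime_UNIV_eq:
  "p \<in> (var_prime UNIV :: ('k::field, 'n::finite) mpoly set) \<longleftrightarrow> (\<exists>c. p = (\<Sum>i\<in>UNIV. c i * indet i))"
proof
  assume "\<exists>c. p = (\<Sum>i\<in>UNIV. c i * indet i)"
  moreover have "indet i \<in> (var_prime UNIV :: ('k, 'n) mpoly set)" for i
    unfolding indet_def by simp
  ultimately show "p \<in> var_prime UNIV"
    by (auto intro!: ideal_sum ideal_mult)
next
  let ?J = "{p :: ('k, 'n) mpoly. \<exists>c. p = (\<Sum>i\<in>UNIV. c i * indet i)}"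
  assume p: "p \<in> var_prime UNIV"
  have J: "is_ideal ?J"
  proof (rule is_idealI)
    show "0 \<in> ?J" by (auto intro: exI[of _ "\<lambda>_. 0"])
    show "p + q \<in> ?J" if pq: "p \<in> ?J" "q \<in> ?J" for p q
    proof -
      obtain c d where "p = (\<Sum>i\<in>UNIV. c i * indet i)" "q = (\<Sum>i\<in>UNIV. d i * indet i)"
        using pq by blast
      then show ?thesis by (auto intro!: exI[of _ "\<lambda>i. c i + d i"] simp: distrib_right sum.distrib)
    qed
    show "s * p \<in> ?J" if p: "p \<in> ?J" for s p
    proof -
      obtain c where "p = (\<Sum>i\<in>UNIV. c i * indet i)" using p by blast
      then show ?thesis by (auto intro!: exI[of _ "\<lambda>i. s * c i"] simp: sum_distrib_left mult.assoc)
    qed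
  qed
  have "p \<in> ?J"
  proof (rule in_ideal_if_monomials_in_ideal[OF J])
    fix v assume "v \<in> keys p"
    then obtain i where i: "i \<in> keys v" using p unfolding mono_ideal_def var_exponents_def by blast
    have "(\<Sum>j\<in>UNIV. (if j = i then 1 else 0) * indet j) = (\<Sum>j\<in>UNIV. if j = i then indet j else 0 :: ('k, 'n) mpoly)"
      by (rule sum.cong) auto
    then have "indet i \<in> ?J" by (auto intro!: exI[of _ "\<lambda>j. if j = i then 1 else 0"])
    then show "single v 1 \<in> ?J" unfolding monomial_split_indet[OF i] by (rule ideal_mult[OF J])
  qed
  then show "\<exists>c. p = (\<Sum>i\<in>UNIV. c i * indet i)" by simp
qed

section \<open>The Krull dimension of a polynomial ring\<close>

definition is_prime :: "'a::comm_ring_1 set \<Rightarrow> bool"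
  where "is_prime P \<longleftrightarrow> is_ideal P \<and> P \<noteq> UNIV \<and> (\<forall>a b. a * b \<in> P \<longrightarrow> a \<in> P \<or> b \<in> P)"

lemma is_prime_one: "is_prime P \<Longrightarrow> 1 \<notin> P"
  unfolding is_prime_def using ideal_mult[of P 1] by force

lemma is_prime_power: "is_prime P \<Longrightarrow> a \<notin> P \<Longrightarrow> a ^ m \<notin> P"
  by (induction m) (auto simp: is_prime_one, auto simp: is_prime_def)

lemma is_prime_var_prime: "is_prime (var_prime T :: ('k::field, 'n::finite) mpoly set)"
proof -
  have "(1 :: ('k, 'n) mpoly) \<notin> var_prime T"
    using single_in_mono_ideal[of 0 "var_exponents T"] by (simp add: var_exponents_def)
  then show ?thesis unfolding is_prime_def using var_prime_prime by auto
qed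

subsection \<open>Algebraic dependence\<close>

definition exp_bounded :: "nat \<Rightarrow> ('k::field, 'n::finite) mpoly \<Rightarrow> bool"
  where "exp_bounded d p \<longleftrightarrow> (\<forall>v\<in>keys p. \<forall>i. lookup v i \<le> d)"

lemma exp_bounded_mult:
  assumes "exp_bounded d p" "exp_bounded e q" shows "exp_bounded (d + e) (p * q)"
  unfolding exp_bounded_def
proof (intro ballI allI)
  fix v i assume "v \<in> keys (p * q)"
  then obtain a b where "v = a + b" "a \<in> keys p" "b \<in> keys q" using keys_mult[of p q] by blast
  then show "lookup v i \<le> d + e"
    using assms unfolding exp_bounded_def by (simp add: lookup_add add_mono)
qed

lemma exp_bounded_one: "exp_bounded 0 1"
  unfolding exp_bounded_def by simp

lemma exp_bounded_power: "exp_bounded d p \<Longrightarrow> exp_bounded (k * d) (p ^ k)"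
  by (induction k) (auto simp: exp_bounded_one intro: exp_bounded_mult)

lemma exp_bounded_prod:
  "finite A \<Longrightarrow> (\<And>i. i \<in> A \<Longrightarrow> exp_bounded (d i) (f i)) \<Longrightarrow> exp_bounded (sum d A) (prod f A)"
  by (induction A rule: finite_induct) (auto simp: exp_bounded_one intro: exp_bounded_mult)

lemma exp_bounded_mono: "exp_bounded d p \<Longrightarrow> d \<le> e \<Longrightarrow> exp_bounded e p"
  unfolding exp_bounded_def using order_trans by blast

lemma exp_bounded_exists: "\<exists>d. exp_bounded d p"
proof -
  let ?S = "(\<lambda>(v, i). lookup v i) ` (keys p \<times> UNIV)"
  have "finite ?S" by simp
  then have "lookup v i \<le> Max ?S" if "v \<in> keys p" for v i using that by (intro Max_ge) auto
  then show ?thesis unfolding exp_bounded_def by blast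
qed

lemma card_exponent_box:
  "finite {v :: 'n::finite \<Rightarrow>\<^sub>0 nat. \<forall>i. lookup v i \<le> d}"
  "card {v :: 'n::finite \<Rightarrow>\<^sub>0 nat. \<forall>i. lookup v i \<le> d} \<le> Suc d ^ card (UNIV :: 'n set)"
proof -
  let ?B = "{v :: 'n \<Rightarrow>\<^sub>0 nat. \<forall>i. lookup v i \<le> d}"
  let ?P = "PiE (UNIV :: 'n set) (\<lambda>_. {..d})"
  have inj: "inj_on lookup ?B" by (auto intro!: inj_onI simp: poly_mapping.lookup_inject)
  have sub: "lookup ` ?B \<subseteq> ?P" by auto
  have fin: "finite ?P" by (intro finite_PiE) auto
  show "finite ?B" using finite_imageD[OF finite_subset[OF sub fin] inj] .
  have "card ?B = card (lookup ` ?B)" using card_image[OF inj] by simp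
  also have "\<dots> \<le> card ?P" by (rule card_mono[OF fin sub])
  finally show "card ?B \<le> Suc d ^ card (UNIV :: 'n set)" by (simp add: card_PiE)
qed

text \<open>The $(N + 1)^l$ power products with exponents up to $N$ lie in a space of polynomials of
  dimension $O(N^{l - 1})$, so they are linearly dependent or not even distinct once $N$ is large.\<close>

lemma algebraic_dependence:
  fixes a :: "nat \<Rightarrow> ('k::field, 'n::finite) mpoly"
  assumes l: "l = Suc (card (UNIV :: 'n set))"
  shows "\<exists>F c. finite F \<and> F \<noteq> {} \<and> F \<subseteq> PiE {..<l} (\<lambda>_. UNIV) \<and> (\<forall>\<mu>\<in>F. c \<mu> \<noteq> 0) \<and>
    (\<Sum>\<mu>\<in>F. single 0 (c \<mu>) * (\<Prod>i<l. a i ^ \<mu> i)) = 0"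
proof -
  interpret V: vector_space "\<lambda>c (p :: ('k, 'n) mpoly). single 0 c * p"
    by unfold_locales (simp_all add: distrib_left distrib_right single_add mult_single flip: mult.assoc)
  let ?n = "card (UNIV :: 'n set)"
  have "\<forall>i. \<exists>d. exp_bounded d (a i)" using exp_bounded_exists by blast
  then obtain d where d: "\<And>i. exp_bounded (d i) (a i)" by metis
  define D where "D = Max (d ` {..<l})"
  have D: "exp_bounded D (a i)" if "i < l" for i
    unfolding D_def by (rule exp_bounded_mono[OF d Max_ge]) (use that in auto)
  \<comment> \<open>large enough that the number of power products exceeds the dimension of the target below\<close>
  define N where "N = (l * D + 1) ^ ?n"
  define E where "E = PiE {..<l} (\<lambda>_. {..N})"
  define g where "g \<mu> = (\<Prod>i<l. a i ^ \<mu> i)" for \<mu> :: "nat \<Rightarrow> nat"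
  let ?B = "{v :: 'n \<Rightarrow>\<^sub>0 nat. \<forall>i. lookup v i \<le> l * N * D}"
  let ?M = "(\<lambda>v. single v (1 :: 'k)) ` ?B"
  have finE: "finite E" unfolding E_def by (intro finite_PiE) auto
  have E_sub: "E \<subseteq> PiE {..<l} (\<lambda>_. UNIV)" unfolding E_def by (intro PiE_mono) auto
  have "g ` E \<subseteq> V.span ?M"
  proof clarify
    fix \<mu> assume "\<mu> \<in> E"
    then have \<mu>: "\<mu> i \<le> N" if "i < l" for i using that unfolding E_def by auto
    have 1: "exp_bounded (\<Sum>i<l. \<mu> i * D) (g \<mu>)"
      unfolding g_def by (rule exp_bounded_prod, simp, rule exp_bounded_power, rule D, simp)
    have "(\<Sum>i<l. \<mu> i * D) \<le> (\<Sum>i<l. N * D)"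
      by (intro sum_mono mult_right_mono) (use \<mu> in auto)
    also have "\<dots> = l * N * D" by simp
    finally have bd: "exp_bounded (l * N * D) (g \<mu>)" by (rule exp_bounded_mono[OF 1])
    have "single v (lookup (g \<mu>) v) \<in> V.span ?M" if "v \<in> keys (g \<mu>)" for v
    proof -
      have "single v 1 \<in> ?M" using that bd unfolding exp_bounded_def by (intro imageI) simp
      from V.span_scale[OF V.span_base[OF this], of "lookup (g \<mu>) v"] show ?thesis
        by (simp add: mult_single)
    qed
    then show "g \<mu> \<in> V.span ?M"
      by (subst poly_mapping_sum_single) (rule V.span_sum)
  qed
  moreover have "card ?M < card E"
  proof -
    have "card ?M \<le> Suc (l * N * D) ^ ?n"
      using card_image_le[OF card_exponent_box(1)] card_exponent_box(2) order_trans by blast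
    also have "\<dots> \<le> ((l * D + 1) * Suc N) ^ ?n"
      by (intro power_mono) (auto simp: algebra_simps)
    also have "\<dots> = N * Suc N ^ ?n" by (simp only: power_mult_distrib flip: N_def)
    also have "\<dots> < Suc N ^ l" unfolding l by simp
    also have "\<dots> = card E" unfolding E_def by (simp add: card_PiE)
    finally show ?thesis .
  qed
  moreover have "finite ?M" by (rule finite_imageI[OF card_exponent_box(1)])
  ultimately have indep: "\<not> (inj_on g E \<and> V.independent (g ` E))"
    using V.independent_span_bound[of ?M "g ` E"] card_image[of g E] by (metis not_le)
  show ?thesis
  proof (cases "inj_on g E")
    case False
    then obtain \<mu> \<nu> where mn: "\<mu> \<in> E" "\<nu> \<in> E" "\<mu> \<noteq> \<nu>" "g \<mu> = g \<nu>" unfolding inj_on_def by blast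
    \<comment> \<open>two equal power products with different exponents are a relation by themselves\<close>
    let ?c = "\<lambda>\<rho>. if \<rho> = \<mu> then 1 else - 1 :: 'k"
    have "(\<Sum>\<rho>\<in>{\<mu>, \<nu>}. single 0 (?c \<rho>) * g \<rho>) = 0"
      using mn by (simp add: single_uminus)
    then show ?thesis
      using mn E_sub unfolding g_def by (intro exI[of _ "{\<mu>, \<nu>}"] exI[of _ ?c]) auto
  next
    case True
    then have "V.dependent (g ` E)" using indep by simp
    then obtain S u where S: "finite S" "S \<subseteq> g ` E" "(\<Sum>v\<in>S. single 0 (u v) * v) = 0" "\<exists>v\<in>S. u v \<noteq> 0"
      unfolding V.dependent_explicit by blast
    define F where "F = {\<mu> \<in> E. g \<mu> \<in> S \<and> u (g \<mu>) \<noteq> 0}"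
    have injF: "inj_on g F" using True by (rule inj_on_subset) (auto simp: F_def)
    have img: "g ` F = {v \<in> S. u v \<noteq> 0}" using S(2) unfolding F_def by auto
    have "(\<Sum>\<mu>\<in>F. single 0 (u (g \<mu>)) * g \<mu>) = (\<Sum>v\<in>g ` F. single 0 (u v) * v)"
      using injF by (simp add: sum.reindex)
    also have "\<dots> = (\<Sum>v\<in>S. single 0 (u v) * v)"
      unfolding img using S(1) by (intro sum.mono_neutral_left) auto
    also have "\<dots> = 0" by (rule S(3))
    finally have "(\<Sum>\<mu>\<in>F. single 0 (u (g \<mu>)) * (\<Prod>i<l. a i ^ \<mu> i)) = 0" unfolding g_def .
    moreover have "finite F" "F \<subseteq> PiE {..<l} (\<lambda>_. UNIV)" "\<forall>\<mu>\<in>F. u (g \<mu>) \<noteq> 0"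
      unfolding F_def using finE E_sub by auto
    moreover have "F \<noteq> {}" using img S(4) by auto
    ultimately show ?thesis by (intro exI[of _ F] exI[of _ "\<lambda>\<mu>. u (g \<mu>)"]) blast
  qed
qed

subsection \<open>Chains of primes\<close>

text \<open>In a longer chain choose $a_i \<in> Q_{i + 1}$ outside $Q_i$ and an algebraic relation between
  them. Divide the relation by the highest possible power of $a_0$, which is legitimate modulo
  $Q_0$, and then drop the terms that still contain $a_0$, which is legitimate modulo $Q_1$. This
  leaves a nontrivial relation modulo $Q_1$ between $a_1, a_2, \ldots$. At the end a nonzero
  constant lies in a prime.\<close>

lemma prime_chain_length_le:
  fixes Q :: "nat \<Rightarrow> ('k::field, 'n::finite) mpoly set"
  assumes prime: "\<And>i. i \<le> k \<Longrightarrow> is_prime (Q i)" and chain: "\<And>i. i < k \<Longrightarrow> Q i \<subset> Q (Suc i)"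
  shows "k \<le> card (UNIV :: 'n set)"
proof (rule ccontr)
  define l where "l = Suc (card (UNIV :: 'n set))"
  assume "\<not> k \<le> card (UNIV :: 'n set)"
  then have lk: "l \<le> k" unfolding l_def by simp
  have "\<forall>i. \<exists>b. i < l \<longrightarrow> b \<in> Q (Suc i) - Q i" using chain lk by (meson psubset_imp_ex_mem less_le_trans)
  then obtain a where a: "\<And>i. i < l \<Longrightarrow> a i \<in> Q (Suc i) - Q i" by metis
  obtain F0 c where F0: "finite F0" "F0 \<noteq> {}" "F0 \<subseteq> PiE {..<l} (\<lambda>_. UNIV)" "\<forall>\<mu>\<in>F0. c \<mu> \<noteq> 0"
    and dep: "(\<Sum>\<mu>\<in>F0. single 0 (c \<mu>) * (\<Prod>i<l. a i ^ \<mu> i)) = 0"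
    using algebraic_dependence[OF l_def, of a] by blast
  define t where "t j \<mu> = single 0 (c \<mu>) * (\<Prod>i\<in>{j..<l}. a i ^ \<mu> i)" for j and \<mu> :: "nat \<Rightarrow> nat"
  \<comment> \<open>the terms that survive stage \<open>j\<close> are distinguished by the exponents of $a_j, \ldots, a_{l - 1}$ alone\<close>
  have "\<exists>F\<subseteq>F0. F \<noteq> {} \<and> (\<forall>\<mu>\<in>F. \<forall>\<nu>\<in>F. (\<forall>i\<in>{j..<l}. \<mu> i = \<nu> i) \<longrightarrow> \<mu> = \<nu>) \<and> (\<Sum>\<mu>\<in>F. t j \<mu>) \<in> Q j"
    if "j \<le> l" for j
    using that
  proof (induction j)
    case 0
    have "(\<Sum>\<mu>\<in>F0. t 0 \<mu>) \<in> Q 0"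
      using dep ideal_0[of "Q 0"] prime[of 0] unfolding t_def is_prime_def
      by (simp add: lessThan_atLeast0)
    moreover have "\<forall>\<mu>\<in>F0. \<forall>\<nu>\<in>F0. (\<forall>i\<in>{0..<l}. \<mu> i = \<nu> i) \<longrightarrow> \<mu> = \<nu>"
    proof (intro ballI impI)
      fix \<mu> \<nu> assume "\<mu> \<in> F0" "\<nu> \<in> F0" "\<forall>i\<in>{0..<l}. \<mu> i = \<nu> i"
      then show "\<mu> = \<nu>"
        using F0(3) by (intro PiE_ext[of _ "{..<l}" "\<lambda>_. UNIV"]) auto
    qed
    ultimately show ?case using F0(2) by blast
  next
    case (Suc j)
    have "j \<le> l" using Suc.prems by simp
    from Suc.IH[OF this] obtain F where F: "F \<subseteq> F0" "F \<noteq> {}" "(\<Sum>\<mu>\<in>F. t j \<mu>) \<in> Q j"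
      and uniq: "\<And>\<mu> \<nu>. \<mu> \<in> F \<Longrightarrow> \<nu> \<in> F \<Longrightarrow> (\<forall>i\<in>{j..<l}. \<mu> i = \<nu> i) \<Longrightarrow> \<mu> = \<nu>"
      by (elim exE conjE) blast
    have finF: "finite F" using F(1) F0(1) finite_subset by blast
    have pr: "is_prime (Q j)" "is_ideal (Q j)" "is_ideal (Q (Suc j))"
      using prime[of j] prime[of "Suc j"] Suc.prems lk unfolding is_prime_def by auto
    define m where "m = Min ((\<lambda>\<mu>. \<mu> j) ` F)"
    define G where "G = {\<mu> \<in> F. \<mu> j = m}"
    have m_le: "m \<le> \<mu> j" if "\<mu> \<in> F" for \<mu> unfolding m_def using finF that by (intro Min_le) auto
    have "m \<in> (\<lambda>\<mu>. \<mu> j) ` F" unfolding m_def using finF F(2) by (intro Min_in) auto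
    then have "G \<noteq> {}" unfolding G_def by auto
    have t_Suc: "t j \<mu> = a j ^ \<mu> j * t (Suc j) \<mu>" for \<mu>
      unfolding t_def using Suc.prems by (simp add: prod.atLeast_Suc_lessThan mult_ac)
    define r where "r = (\<Sum>\<mu>\<in>F - G. a j ^ (\<mu> j - Suc m) * t (Suc j) \<mu>)"
    have "(\<Sum>\<mu>\<in>F. t j \<mu>) = (\<Sum>\<mu>\<in>F - G. t j \<mu>) + (\<Sum>\<mu>\<in>G. t j \<mu>)"
      using finF by (intro sum.subset_diff) (auto simp: G_def)
    also have "(\<Sum>\<mu>\<in>G. t j \<mu>) = a j ^ m * (\<Sum>\<mu>\<in>G. t (Suc j) \<mu>)"
      unfolding sum_distrib_left by (rule sum.cong) (auto simp: t_Suc G_def)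
    also have "(\<Sum>\<mu>\<in>F - G. t j \<mu>) = a j ^ m * (a j * r)"
      unfolding r_def sum_distrib_left
    proof (rule sum.cong)
      fix \<mu> assume "\<mu> \<in> F - G"
      then have "\<mu> j = m + 1 + (\<mu> j - Suc m)" using m_le[of \<mu>] unfolding G_def by auto
      then have "a j ^ \<mu> j = a j ^ m * (a j * a j ^ (\<mu> j - Suc m))"
        by (metis power_add power_one_right mult.assoc)
      then show "t j \<mu> = a j ^ m * (a j * (a j ^ (\<mu> j - Suc m) * t (Suc j) \<mu>))"
        by (simp add: t_Suc mult.assoc)
    qed simp
    finally have "a j ^ m * (a j * r + (\<Sum>\<mu>\<in>G. t (Suc j) \<mu>)) \<in> Q j"
      using F(3) by (simp add: distrib_left)
    moreover have "a j ^ m \<notin> Q j" using is_prime_power[OF pr(1)] a[of j] Suc.prems by simp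
    ultimately have "a j * r + (\<Sum>\<mu>\<in>G. t (Suc j) \<mu>) \<in> Q j"
      using pr(1) unfolding is_prime_def by blast
    then have "a j * r + (\<Sum>\<mu>\<in>G. t (Suc j) \<mu>) \<in> Q (Suc j)" using chain[of j] Suc.prems lk by auto
    moreover have "a j * r \<in> Q (Suc j)"
      using a[of j] Suc.prems ideal_mult2[OF pr(3)] by simp
    ultimately have "(\<Sum>\<mu>\<in>G. t (Suc j) \<mu>) \<in> Q (Suc j)"
      using ideal_add_cancel(1)[OF pr(3)] by blast
    moreover have "\<mu> = \<nu>" if "\<mu> \<in> G" "\<nu> \<in> G" "\<forall>i\<in>{Suc j..<l}. \<mu> i = \<nu> i" for \<mu> \<nu>
    proof (rule uniq)
      show "\<forall>i\<in>{j..<l}. \<mu> i = \<nu> i" 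
        using that unfolding G_def by (auto simp: Suc_le_eq le_less)
    qed (use that in \<open>auto simp: G_def\<close>)
    moreover have "G \<subseteq> F0" unfolding G_def using F(1) by auto
    ultimately show ?case using \<open>G \<noteq> {}\<close> by blast
  qed
  from this[OF order_refl] obtain F where F: "F \<subseteq> F0" "F \<noteq> {}" "(\<Sum>\<mu>\<in>F. t l \<mu>) \<in> Q l" "\<And>\<mu> \<nu>. \<mu> \<in> F \<Longrightarrow> \<nu> \<in> F \<Longrightarrow> \<mu> = \<nu>"
    by auto
  then obtain \<mu> where \<mu>: "F = {\<mu>}" by blast
  have Ql: "is_prime (Q l)" using prime lk by simp
  have "single 0 (c \<mu>) \<in> Q l" using F(3) unfolding \<mu> t_def by simp
  then have "single 0 (inverse (c \<mu>)) * single 0 (c \<mu>) \<in> Q l"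
    using Ql ideal_mult unfolding is_prime_def by blast
  then have "1 \<in> Q l" using F(1) F0(4) \<mu> by (simp add: mult_single)
  then show False using is_prime_one[OF Ql] by simp
qed

lemma var_prime_chain:
  fixes T T' :: "'n::finite set"
  assumes "T \<subseteq> T'"
  obtains W where "W 0 = T" "W (card (T' - T)) = T'" "\<And>i. i < card (T' - T) \<Longrightarrow> W i \<subset> W (Suc i)"
    "\<And>i. T \<subseteq> W i"
proof -
  obtain e where e: "bij_betw e {..<card (T' - T)} (T' - T)"
    using ex_bij_betw_nat_finite[of "T' - T"] by (auto simp: lessThan_atLeast0)
  define W where "W i = T \<union> e ` {..<i}" for i
  show thesis
  proof
    show "W (card (T' - T)) = T'" using e assms unfolding W_def bij_betw_def by auto
    show "W i \<subset> W (Suc i)" if "i < card (T' - T)" for i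
    proof -
      have "e i \<notin> T" using e that unfolding bij_betw_def by blast
      moreover have "e i \<noteq> e j" if "j < i" for j
        using e \<open>i < card (T' - T)\<close> that unfolding bij_betw_def inj_on_def by force
      ultimately have "e i \<notin> W i" "e i \<in> W (Suc i)" unfolding W_def by auto
      then show ?thesis unfolding W_def by (auto simp: lessThan_Suc)
    qed
  qed (auto simp: W_def)
qed

lemma var_prime_psubset_iff:
  "var_prime T \<subset> (var_prime T' :: ('k::field, 'n::finite) mpoly set) \<longleftrightarrow> T \<subset> T'"
  unfolding mono_ideal_psubset_iff by (simp add: less_le_not_le var_exponents_subset_iff)

text \<open>A chain above $P_T$ is prolonged downwards by the $P_W$ with $W$ in a maximal chain of subsets
  of $T$.\<close>

lemma prime_chain_above_var_prime:
  fixes Q :: "nat \<Rightarrow> ('k::field, 'n::finite) mpoly set"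
  assumes prime: "\<And>i. i \<le> k \<Longrightarrow> is_prime (Q i)" and chain: "\<And>i. i < k \<Longrightarrow> Q i \<subset> Q (Suc i)"
    and T: "var_prime T \<subseteq> Q 0"
  shows "card T + k \<le> card (UNIV :: 'n set)"
proof -
  obtain W where W: "W (card T) = T" "\<And>i. i < card T \<Longrightarrow> W i \<subset> W (Suc i)"
    by (rule var_prime_chain[of "{}" T]) auto
  define R where "R i = (if i < card T then var_prime (W i) else Q (i - card T))" for i
  show ?thesis
  proof (rule prime_chain_length_le[of _ R])
    show "is_prime (R i)" if "i \<le> card T + k" for i
      using that prime is_prime_var_prime unfolding R_def by auto
    show "R i \<subset> R (Suc i)" if i: "i < card T + k" for i
    proof -
      consider "Suc i < card T" | "Suc i = card T" | "card T \<le> i" by linarith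
      then show ?thesis
      proof cases
        case 2
        then have "W i \<subset> T" using W(2)[of i] W(1) by simp
        then have "var_prime (W i) \<subset> (var_prime T :: ('k, 'n) mpoly set)"
          by (simp add: var_prime_psubset_iff)
        also note T
        finally show ?thesis using 2 unfolding R_def by simp
      next
        case 3
        then show ?thesis using chain[of "i - card T"] i unfolding R_def by (auto simp: Suc_diff_le)
      qed (use W(2) in \<open>simp add: R_def var_prime_psubset_iff\<close>)
    qed
  qed
qed

section \<open>Filtrations by boxes\<close>

text \<open>The exponents of the Stanley space $x^g K[x_i : i \<notin> T]$. When $U$ and $U$ together with
  this set are both up-closed and the two are disjoint, the corresponding quotient of monomial
  ideals is $S/P_T$ shifted by $g$ (\<open>box_colon\<close>).\<close>

definition box :: "('n \<Rightarrow>\<^sub>0 nat) \<Rightarrow> 'n set \<Rightarrow> ('n \<Rightarrow>\<^sub>0 nat) set"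
  where "box g T = {g + v |v. keys v \<inter> T = {}}"

fun box_filtration ::
  "('n \<Rightarrow>\<^sub>0 nat) set \<Rightarrow> (('n \<Rightarrow>\<^sub>0 nat) \<times> 'n set) list \<Rightarrow> ('n \<Rightarrow>\<^sub>0 nat) set \<Rightarrow> bool"
  where "box_filtration U [] V \<longleftrightarrow> U = V"
  | "box_filtration U ((g, T) # D) V \<longleftrightarrow>
      U \<inter> box g T = {} \<and> up_closed (U \<union> box g T) \<and> box_filtration (U \<union> box g T) D V"

lemma up_closed_UNIV [simp]: "up_closed UNIV"
  unfolding up_closed_def by simp

lemma box_filtration_append:
  "box_filtration U D V \<Longrightarrow> box_filtration V D' W \<Longrightarrow> box_filtration U (D @ D') W"
  by (induction D arbitrary: U) auto

lemma box_filtration_subset: "box_filtration U D V \<Longrightarrow> U \<subseteq> V"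
proof (induction D arbitrary: U)
  case (Cons b D)
  then show ?case by (cases b) fastforce
qed simp

lemma in_box_iff: "g + v \<in> box g T \<longleftrightarrow> keys v \<inter> T = {}"
  unfolding box_def by auto

lemma self_in_box [simp]: "g \<in> box g T"
  using in_box_iff[of g 0 T] by simp

lemma box_add: "box (w + g) T = (+) w ` box g T"
  unfolding box_def by (auto simp: add.assoc)

lemma box_colon:
  assumes "up_closed (U \<union> box g T)" "U \<inter> box g T = {}"
  shows "g + v \<in> U \<longleftrightarrow> v \<in> var_exponents T"
proof -
  have "g + v \<in> U \<union> box g T" using up_closedD[OF assms(1)] by simp
  then show ?thesis using assms(2) unfolding var_exponents_def by (auto simp: in_box_iff)
qed

text \<open>Multiplication by $x^w$ embeds $S/(A : x^w)$ into $S/A$.\<close>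

lemma box_filtration_shift:
  assumes "up_closed A" "box_filtration {s. w + s \<in> A} D C"
  shows "box_filtration A (map (\<lambda>(g, T). (w + g, T)) D) (A \<union> (+) w ` C)"
  using assms
proof (induction D arbitrary: A)
  case (Cons b D)
  obtain g T where b: "b = (g, T)" by force
  let ?J = "{s. w + s \<in> A}" and ?A' = "A \<union> box (w + g) T"
  have disj: "?J \<inter> box g T = {}" and up: "up_closed (?J \<union> box g T)"
    and rest: "box_filtration (?J \<union> box g T) D C"
    using Cons.prems(2) unfolding b by auto
  have "A \<inter> box (w + g) T = {}" using disj unfolding box_add by auto
  moreover have up': "up_closed ?A'"
    unfolding up_closed_def
  proof (intro ballI allI)
    fix v u assume "v \<in> ?A'"
    then show "v + u \<in> ?A'"
    proof
      assume "v \<in> box (w + g) T"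
      then obtain s where "v = w + s" "s \<in> box g T" unfolding box_add by auto
      then show ?thesis using up_closedD[OF up, of s u] unfolding box_add by (auto simp: add.assoc)
    qed (use up_closedD[OF Cons.prems(1)] in blast)
  qed
  moreover have "{s. w + s \<in> ?A'} = ?J \<union> box g T" unfolding box_add by auto
  then have "box_filtration ?A' (map (\<lambda>(g, T). (w + g, T)) D) (?A' \<union> (+) w ` C)"
    using Cons.IH[OF up'] rest by simp
  moreover have "?A' \<union> (+) w ` C = A \<union> (+) w ` C"
    using box_filtration_subset[OF rest] unfolding box_add by auto
  ultimately show ?case unfolding b by simp
qed auto

definition up_gen :: "('n \<Rightarrow>\<^sub>0 nat) set \<Rightarrow> ('n \<Rightarrow>\<^sub>0 nat) set"
  where "up_gen G = {u + v |u v. u \<in> G}"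

lemma up_closed_up_gen [simp]: "up_closed (up_gen G)"
  unfolding up_closed_def up_gen_def by (force simp: add.assoc)

lemma up_closed_Un: "up_closed U \<Longrightarrow> up_closed V \<Longrightarrow> up_closed (U \<union> V)"
  unfolding up_closed_def by blast

lemma up_gen_insert: "up_gen (insert u G) = range ((+) u) \<union> up_gen G"
  unfolding up_gen_def by auto

lemma up_gen_empty [simp]: "up_gen {} = {}"
  unfolding up_gen_def by simp

lemma up_gen_self: "u \<in> G \<Longrightarrow> u \<in> up_gen G"
  unfolding up_gen_def by (auto intro: exI[of _ 0] exI[of _ u])

lemma expo_le_add_coprime:
  fixes u w s :: "'n \<Rightarrow>\<^sub>0 nat"
  assumes "w + s = u + v" "keys w \<inter> keys u = {}" shows "\<exists>v'. s = u + v'"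
proof (rule exI)
  show "s = u + (s - u)"
  proof (rule expo_minus)
    fix i
    show "lookup u i \<le> lookup s i"
    proof (cases "i \<in> keys u")
      case True
      then have "lookup w i = 0" using assms(2) by (auto simp: in_keys_iff)
      then show ?thesis using arg_cong[OF assms(1), of "\<lambda>v. lookup v i"] by (simp add: lookup_add)
    qed (simp add: in_keys_iff)
  qed
qed

text \<open>A monomial coprime to all generators is a nonzerodivisor modulo a monomial ideal.\<close>

lemma up_gen_colon:
  assumes "\<And>u. u \<in> G \<Longrightarrow> keys w \<inter> keys u = {}"
  shows "w + s \<in> up_gen G \<longleftrightarrow> s \<in> up_gen G"
proof
  assume "w + s \<in> up_gen G"
  then obtain u v where "u \<in> G" "w + s = u + v" unfolding up_gen_def by auto
  then show "s \<in> up_gen G"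
    using expo_le_add_coprime[of w s u v] assms unfolding up_gen_def by blast
qed (rule up_closedD2[OF up_closed_up_gen])

abbreviation coprime_exponents :: "('n \<Rightarrow>\<^sub>0 nat) list \<Rightarrow> bool"
  where "coprime_exponents us \<equiv> sorted_wrt (\<lambda>u v. keys u \<inter> keys v = {}) us"

text \<open>The prime $P_T$ is carried along for the induction. Let $u$ be the first generator and $w$ a
  divisor of it. Removing a variable $y$ from $w = y w'$ enlarges the ideal $P_T + (w, \ldots)$ by
  a copy of $S$ modulo its colon by $w'$, and by coprimality that colon is $P_{T \cup {y}}$ plus
  the remaining generators. Starting at $w = u$ this reaches $w = 1$, where the ideal is
  everything.\<close>

lemma box_filtration_quotient:
  assumes "coprime_exponents us" "\<And>u. u \<in> set us \<Longrightarrow> keys u \<inter> T = {}"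
  shows "\<exists>D. box_filtration (var_exponents T \<union> up_gen (set us)) D UNIV \<and>
    (\<forall>(g, T')\<in>set D. T \<subseteq> T' \<and> T' \<subseteq> T \<union> (\<Union>u\<in>set us. keys u) \<and>
      (\<forall>u\<in>set us. card (keys u \<inter> T') = 1))"
  using assms
proof (induction us arbitrary: T)
  case Nil
  have "var_exponents T \<union> box 0 T = UNIV" "var_exponents T \<inter> box 0 T = {}"
    unfolding var_exponents_def box_def by auto
  then have "box_filtration (var_exponents T) [(0, T)] UNIV" by simp
  then show ?case by (intro exI[of _ "[(0, T)]"]) simp
next
  case (Cons u us)
  let ?V = "\<lambda>w. var_exponents T \<union> up_gen (set (w # us))"
  let ?good = "\<lambda>D. \<forall>(g, T')\<in>set D. T \<subseteq> T' \<and> T' \<subseteq> T \<union> (\<Union>v\<in>set (u # us). keys v) \<and>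
      (\<forall>v\<in>set (u # us). card (keys v \<inter> T') = 1)"
  have cop: "keys u \<inter> keys v = {}" if "v \<in> set us" for v using Cons.prems(1) that by auto
  have "\<exists>D. box_filtration (?V w) D UNIV \<and> ?good D" if "keys w \<subseteq> keys u" for w
    using that
  proof (induction "\<Sum>i\<in>keys u. lookup w i" arbitrary: w rule: less_induct)
    case less
    show ?case
    proof (cases "w = 0")
      case True
      then have "?V w = UNIV" by (auto simp: up_gen_insert image_def)
      then show ?thesis by (intro exI[of _ "[]"]) simp
    next
      case False
      then obtain y where y: "y \<in> keys w" by (metis keys_eq_empty ex_in_conv)
      define w' where "w' = w - single y 1"
      have w: "w = single y 1 + w'" unfolding w'_def by (rule expo_minus_single[OF y])
      have yu: "y \<in> keys u" using y less.prems by auto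
      have w'u: "keys w' \<subseteq> keys u" using less.prems unfolding w by (auto simp: keys_expo_add)
      have "(\<Sum>i\<in>keys u. lookup w' i) < (\<Sum>i\<in>keys u. lookup w i)"
        using yu by (intro sum_strict_mono_ex1) (auto simp: w lookup_add intro!: bexI[of _ y])
      from less.hyps[OF this w'u] obtain D where
        D: "box_filtration (?V w') D UNIV" "?good D" by blast
      have "keys v \<inter> insert y T = {}" if "v \<in> set us" for v
        using Cons.prems(2)[of v] cop[OF that] yu that by auto
      then obtain D' where D': "box_filtration (var_exponents (insert y T) \<union> up_gen (set us)) D' UNIV"
        and good': "\<And>g T'. (g, T') \<in> set D' \<Longrightarrow> insert y T \<subseteq> T' \<and>
          T' \<subseteq> insert y T \<union> (\<Union>v\<in>set us. keys v) \<and> (\<forall>v\<in>set us. card (keys v \<inter> T') = 1)"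
        using Cons.IH[of "insert y T"] Cons.prems(1) by fastforce
      have colon: "{s. w' + s \<in> ?V w} = var_exponents (insert y T) \<union> up_gen (set us)"
      proof -
        have "w' + s \<in> var_exponents T \<longleftrightarrow> s \<in> var_exponents T" for s
          using w'u Cons.prems(2)[of u] unfolding var_exponents_def by (auto simp: keys_expo_add)
        moreover have "w' + s \<in> up_gen (set us) \<longleftrightarrow> s \<in> up_gen (set us)" for s
          by (rule up_gen_colon) (use w'u cop in blast)
        moreover have "w' + s \<in> range ((+) w) \<longleftrightarrow> y \<in> keys s" for s
        proof
          assume "w' + s \<in> range ((+) w)"
          then obtain v where "w' + s = w' + (single y 1 + v)" unfolding w by (auto simp: add_ac)
          then have "s = single y 1 + v" by simp
          then show "y \<in> keys s" by (simp add: keys_expo_add)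
        next
          assume "y \<in> keys s"
          then have "w' + s = w + (s - single y 1)"
            using expo_minus_single[of y s] unfolding w by (metis add.assoc add.commute)
          then show "w' + s \<in> range ((+) w)" by blast
        qed
        ultimately show ?thesis unfolding var_exponents_def by (auto simp: up_gen_insert)
      qed
      have up: "up_closed (?V w)" by (intro up_closed_Un) simp_all
      have "box_filtration (?V w) (map (\<lambda>(g, T). (w' + g, T)) D') (?V w \<union> (+) w' ` UNIV)"
        by (rule box_filtration_shift[OF up]) (use D' colon in simp)
      moreover have "range ((+) w) \<subseteq> range ((+) w')"
      proof clarify
        fix v
        have "w + v = w' + (single y 1 + v)" unfolding w by (simp add: add_ac)
        then show "w + v \<in> range ((+) w')" by blast
      qed
      then have "?V w \<union> (+) w' ` UNIV = ?V w'"
        unfolding list.set up_gen_insert by blast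
      ultimately have "box_filtration (?V w) (map (\<lambda>(g, T). (w' + g, T)) D' @ D) UNIV"
        using box_filtration_append D(1) by metis
      moreover have "?good (map (\<lambda>(g, T). (w' + g, T)) D' @ D)"
      proof -
        have "T \<subseteq> T' \<and> T' \<subseteq> T \<union> (\<Union>v\<in>set (u # us). keys v) \<and>
            (\<forall>v\<in>set (u # us). card (keys v \<inter> T') = 1)" if "(g, T') \<in> set D'" for g T'
        proof -
          have "keys u \<inter> T' = {y}"
          proof -
            have T': "insert y T \<subseteq> T'" "T' \<subseteq> insert y T \<union> (\<Union>v\<in>set us. keys v)"
              using good'[OF that] by auto
            have "keys u \<inter> T = {}" using Cons.prems(2)[of u] by simp
            moreover have "keys u \<inter> (\<Union>v\<in>set us. keys v) = {}" using cop by blast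
            moreover define W where "W = (\<Union>v\<in>set us. keys v)"
            ultimately have "keys u \<inter> (T \<union> W) = {}" by (simp add: Int_Un_distrib)
            moreover have "T' \<subseteq> insert y (T \<union> W)" "y \<in> T'" using T' by (auto simp: W_def)
            ultimately show ?thesis using yu by blast
          qed
          then have "card (keys u \<inter> T') = 1" by simp
          moreover have "T \<subseteq> T'" "T' \<subseteq> T \<union> (\<Union>v\<in>set (u # us). keys v)"
            using good'[OF that] yu by (blast, fastforce)
          ultimately show ?thesis using good'[OF that] by (metis set_ConsD)
        qed
        then show ?thesis using D(2) by fastforce
      qed
      ultimately show ?thesis by blast
    qed
  qed
  from this[of u] show ?case by simp
qed

text \<open>The successive quotients are $S/(u_1, \ldots, u_{j - 1})$ shifted by $u_j$, because $u_j$ is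
  coprime to the earlier generators. The last generator \<open>u\<close> is singled out since its
  support meets no $T$.\<close>

lemma box_filtration_ideal:
  assumes "coprime_exponents (vs @ [u])"
  shows "\<exists>D. box_filtration {} D (up_gen (set (vs @ [u]))) \<and>
    (\<forall>(g, T)\<in>set D. T \<subseteq> (\<Union>v\<in>set vs. keys v) \<and> (\<forall>v\<in>set vs. card (keys v \<inter> T) \<le> 1))"
  using assms
proof (induction vs arbitrary: u rule: rev_induct)
  case Nil
  have "box u {} = up_gen {u}" unfolding box_def up_gen_def by auto
  then have "box_filtration {} [(u, {})] (up_gen {u})" by simp
  then show ?case by (intro exI[of _ "[(u, {})]"]) simp
next
  case (snoc v vs)
  let ?A = "up_gen (set (vs @ [v]))"
  have cop: "keys u \<inter> keys w = {}" if "w \<in> set (vs @ [v])" for w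
    using snoc.prems that by (auto simp: sorted_wrt_append)
  have cop': "keys v \<inter> keys w = {}" if "w \<in> set vs" for w
    using snoc.prems that by (auto simp: sorted_wrt_append)
  obtain D where D: "box_filtration {} D ?A"
    and good: "\<And>g T. (g, T) \<in> set D \<Longrightarrow> T \<subseteq> (\<Union>v\<in>set vs. keys v) \<and> (\<forall>v\<in>set vs. card (keys v \<inter> T) \<le> 1)"
    using snoc.IH[of v] snoc.prems by (fastforce simp: sorted_wrt_append)
  obtain D' where D': "box_filtration ?A D' UNIV"
    and good': "\<And>g T. (g, T) \<in> set D' \<Longrightarrow> T \<subseteq> (\<Union>v\<in>set (vs @ [v]). keys v) \<and>
      (\<forall>w\<in>set (vs @ [v]). card (keys w \<inter> T) = 1)"
    using box_filtration_quotient[of "vs @ [v]" "{}"] snoc.prems by (fastforce simp: sorted_wrt_append)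
  have "{s. u + s \<in> ?A} = ?A" using up_gen_colon[of "set (vs @ [v])" u] cop by blast
  then have "box_filtration ?A (map (\<lambda>(g, T). (u + g, T)) D') (?A \<union> range ((+) u))"
    using box_filtration_shift[OF up_closed_up_gen, of u "set (vs @ [v])" D' UNIV] D' by simp
  moreover have "?A \<union> range ((+) u) = up_gen (set ((vs @ [v]) @ [u]))"
    by (simp add: up_gen_insert Un_ac)
  ultimately have "box_filtration {} (D @ map (\<lambda>(g, T). (u + g, T)) D') (up_gen (set ((vs @ [v]) @ [u])))"
    using box_filtration_append[OF D] by metis
  moreover have "T \<subseteq> (\<Union>w\<in>set (vs @ [v]). keys w) \<and> (\<forall>w\<in>set (vs @ [v]). card (keys w \<inter> T) \<le> 1)"
    if gT: "(g, T) \<in> set (D @ map (\<lambda>(g, T). (u + g, T)) D')" for g T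
  proof (cases "(g, T) \<in> set D")
    case True
    have "keys w \<inter> keys v = {}" if "w \<in> set vs" for w using cop'[OF that] by blast
    then have "keys v \<inter> T = {}" using good[OF True] by fast
    then show ?thesis using good[OF True] by auto
  next
    case False
    then obtain g' where "(g', T) \<in> set D'" using gT by auto
    then show ?thesis using good' by fastforce
  qed
  ultimately show ?case by blast
qed

section \<open>A regular sequence of linear forms\<close>

lemma indet_in_var_prime [simp]: "indet i \<in> var_prime T \<longleftrightarrow> i \<in> T"
  unfolding indet_def by simp

lemma var_prime_subset:
  fixes C :: "('k::field, 'n::finite) mpoly set"
  assumes C: "is_ideal C" and "\<And>i. i \<in> T \<Longrightarrow> indet i \<in> C"
  shows "var_prime T \<subseteq> C"
proof
  fix p :: "('k, 'n) mpoly" assume p: "p \<in> var_prime T"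
  show "p \<in> C"
  proof (rule in_ideal_if_monomials_in_ideal[OF C])
    fix v assume "v \<in> keys p"
    then obtain i where i: "i \<in> keys v" "i \<in> T" using p unfolding mono_ideal_def var_exponents_def by blast
    show "single v 1 \<in> C"
      unfolding monomial_split_indet[OF i(1)] by (rule ideal_mult[OF C assms(2)[OF i(2)]])
  qed
qed

lemma indet_inj [simp]: "(indet i :: ('k::field, 'n::finite) mpoly) = indet j \<longleftrightarrow> i = j"
  unfolding indet_def by (metis keys_single keys_one one_neq_zero singleton_inject)

lemma indet_nonzero [simp]: "(indet i :: ('k::field, 'n::finite) mpoly) \<noteq> 0"
  unfolding indet_def by (metis lookup_single_eq lookup_zero one_neq_zero)

text \<open>The set $B$ is divided into blocks and $r$ sends each element of $B$ to the root of its block.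
  In the application the blocks are the supports of the generators.\<close>

locale star_forest =
  fixes B :: "'n::finite set" and r :: "'n \<Rightarrow> 'n"
  assumes r_in: "a \<in> B \<Longrightarrow> r a \<in> B" and r_r: "a \<in> B \<Longrightarrow> r (r a) = r a"
begin

definition roots :: "'n set" where "roots = {a \<in> B. r a = a}"

definition edge :: "'n \<Rightarrow> ('k::field, 'n) mpoly"
  where "edge a = (if a \<in> B then indet a - indet (r a) else indet a)"

text \<open>The ideal $J$ is generated by $x_t$ for $t \<in> T$ and the linear forms of $D$. Modulo $J$ each
  variable becomes zero or is identified with the root of its block, and a root becomes zero
  exactly when it lies in $T$ or is identified with an element of $T$. The substitution
  \<open>s\<close> carries out these identifications. As $T$ meets each block at most once, a new
  linear form never vanishes under \<open>s\<close>, and neither does a root whose block misses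
  $T$.\<close>

lemma edge_regular:
  fixes J :: "('k::field, 'n) mpoly set"
  assumes T: "T \<subseteq> B" "inj_on r T"
    and J: "is_ideal J" "var_prime T \<subseteq> J" "edge ` D \<subseteq> J"
    and least: "\<forall>C. is_ideal C \<longrightarrow> var_prime T \<subseteq> C \<longrightarrow> edge ` D \<subseteq> C \<longrightarrow> J \<subseteq> C"
    and D: "D \<inter> roots = {}"
  shows "a \<notin> D \<Longrightarrow> a \<notin> roots \<Longrightarrow> edge a * b \<in> J \<Longrightarrow> b \<in> J"
    and "c \<in> roots \<Longrightarrow> c \<notin> r ` T \<Longrightarrow> indet c * b \<in> J \<Longrightarrow> b \<in> J"
proof -
  \<comment> \<open>the image of a root\<close>
  define val :: "'n \<Rightarrow> ('k, 'n) mpoly"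
    where "val c = (if c \<in> T \<or> c \<in> r ` (T \<inter> D) then 0 else indet c)" for c
  define s :: "'n \<Rightarrow> ('k, 'n) mpoly"
    where "s a = (if a \<in> T then 0 else if a \<notin> B then if a \<in> D then 0 else indet a
      else if a = r a \<or> a \<in> D then val (r a) else indet a)" for a
  have xT: "indet a \<in> J" if "a \<in> T" for a using J(2) that by auto
  have val: "indet c - val c \<in> J" for c
  proof (cases "c \<in> r ` (T \<inter> D)")
    case True
    then obtain t where t: "t \<in> T" "t \<in> D" "c = r t" by auto
    then have "indet t - indet c \<in> J" using J(3) T(1) unfolding edge_def by auto
    then have "indet t - (indet t - indet c) \<in> J" using ideal_diff[OF J(1) xT[OF t(1)]] by blast
    then show ?thesis using True unfolding val_def by simp
  qed (use xT ideal_0[OF J(1)] in \<open>auto simp: val_def\<close>)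
  have cong: "indet a - s a \<in> J" for a
  proof (cases "a \<in> B \<and> a \<notin> T")
    case True
    show ?thesis
    proof (cases "a \<in> D")
      case aD: True
      have "edge a + (indet (r a) - val (r a)) \<in> J"
        using J(3) aD by (intro ideal_add[OF J(1) _ val]) auto
      then show ?thesis using True aD unfolding edge_def s_def by simp
    next
      case False
      then show ?thesis using True val[of a] ideal_0[OF J(1)] unfolding s_def by auto
    qed
  next
    case False
    then show ?thesis
      using xT subsetD[OF J(3) imageI, of a] ideal_0[OF J(1)] T(1) unfolding s_def edge_def by auto
  qed
  have root: "s (r a) = val (r a)" if "a \<in> B" for a
    using r_in[OF that] r_r[OF that] unfolding s_def val_def by auto
  have kernel: "J \<subseteq> {p. subst s p = 0}"
  proof (rule least[rule_format, OF is_ideal_subst_kernel])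
    show "var_prime T \<subseteq> {p. subst s p = 0}"
      by (rule var_prime_subset[OF is_ideal_subst_kernel]) (simp add: s_def)
    have "edge a \<in> {p. subst s p = 0}" if a: "a \<in> D" for a
    proof -
      have "s a = s (r a)" if "a \<in> B"
      proof (cases "a \<in> T")
        case True
        then show ?thesis using root[OF that] a unfolding val_def s_def by auto
      next
        case False
        then show ?thesis using root[OF that] a that unfolding s_def by auto
      qed
      moreover have "s a = 0" if "a \<notin> B" using that a unfolding s_def by auto
      ultimately show "edge a \<in> {p. subst s p = 0}" unfolding edge_def by (auto simp: subst_diff)
    qed
    then show "edge ` D \<subseteq> {p. subst s p = 0}" by auto
  qed
  show "b \<in> J" if a: "a \<notin> D" "a \<notin> roots" "edge a * b \<in> J" for a b
  proof (rule nonzerodivisor_by_subst[OF J(1) cong kernel _ a(3)])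
    show "subst s (edge a) \<noteq> 0"
    proof (cases "a \<in> B")
      case aB: True
      have ne: "r a \<noteq> a" using a(2) aB unfolding roots_def by auto
      show ?thesis
      proof (cases "a \<in> T")
        case True
        have "r a \<notin> T" using inj_onD[OF T(2) _ True] r_r[OF aB] ne by metis
        moreover have "r a \<notin> r ` (T \<inter> D)" using inj_onD[OF T(2) _ True] a(1) by (metis IntE imageE)
        ultimately have "s (r a) = indet (r a)" using root[OF aB] unfolding val_def by simp
        then show ?thesis using True aB unfolding edge_def by (simp add: subst_diff s_def)
      next
        case False
        then have "s a = indet a" using aB ne a(1) unfolding s_def by auto
        moreover have "s (r a) \<noteq> indet a" using root[OF aB] ne unfolding val_def by auto
        ultimately show ?thesis using aB unfolding edge_def by (simp add: subst_diff)
      qed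
    next
      case False
      then show ?thesis using a(1) T(1) unfolding edge_def s_def by auto
    qed
  qed
  show "b \<in> J" if c: "c \<in> roots" "c \<notin> r ` T" "indet c * b \<in> J" for c b
  proof (rule nonzerodivisor_by_subst[OF J(1) cong kernel _ c(3)])
    have rc: "c \<in> B" "r c = c" using c(1) unfolding roots_def by auto
    then have "c \<notin> T" using c(2) by force
    moreover have "c \<notin> r ` (T \<inter> D)" using c(2) by auto
    ultimately have "s c = indet c" using root[OF rc(1)] rc(2) unfolding val_def by simp
    then show "subst s (indet c) \<noteq> 0" by simp
  qed
qed

lemma edges_regular_on_var_prime:
  fixes xs :: "'n list"
  assumes T: "T \<subseteq> B" "inj_on r T"
    and xs: "distinct xs" "set xs \<inter> roots = {}"
    and cs: "cs = [] \<or> (\<exists>c. cs = [c] \<and> c \<in> roots \<and> c \<notin> r ` T)"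
  shows "weakly_regular (map edge xs @ map indet cs) (var_prime T :: ('k::field, 'n) mpoly set) UNIV"
proof -
  let ?J = "\<lambda>ys. ideal_plus_list (map edge ys) (var_prime T :: ('k, 'n) mpoly set) UNIV"
  have J: "is_ideal (?J ys)" for ys by (simp add: is_ideal_plus_list)
  have J': "var_prime T \<subseteq> ?J ys" for ys by (rule ideal_plus_list_superset) simp_all
  have J'': "edge ` set ys \<subseteq> ?J ys" for ys
    using ideal_plus_list_mult[of "var_prime T" UNIV _ "map edge ys" 1] by auto
  have least: "\<forall>C. is_ideal C \<longrightarrow> var_prime T \<subseteq> C \<longrightarrow> edge ` set ys \<subseteq> C \<longrightarrow> ?J ys \<subseteq> C" for ys
  proof (intro allI impI)
    fix C :: "('k, 'n) mpoly set"
    assume "is_ideal C" "var_prime T \<subseteq> C" "edge ` set ys \<subseteq> C"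
    then show "?J ys \<subseteq> C"
      by (intro ideal_plus_list_least) (auto intro: ideal_mult2)
  qed
  note reg = edge_regular[OF T J J' J'' least]
  have step: "b \<in> ?J (take i xs)" if i: "i < length xs" "edge (xs ! i) * b \<in> ?J (take i xs)" for i b
  proof (rule reg(1)[where a = "xs ! i"])
    show "xs ! i \<notin> set (take i xs)"
      using i(1) xs(1) by (auto simp: in_set_conv_nth nth_eq_iff_index_eq)
    show "xs ! i \<notin> roots" using i(1) xs(2) nth_mem by blast
    show "set (take i xs) \<inter> roots = {}" using xs(2) set_take_subset by fast
  qed (use i in auto)
  have "weakly_regular (map edge xs) (var_prime T :: ('k, 'n) mpoly set) UNIV"
    unfolding weakly_regular_nth
  proof (intro allI impI ballI)
    fix i and b :: "('k, 'n) mpoly"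
    assume "i < length (map edge xs :: ('k, 'n) mpoly list)"
      and "map edge xs ! i * b \<in> ideal_plus_list (take i (map edge xs)) (var_prime T) UNIV"
    then show "b \<in> ideal_plus_list (take i (map edge xs)) (var_prime T) UNIV"
      using step[of i b] by (simp only: take_map nth_map length_map)
  qed
  moreover have "weakly_regular (map indet cs) (?J xs) UNIV"
  proof (cases "cs = []")
    case False
    then obtain c where c: "cs = [c]" "c \<in> roots" "c \<notin> r ` T" using cs by blast
    have "b \<in> ?J xs" if "indet c * b \<in> ?J xs" for b
      by (rule reg(2)[OF xs(2) c(2,3) that])
    then show ?thesis unfolding c(1) by simp
  qed simp
  ultimately show ?thesis by (simp add: weakly_regular_append)
qed

end

section \<open>Regular sequences along box filtrations\<close>

lemma mono_ideal_box_colon: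
  assumes "up_closed (U \<union> box g T)" "U \<inter> box g T = {}"
  shows "{s. single g 1 * s \<in> (mono_ideal U :: ('k::field, 'n::finite) mpoly set)} = var_prime T"
proof -
  have "keys (single g 1 * s) \<subseteq> U \<longleftrightarrow> keys s \<subseteq> var_exponents T" for s :: "('k, 'n) mpoly"
    using keys_monomial_mult[of g s] box_colon[OF assms] by (simp add: subset_iff image_iff) blast
  then show ?thesis unfolding mono_ideal_def by simp
qed

lemma mono_ideal_Un_box:
  assumes U: "up_closed U" "up_closed (U \<union> box g T)"
  shows "mono_ideal (U \<union> box g T) =
    ideal_plus (mono_ideal U :: ('k::field, 'n::finite) mpoly set) (single g 1) UNIV"
    (is "?L = ?R")
proof
  have R: "is_ideal ?R" by (intro is_ideal_plus is_ideal_mono_ideal U) simp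
  show "?L \<subseteq> ?R"
  proof
    fix p :: "('k, 'n) mpoly" assume p: "p \<in> mono_ideal (U \<union> box g T)"
    show "p \<in> ?R"
    proof (rule in_ideal_if_monomials_in_ideal[OF R])
      fix v assume "v \<in> keys p"
      then consider "v \<in> U" | w where "v = g + w" using p unfolding mono_ideal_def box_def by blast
      then show "single v 1 \<in> ?R"
      proof cases
        case 1
        then show ?thesis using ideal_plus_superset[of UNIV "mono_ideal U" "single g 1"] by auto
      next
        case 2
        have "single g 1 * single w 1 \<in> ?R"
          by (rule ideal_plus_mult[OF is_ideal_mono_ideal[OF U(1)]]) simp
        then show ?thesis using 2 by (simp add: mult_single)
      qed
    qed
  qed
  show "?R \<subseteq> ?L"
  proof (rule ideal_plus_subset[OF is_ideal_mono_ideal[OF U(2)]])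
    show "mono_ideal U \<subseteq> ?L" by (simp add: mono_ideal_subset_iff)
    show "single g 1 * b \<in> ?L" for b
      by (rule ideal_mult2[OF is_ideal_mono_ideal[OF U(2)]]) simp
  qed
qed

lemma weakly_regular_box_filtration:
  fixes fs :: "('k::field, 'n::finite) mpoly list"
  assumes "box_filtration U D V" "up_closed U"
    and "\<And>g T. (g, T) \<in> set D \<Longrightarrow> weakly_regular fs (var_prime T) UNIV"
  shows "weakly_regular fs (mono_ideal U) (mono_ideal V)"
  using assms
proof (induction D arbitrary: U)
  case Nil
  have "weakly_regular fs I I" if "is_ideal I" for I :: "('k, 'n) mpoly set"
    using that
  proof (induction fs)
    case (Cons f fs)
    have "ideal_plus I f I = I"
      using ideal_plus_le[OF Cons.prems order_refl] ideal_plus_superset[OF Cons.prems] by blast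
    then show ?case using Cons by simp
  qed simp
  then show ?case using Nil is_ideal_mono_ideal by auto
next
  case (Cons b D)
  obtain g T where b: "b = (g, T)" by force
  let ?U = "U \<union> box g T"
  have U: "U \<inter> box g T = {}" "up_closed ?U" "box_filtration ?U D V"
    using Cons.prems(1) unfolding b by auto
  have V: "up_closed V" using U(2,3)
    by (induction D arbitrary: g T U) (auto simp: split_paired_all)
  have "weakly_regular fs (mono_ideal U) (mono_ideal ?U)"
    unfolding mono_ideal_Un_box[OF Cons.prems(2) U(2)]
    by (rule weakly_regular_colon[OF is_ideal_mono_ideal[OF Cons.prems(2)]])
      (use Cons.prems(3) mono_ideal_box_colon[OF U(2,1), where 'k='k] in \<open>auto simp: b\<close>)
  moreover have "weakly_regular fs (mono_ideal ?U) (mono_ideal V)"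
    using Cons.IH[OF U(3,2)] Cons.prems(3) by (meson list.set_intros(2))
  moreover have "mono_ideal U \<subseteq> (mono_ideal ?U :: ('k, 'n) mpoly set)"
    "mono_ideal ?U \<subseteq> (mono_ideal V :: ('k, 'n) mpoly set)"
    using box_filtration_subset[OF U(3)] by (simp_all add: mono_ideal_subset_iff)
  ultimately show ?case
    using weakly_regular_extension is_ideal_mono_ideal Cons.prems(2) U(2) V by metis
qed

section \<open>Ideals of the polynomial ring and Krull dimension of its quotients\<close>

lemma polyring_simps [simp]:
  "carrier polyring = UNIV" "p \<otimes>\<^bsub>polyring\<^esub> q = p * q" "p \<oplus>\<^bsub>polyring\<^esub> q = p + q"
  "\<zero>\<^bsub>polyring\<^esub> = 0" "\<one>\<^bsub>polyring\<^esub> = 1"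
  by (simp_all add: ring_of_type_algebra_def)

lemma cring_polyring: "cring polyring" and ring_polyring: "ring polyring"
  by (auto intro: cring_from_type_algebra ring_from_type_algebra)

lemma a_inv_polyring [simp]: "\<ominus>\<^bsub>polyring\<^esub> p = - p"
proof -
  interpret ring polyring by (rule ring_polyring)
  show ?thesis by (rule minus_equality) simp_all
qed

lemma ideal_polyring_iff: "ideal I polyring \<longleftrightarrow> is_ideal I"
proof
  assume "ideal I polyring"
  then interpret ideal I polyring .
  have "0 \<in> I" "\<And>a b. a \<in> I \<Longrightarrow> b \<in> I \<Longrightarrow> a + b \<in> I"
    using additive_subgroup.zero_closed[OF is_additive_subgroup]
      additive_subgroup.a_closed[OF is_additive_subgroup] by simp_all
  then show "is_ideal I" using I_l_closed by (intro is_idealI) simp_all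
next
  assume I: "is_ideal I"
  interpret ring polyring by (rule ring_polyring)
  show "ideal I polyring"
  proof (rule idealI[OF ring_polyring])
    show "subgroup I (add_monoid polyring)"
    proof (rule add.subgroupI)
      show "I \<noteq> {}" using ideal_0[OF I] by auto
      show "\<ominus>\<^bsub>polyring\<^esub> a \<in> I" if "a \<in> I" for a
        using ideal_uminus[OF I that] by simp
    qed (use ideal_add[OF I] in auto)
  qed (use ideal_mult[OF I] ideal_mult2[OF I] in auto)
qed

lemma primeideal_polyring_iff: "primeideal P polyring \<longleftrightarrow> is_prime P"
proof
  assume "primeideal P polyring"
  then interpret primeideal P polyring .
  show "is_prime P"
    unfolding is_prime_def using is_ideal I_notcarr I_prime by (auto simp: ideal_polyring_iff)
next
  assume "is_prime P"
  then show "primeideal P polyring"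
    by (intro primeidealI cring_polyring) (auto simp: is_prime_def ideal_polyring_iff)
qed

lemma Idl_least: "is_ideal C \<Longrightarrow> G \<subseteq> C \<Longrightarrow> Idl\<^bsub>polyring\<^esub> G \<subseteq> C"
  unfolding genideal_def by (auto simp: ideal_polyring_iff)

lemma Idl_superset: "G \<subseteq> Idl\<^bsub>polyring\<^esub> G"
  unfolding genideal_def by auto

lemma is_ideal_Idl: "is_ideal (Idl\<^bsub>polyring\<^esub> G)"
  using ring.genideal_ideal[OF ring_polyring, of G] by (simp add: ideal_polyring_iff)

lemma Idl_monomials:
  "Idl\<^bsub>polyring\<^esub> ((\<lambda>v. single v 1) ` E) = (mono_ideal (up_gen E) :: ('k::field, 'n::finite) mpoly set)"
proof
  show "Idl\<^bsub>polyring\<^esub> ((\<lambda>v. single v 1) ` E) \<subseteq> (mono_ideal (up_gen E) :: ('k, 'n) mpoly set)"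
    by (rule Idl_least[OF is_ideal_mono_ideal]) (auto intro: up_gen_self)
  show "mono_ideal (up_gen E) \<subseteq> (Idl\<^bsub>polyring\<^esub> ((\<lambda>v. single v 1) ` E) :: ('k, 'n) mpoly set)"
  proof
    fix p :: "('k, 'n) mpoly" assume p: "p \<in> mono_ideal (up_gen E)"
    show "p \<in> Idl\<^bsub>polyring\<^esub> ((\<lambda>v. single v 1) ` E)"
    proof (rule in_ideal_if_monomials_in_ideal[OF is_ideal_Idl])
      fix v assume "v \<in> keys p"
      then obtain u w where uw: "u \<in> E" "v = u + w" using p unfolding mono_ideal_def up_gen_def by blast
      have "single w 1 * single u 1 \<in> Idl\<^bsub>polyring\<^esub> ((\<lambda>v. single v (1 :: 'k)) ` E)"
        by (rule ideal_mult[OF is_ideal_Idl subsetD[OF Idl_superset imageI[OF uw(1)]]])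
      then show "single v 1 \<in> Idl\<^bsub>polyring\<^esub> ((\<lambda>v. single v (1 :: 'k)) ` E)"
        using uw by (simp add: mult_single add.commute)
    qed
  qed
qed

lemma up_gen_up_closed: "up_closed U \<Longrightarrow> up_gen U = U"
  using up_gen_self[of _ U] up_closedD[of U] unfolding up_gen_def by blast

lemma monomial_ideal_iff:
  "monomial_ideal (I :: ('k::field, 'n::finite) mpoly set) \<longleftrightarrow> (\<exists>U. up_closed U \<and> I = mono_ideal U)"
proof
  assume "monomial_ideal I"
  then obtain G where G: "G \<subseteq> monomials" "I = Idl\<^bsub>polyring\<^esub> G" unfolding monomial_ideal_def by blast
  then obtain E where "G = (\<lambda>v. single v 1) ` E" unfolding monomials_def by (metis subset_imageE)
  then show "\<exists>U. up_closed U \<and> I = mono_ideal U"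
    using G(2) Idl_monomials up_closed_up_gen by metis
next
  assume "\<exists>U. up_closed U \<and> I = mono_ideal U"
  then obtain U where U: "up_closed U" "I = mono_ideal U" by blast
  have "I = Idl\<^bsub>polyring\<^esub> ((\<lambda>v. single v 1) ` U)"
    unfolding Idl_monomials up_gen_up_closed[OF U(1)] by (rule U(2))
  then show "monomial_ideal I"
    unfolding monomial_ideal_def monomials_def by (intro exI[of _ "(\<lambda>v. single v 1) ` U"]) auto
qed

lemma max_ideal_eq: "max_ideal = (var_prime UNIV :: ('k::field, 'n::finite) mpoly set)"
proof
  show "max_ideal \<subseteq> (var_prime UNIV :: ('k, 'n) mpoly set)"
    unfolding max_ideal_def by (rule Idl_least) auto
  show "var_prime UNIV \<subseteq> (max_ideal :: ('k, 'n) mpoly set)"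
    unfolding max_ideal_def by (rule var_prime_subset[OF is_ideal_Idl]) (intro subsetD[OF Idl_superset], simp)
qed

lemma is_prime_prod:
  assumes "is_prime P" "finite F" "(\<Prod>i\<in>F. f i) \<in> P" shows "\<exists>i\<in>F. f i \<in> P"
  using assms(2,3)
proof (induction F rule: finite_induct)
  case empty
  then show ?case using is_prime_one[OF assms(1)] by simp
next
  case (insert i F)
  then show ?case using assms(1) unfolding is_prime_def by auto
qed

text \<open>A prime that contains a monomial contains one of its variables.\<close>

lemma monomial_prime_is_var_prime:
  fixes P :: "('k::field, 'n::finite) mpoly set"
  assumes "primeideal P polyring" "monomial_ideal P"
  obtains T where "P = var_prime T"
proof
  have P: "is_prime P" "is_ideal P" using assms(1) unfolding primeideal_polyring_iff is_prime_def by auto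
  obtain U where U: "up_closed U" "P = mono_ideal U" using assms(2) unfolding monomial_ideal_iff by blast
  let ?T = "{i. indet i \<in> P}"
  show "P = var_prime ?T"
  proof
    show "var_prime ?T \<subseteq> P" by (rule var_prime_subset[OF P(2)]) simp
    have "U \<subseteq> var_exponents ?T"
    proof
      fix v assume "v \<in> U"
      then have "(\<Prod>i\<in>UNIV. indet i ^ lookup v i) \<in> P" 
        using U(2) by (simp flip: monomial_prod_indet)
      then obtain i where i: "(indet i :: ('k, 'n) mpoly) ^ lookup v i \<in> P"
        using is_prime_prod[OF P(1) finite_UNIV] by blast
      then have "indet i \<in> P" using is_prime_power[OF P(1)] by blast
      moreover have "lookup v i \<noteq> 0" using i is_prime_one[OF P(1)] by (metis power_0)
      ultimately show "v \<in> var_exponents ?T" unfolding var_exponents_def by (auto simp: in_keys_iff)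
    qed
    then show "P \<subseteq> var_prime ?T" unfolding U(2) by (simp add: mono_ideal_subset_iff)
  qed
qed

text \<open>The correspondence between primes above $I$ and primes of $S/I$, from left to right.\<close>

lemma quot_primeideal_image:
  fixes I P :: "('k::field, 'n::finite) mpoly set"
  assumes I: "is_ideal I" and P: "is_prime P" and "I \<subseteq> P"
  shows "primeideal ((+>\<^bsub>polyring\<^esub>) I ` P) (polyring Quot I)"
    and "I +>\<^bsub>polyring\<^esub> p \<in> (+>\<^bsub>polyring\<^esub>) I ` P \<longleftrightarrow> p \<in> P"
proof -
  interpret ideal I polyring using I by (simp add: ideal_polyring_iff)
  have Pi: "is_ideal P" using P unfolding is_prime_def by simp
  have mem: "I +>\<^bsub>polyring\<^esub> p \<in> (+>\<^bsub>polyring\<^esub>) I ` P \<longleftrightarrow> p \<in> P" for p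
  proof
    assume "I +>\<^bsub>polyring\<^esub> p \<in> (+>\<^bsub>polyring\<^esub>) I ` P"
    then obtain q where q: "q \<in> P" "I +>\<^bsub>polyring\<^esub> p = I +>\<^bsub>polyring\<^esub> q" by auto
    have "p \<in> I +>\<^bsub>polyring\<^esub> q" using a_rcos_self[of p] unfolding q(2) by simp
    then obtain a where "a \<in> I" "p = a + q" unfolding a_r_coset_def' by auto
    then show "p \<in> P" using ideal_add[OF Pi] q(1) assms(3) by blast
  qed auto
  then show "I +>\<^bsub>polyring\<^esub> p \<in> (+>\<^bsub>polyring\<^esub>) I ` P \<longleftrightarrow> p \<in> P" .
  have carr: "carrier (polyring Quot I) = range ((+>\<^bsub>polyring\<^esub>) I)"
    unfolding FactRing_def A_RCOSETS_def' by auto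
  show "primeideal ((+>\<^bsub>polyring\<^esub>) I ` P) (polyring Quot I)"
  proof (rule primeidealI)
    show "ideal ((+>\<^bsub>polyring\<^esub>) I ` P) (polyring Quot I)"
      using ring_ideal_imp_quot_ideal[OF is_ideal] Pi by (simp add: ideal_polyring_iff)
    show "cring (polyring Quot I)" by (rule quotient_is_cring[OF cring_polyring])
    show "carrier (polyring Quot I) \<noteq> (+>\<^bsub>polyring\<^esub>) I ` P"
      using mem[of 1] is_prime_one[OF P] unfolding carr by blast
    fix a b
    assume ab: "a \<in> carrier (polyring Quot I)" "b \<in> carrier (polyring Quot I)"
      "a \<otimes>\<^bsub>polyring Quot I\<^esub> b \<in> (+>\<^bsub>polyring\<^esub>) I ` P"
    then obtain p q where pq: "a = I +>\<^bsub>polyring\<^esub> p" "b = I +>\<^bsub>polyring\<^esub> q" unfolding carr by auto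
    have "a \<otimes>\<^bsub>polyring Quot I\<^esub> b = I +>\<^bsub>polyring\<^esub> (p * q)"
      unfolding pq FactRing_def using rcoset_mult_add[of p q] by simp
    then have "p * q \<in> P" using ab(3) mem by simp
    then have "p \<in> P \<or> q \<in> P" using P unfolding is_prime_def by blast
    then show "a \<in> (+>\<^bsub>polyring\<^esub>) I ` P \<or> b \<in> (+>\<^bsub>polyring\<^esub>) I ` P" unfolding pq by auto
  qed
qed

lemma quot_primeideal_vimage:
  fixes I :: "('k::field, 'n::finite) mpoly set"
  assumes I: "is_ideal I" and Q: "primeideal Q (polyring Quot I)"
  shows "is_prime {p. I +>\<^bsub>polyring\<^esub> p \<in> Q}" "I \<subseteq> {p. I +>\<^bsub>polyring\<^esub> p \<in> Q}"
    "Q = (+>\<^bsub>polyring\<^esub>) I ` {p. I +>\<^bsub>polyring\<^esub> p \<in> Q}"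
proof -
  interpret ideal I polyring using I by (simp add: ideal_polyring_iff)
  have carr: "carrier (polyring Quot I) = range ((+>\<^bsub>polyring\<^esub>) I)"
    unfolding FactRing_def A_RCOSETS_def' by auto
  interpret Q: primeideal Q "polyring Quot I" by (rule Q)
  have "primeideal {p \<in> carrier polyring. I +>\<^bsub>polyring\<^esub> p \<in> Q} polyring"
    by (rule ring_hom_ring.primeideal_vimage[OF rcos_ring_hom_ring cring_polyring Q])
  then show "is_prime {p. I +>\<^bsub>polyring\<^esub> p \<in> Q}" by (simp add: primeideal_polyring_iff)
  show "I \<subseteq> {p. I +>\<^bsub>polyring\<^esub> p \<in> Q}"
  proof clarify
    fix p assume "p \<in> I"
    then have "I +>\<^bsub>polyring\<^esub> p = \<zero>\<^bsub>polyring Quot I\<^esub>"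
      using a_rcos_const[of p] by (simp add: FactRing_def)
    then show "I +>\<^bsub>polyring\<^esub> p \<in> Q" using Q.zero_closed by simp
  qed
  show "Q = (+>\<^bsub>polyring\<^esub>) I ` {p. I +>\<^bsub>polyring\<^esub> p \<in> Q}"
    using Q.Icarr carr by auto
qed

lemma krull_dim_quot_var_prime:
  "krull_dim (polyring Quot (var_prime T :: ('k::field, 'n::finite) mpoly set)) =
    enat (card (UNIV :: 'n set) - card T)" (is "krull_dim (polyring Quot ?P) = enat ?d")
proof (rule antisym)
  show "krull_dim (polyring Quot ?P) \<le> enat ?d"
    unfolding krull_dim_def
  proof (rule Sup_least, clarify)
    fix k Q assume Q: "\<forall>i\<le>k. primeideal (Q i) (polyring Quot ?P)" "\<forall>i<k. Q i \<subset> Q (Suc i)"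
    let ?R = "\<lambda>i. {p. ?P +>\<^bsub>polyring\<^esub> p \<in> Q i}"
    note vimage = quot_primeideal_vimage[OF is_ideal_var_prime]
    have "card T + k \<le> card (UNIV :: 'n set)"
    proof (rule prime_chain_above_var_prime[of k ?R T])
      show "is_prime (?R i)" if "i \<le> k" for i using vimage(1) Q(1) that by blast
      show "?P \<subseteq> ?R 0" using vimage(2) Q(1) by blast
      show "?R i \<subset> ?R (Suc i)" if i: "i < k" for i
      proof
        show "?R i \<subseteq> ?R (Suc i)" using Q(2) i by auto
        have "Q i = (+>\<^bsub>polyring\<^esub>) ?P ` ?R i" "Q (Suc i) = (+>\<^bsub>polyring\<^esub>) ?P ` ?R (Suc i)"
          using vimage(3) Q(1) i by (metis Suc_leI less_imp_le)+
        then show "?R i \<noteq> ?R (Suc i)" using Q(2) i by (metis less_irrefl)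
      qed
    qed
    then show "enat k \<le> enat ?d" by simp
  qed
  obtain W where W: "W 0 = T" "\<And>i. i < card (UNIV - T) \<Longrightarrow> W i \<subset> W (Suc i)" "\<And>i. T \<subseteq> W i"
    by (rule var_prime_chain[of T UNIV]) auto
  have d: "card (UNIV - T) = ?d" by (simp add: card_Diff_subset)
  let ?Q = "\<lambda>i. (+>\<^bsub>polyring\<^esub>) ?P ` var_prime (W i)"
  have sub: "?P \<subseteq> var_prime (W i)" for i
    using W(3) by (simp add: mono_ideal_subset_iff var_exponents_subset_iff)
  note image = quot_primeideal_image[OF is_ideal_var_prime is_prime_var_prime sub]
  have "?Q i \<subset> ?Q (Suc i)" if "i < ?d" for i
  proof -
    have "var_prime (W i) \<subset> (var_prime (W (Suc i)) :: ('k, 'n) mpoly set)"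
      using W(2) that d by (simp add: var_prime_psubset_iff)
    note strict = this
    have "?Q i \<subseteq> ?Q (Suc i)" by (rule image_mono[OF psubset_imp_subset[OF strict]])
    moreover obtain p :: "('k, 'n) mpoly" where p: "p \<in> var_prime (W (Suc i)) - var_prime (W i)"
      using psubset_imp_ex_mem[OF strict] by (rule exE)
    moreover have "?P +>\<^bsub>polyring\<^esub> p \<in> ?Q (Suc i)" "?P +>\<^bsub>polyring\<^esub> p \<notin> ?Q i"
      using p unfolding image(2) by simp_all
    ultimately show ?thesis by blast
  qed
  then show "enat ?d \<le> krull_dim (polyring Quot ?P)"
    unfolding krull_dim_def using image(1)
    by (intro Sup_upper CollectI exI[of _ ?d] conjI[OF refl] exI[of _ ?Q]) simp
qed

section \<open>Modules presented as quotients of ideals\<close>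

text \<open>The map $\pi$ identifies $M$ with $B/A$. Both $S/I$ and $I$ have this form, and so do all their
  submodules and subquotients, even though the latter are nested cosets as sets.\<close>

locale presented =
  fixes M :: "(('k::field, 'n::finite) mpoly, 'm, 'z) module_scheme"
    and A B :: "('k, 'n) mpoly set" and \<pi> :: "('k, 'n) mpoly \<Rightarrow> 'm"
  assumes A: "is_ideal A" and B: "is_ideal B" and A_sub: "A \<subseteq> B"
    and carrier_eq: "carrier M = \<pi> ` B"
    and pi_add: "p \<in> B \<Longrightarrow> q \<in> B \<Longrightarrow> \<pi> p \<oplus>\<^bsub>M\<^esub> \<pi> q = \<pi> (p + q)"
    and pi_zero: "\<zero>\<^bsub>M\<^esub> = \<pi> 0"
    and pi_eq: "p \<in> B \<Longrightarrow> q \<in> B \<Longrightarrow> \<pi> p = \<pi> q \<longleftrightarrow> p - q \<in> A"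
    and pi_smult: "p \<in> B \<Longrightarrow> s \<odot>\<^bsub>M\<^esub> \<pi> p = \<pi> (s * p)"
begin

lemma pi_eq_zero: "p \<in> B \<Longrightarrow> \<pi> p = \<zero>\<^bsub>M\<^esub> \<longleftrightarrow> p \<in> A"
  using pi_eq[of p 0] ideal_0[OF B] by (simp add: pi_zero)

lemma is_abelian_group: "abelian_group M"
proof (rule abelian_groupI)
  fix x assume "x \<in> carrier M"
  then obtain p where p: "p \<in> B" "x = \<pi> p" unfolding carrier_eq by auto
  show "\<exists>y\<in>carrier M. y \<oplus>\<^bsub>M\<^esub> x = \<zero>\<^bsub>M\<^esub>"
    using p ideal_uminus[OF B p(1)] by (intro bexI[of _ "\<pi> (- p)"]) (auto simp: carrier_eq pi_add pi_zero)
qed (use ideal_0[OF B] ideal_add[OF B] in \<open>auto simp: carrier_eq pi_add pi_zero add_ac\<close>)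

lemma is_module: "module polyring M"
  by (rule moduleI[OF cring_polyring is_abelian_group])
    (use ideal_add[OF B] ideal_mult[OF B] in
      \<open>auto simp: carrier_eq pi_add pi_smult distrib_left distrib_right mult.assoc\<close>)

lemma a_inv_pi: "p \<in> B \<Longrightarrow> \<ominus>\<^bsub>M\<^esub> \<pi> p = \<pi> (- p)"
proof -
  interpret abelian_group M by (rule is_abelian_group)
  assume p: "p \<in> B"
  show ?thesis
    by (rule minus_equality) (use p ideal_uminus[OF B p] in \<open>auto simp: carrier_eq pi_add pi_zero\<close>)
qed

lemma finsum_pi:
  assumes "finite F" "\<And>i. i \<in> F \<Longrightarrow> q i \<in> B"
  shows "(\<Oplus>\<^bsub>M\<^esub>i\<in>F. \<pi> (q i)) = \<pi> (\<Sum>i\<in>F. q i)"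
proof -
  interpret abelian_group M by (rule is_abelian_group)
  show ?thesis using assms
  proof (induction F rule: finite_induct)
    case (insert i F)
    have "(\<lambda>i. \<pi> (q i)) \<in> F \<rightarrow> carrier M" using insert.prems by (auto simp: carrier_eq)
    then have "(\<Oplus>\<^bsub>M\<^esub>i\<in>insert i F. \<pi> (q i)) = \<pi> (q i) \<oplus>\<^bsub>M\<^esub> (\<Oplus>\<^bsub>M\<^esub>i\<in>F. \<pi> (q i))"
      using insert.prems by (intro finsum_insert[OF insert.hyps]) (auto simp: carrier_eq)
    then show ?case using insert ideal_sum[OF B, of F q] by (simp add: pi_add)
  qed (simp add: pi_zero)
qed

lemma image_ideal_mem_iff:
  assumes "is_ideal C" "A \<subseteq> C" "C \<subseteq> B" "p \<in> B"
  shows "\<pi> p \<in> \<pi> ` C \<longleftrightarrow> p \<in> C"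
proof
  assume "\<pi> p \<in> \<pi> ` C"
  then obtain q where q: "q \<in> C" "\<pi> p = \<pi> q" by auto
  then have "p - q \<in> C" using pi_eq[of p q] assms by auto
  then show "p \<in> C" using ideal_add[OF assms(1) _ q(1)] by fastforce
qed auto

lemma submodule_image:
  assumes "is_ideal C" "C \<subseteq> B"
  shows "submodule (\<pi> ` C) polyring M"
proof (rule module.submoduleI[OF is_module])
  show "\<zero>\<^bsub>M\<^esub> \<in> \<pi> ` C" using ideal_0[OF assms(1)] by (auto simp: pi_zero)
  show "\<ominus>\<^bsub>M\<^esub> x \<in> \<pi> ` C" if "x \<in> \<pi> ` C" for x
    using that assms ideal_uminus[OF assms(1)] by (auto simp: a_inv_pi subset_iff)
  show "x \<oplus>\<^bsub>M\<^esub> y \<in> \<pi> ` C" if xy: "x \<in> \<pi> ` C" "y \<in> \<pi> ` C" for x y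
    using xy assms ideal_add[OF assms(1)] by (auto simp: pi_add subset_iff)
  show "s \<odot>\<^bsub>M\<^esub> x \<in> \<pi> ` C" if "x \<in> \<pi> ` C" for s x
    using that assms ideal_mult[OF assms(1)] by (auto simp: pi_smult subset_iff)
qed (use assms in \<open>auto simp: carrier_eq\<close>)

lemma submodule_vimage:
  assumes "submodule N polyring M"
  shows "is_ideal {p \<in> B. \<pi> p \<in> N}" "A \<subseteq> {p \<in> B. \<pi> p \<in> N}" "N = \<pi> ` {p \<in> B. \<pi> p \<in> N}"
proof -
  interpret submodule N polyring M by (rule assms)
  have N0: "\<pi> 0 \<in> N" using one_closed by (simp add: pi_zero)
  show "is_ideal {p \<in> B. \<pi> p \<in> N}"
  proof (rule is_idealI)
    show "p + q \<in> {p \<in> B. \<pi> p \<in> N}" if "p \<in> {p \<in> B. \<pi> p \<in> N}" "q \<in> {p \<in> B. \<pi> p \<in> N}" for p q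
      using that m_closed[of "\<pi> p" "\<pi> q"] ideal_add[OF B] by (auto simp: pi_add)
    show "s * p \<in> {p \<in> B. \<pi> p \<in> N}" if "p \<in> {p \<in> B. \<pi> p \<in> N}" for s p
      using that smult_closed[of s "\<pi> p"] ideal_mult[OF B] by (auto simp: pi_smult)
  qed (use N0 ideal_0[OF B] in auto)
  show "A \<subseteq> {p \<in> B. \<pi> p \<in> N}"
  proof
    fix p assume "p \<in> A"
    then have "p \<in> B" "\<pi> p = \<pi> 0" using A_sub pi_eq_zero[of p] by (auto simp: pi_zero)
    then show "p \<in> {p \<in> B. \<pi> p \<in> N}" using N0 by simp
  qed
  show "N = \<pi> ` {p \<in> B. \<pi> p \<in> N}" using subset by (auto simp: carrier_eq)
qed

text \<open>Only the listed operations of \<open>M'\<close> are compared with those of $M$, so that it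
  applies to every record that extends the module, in particular to graded submodules.\<close>

lemma presented_sub:
  fixes M' :: "(('k, 'n) mpoly, 'm, 'y) module_scheme"
  assumes "is_ideal C" "A \<subseteq> C" "C \<subseteq> B" and "carrier M' = \<pi> ` C"
    and "add M' = add M" "zero M' = zero M" "module.smult M' = module.smult M"
  shows "presented M' A C \<pi>"
  by unfold_locales (use assms A pi_add pi_zero pi_eq pi_smult in \<open>auto simp: subset_iff\<close>)

lemma coset_eq:
  assumes "is_ideal C" "C \<subseteq> B" "p \<in> B"
  shows "\<pi> ` C +>\<^bsub>M\<^esub> \<pi> p = \<pi> ` {q \<in> B. q - p \<in> C}"
proof
  show "\<pi> ` C +>\<^bsub>M\<^esub> \<pi> p \<subseteq> \<pi> ` {q \<in> B. q - p \<in> C}"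
  proof
    fix x assume "x \<in> \<pi> ` C +>\<^bsub>M\<^esub> \<pi> p"
    then obtain c where c: "c \<in> C" "x = \<pi> c \<oplus>\<^bsub>M\<^esub> \<pi> p" unfolding a_r_coset_def' by auto
    then have "x = \<pi> (c + p)" "c + p \<in> B" using pi_add assms ideal_add[OF B] by auto
    then show "x \<in> \<pi> ` {q \<in> B. q - p \<in> C}" using c by auto
  qed
  show "\<pi> ` {q \<in> B. q - p \<in> C} \<subseteq> \<pi> ` C +>\<^bsub>M\<^esub> \<pi> p"
  proof clarify
    fix q assume q: "q \<in> B" "q - p \<in> C"
    then have "\<pi> (q - p) \<oplus>\<^bsub>M\<^esub> \<pi> p = \<pi> q" using pi_add[of "q - p" p] assms by auto
    then show "\<pi> q \<in> \<pi> ` C +>\<^bsub>M\<^esub> \<pi> p" using q(2) unfolding a_r_coset_def' by force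
  qed
qed

text \<open>Stated for any record with these operations, so that it covers both \<open>quot_module\<close>
  and \<open>gquot\<close>.\<close>

lemma presented_quot:
  fixes M' :: "(('k, 'n) mpoly, 'm set, 'y) module_scheme"
  assumes C: "is_ideal C" "A \<subseteq> C" "C \<subseteq> B"
    and M': "carrier M' = a_rcosets\<^bsub>M\<^esub> (\<pi> ` C)" "add M' = set_add M" "zero M' = \<pi> ` C"
      "module.smult M' = (\<lambda>s H. \<Union>x\<in>H. \<pi> ` C +>\<^bsub>M\<^esub> (s \<odot>\<^bsub>M\<^esub> x))"
  shows "presented M' C B (\<lambda>p. \<pi> ` C +>\<^bsub>M\<^esub> \<pi> p)"
proof -
  note coset = coset_eq[OF C(1,3)]
  have self: "\<pi> p \<in> \<pi> ` C +>\<^bsub>M\<^esub> \<pi> p" if "p \<in> B" for p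
    using coset[OF that] that ideal_0[OF C(1)] by auto
  have eq: "\<pi> ` C +>\<^bsub>M\<^esub> \<pi> p = \<pi> ` C +>\<^bsub>M\<^esub> \<pi> q \<longleftrightarrow> p - q \<in> C" if pq: "p \<in> B" "q \<in> B" for p q
  proof
    assume "\<pi> ` C +>\<^bsub>M\<^esub> \<pi> p = \<pi> ` C +>\<^bsub>M\<^esub> \<pi> q"
    then obtain q' where q': "q' \<in> B" "q' - q \<in> C" "\<pi> p = \<pi> q'"
      using self[OF pq(1)] coset[OF pq(2)] by auto
    then have "p - q' \<in> C" using pi_eq[OF pq(1) q'(1)] C(2) by auto
    then show "p - q \<in> C" using ideal_add[OF C(1) _ q'(2)] by fastforce
  next
    assume pqC: "p - q \<in> C"
    have "t - p \<in> C \<longleftrightarrow> t - q \<in> C" for t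
      using ideal_add_cancel(2)[OF C(1) pqC, of "t - p"] by simp
    then show "\<pi> ` C +>\<^bsub>M\<^esub> \<pi> p = \<pi> ` C +>\<^bsub>M\<^esub> \<pi> q" using coset pq by simp
  qed
  have zero: "\<pi> ` C = \<pi> ` C +>\<^bsub>M\<^esub> \<pi> 0"
    using coset[OF ideal_0[OF B]] C(3) by (simp add: Collect_conj_eq inf_absorb2)
  show ?thesis
  proof unfold_locales
    show "carrier M' = (\<lambda>p. \<pi> ` C +>\<^bsub>M\<^esub> \<pi> p) ` B" unfolding M'(1) A_RCOSETS_def' carrier_eq by auto
    fix p assume p: "p \<in> B"
    show "(\<pi> ` C +>\<^bsub>M\<^esub> \<pi> p) \<oplus>\<^bsub>M'\<^esub> (\<pi> ` C +>\<^bsub>M\<^esub> \<pi> q) = \<pi> ` C +>\<^bsub>M\<^esub> \<pi> (p + q)" if q: "q \<in> B" for q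
    proof -
      have "(\<pi> ` C +>\<^bsub>M\<^esub> \<pi> p) \<oplus>\<^bsub>M'\<^esub> (\<pi> ` C +>\<^bsub>M\<^esub> \<pi> q) =
          {x \<oplus>\<^bsub>M\<^esub> y |x y. x \<in> \<pi> ` {a \<in> B. a - p \<in> C} \<and> y \<in> \<pi> ` {b \<in> B. b - q \<in> C}}"
        unfolding M'(2) coset[OF p] coset[OF q] set_add_def' by auto
      also have "\<dots> = \<pi> ` {t \<in> B. t - (p + q) \<in> C}"
      proof
        show "{x \<oplus>\<^bsub>M\<^esub> y |x y. x \<in> \<pi> ` {a \<in> B. a - p \<in> C} \<and> y \<in> \<pi> ` {b \<in> B. b - q \<in> C}} \<subseteq>
            \<pi> ` {t \<in> B. t - (p + q) \<in> C}"
        proof clarify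
          fix a b assume ab: "a \<in> B" "a - p \<in> C" "b \<in> B" "b - q \<in> C"
          have "a + b - (p + q) \<in> C" using ideal_add[OF C(1) ab(2,4)] by (simp add: algebra_simps)
          then show "\<pi> a \<oplus>\<^bsub>M\<^esub> \<pi> b \<in> \<pi> ` {t \<in> B. t - (p + q) \<in> C}"
            using ab ideal_add[OF B] by (auto simp: pi_add)
        qed
        show "\<pi> ` {t \<in> B. t - (p + q) \<in> C} \<subseteq>
            {x \<oplus>\<^bsub>M\<^esub> y |x y. x \<in> \<pi> ` {a \<in> B. a - p \<in> C} \<and> y \<in> \<pi> ` {b \<in> B. b - q \<in> C}}"
        proof clarify
          fix t assume t: "t \<in> B" "t - (p + q) \<in> C"
          have "\<pi> t = \<pi> (t - q) \<oplus>\<^bsub>M\<^esub> \<pi> q" using pi_add[of "t - q" q] ideal_diff[OF B t(1) q] q by simp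
          moreover have "t - q \<in> {a \<in> B. a - p \<in> C}"
            using t ideal_diff[OF B t(1) q] by (simp add: algebra_simps)
          moreover have "q \<in> {b \<in> B. b - q \<in> C}" using q ideal_0[OF C(1)] by simp
          ultimately show "\<exists>x y. \<pi> t = x \<oplus>\<^bsub>M\<^esub> y \<and> x \<in> \<pi> ` {a \<in> B. a - p \<in> C} \<and> y \<in> \<pi> ` {b \<in> B. b - q \<in> C}"
            by blast
        qed
      qed
      also have "\<dots> = \<pi> ` C +>\<^bsub>M\<^esub> \<pi> (p + q)" using coset[OF ideal_add[OF B p q]] by simp
      finally show ?thesis .
    qed
    show "s \<odot>\<^bsub>M'\<^esub> (\<pi> ` C +>\<^bsub>M\<^esub> \<pi> p) = \<pi> ` C +>\<^bsub>M\<^esub> \<pi> (s * p)" for s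
    proof -
      have "\<pi> ` C +>\<^bsub>M\<^esub> (s \<odot>\<^bsub>M\<^esub> x) = \<pi> ` C +>\<^bsub>M\<^esub> \<pi> (s * p)" if "x \<in> \<pi> ` C +>\<^bsub>M\<^esub> \<pi> p" for x
      proof -
        obtain q where q: "q \<in> B" "q - p \<in> C" "x = \<pi> q" using \<open>x \<in> _\<close> coset[OF p] by auto
        have "s * q - s * p \<in> C" using ideal_mult[OF C(1) q(2), of s] by (simp add: algebra_simps)
        then show ?thesis using eq q p ideal_mult[OF B] by (simp add: pi_smult)
      qed
      then show ?thesis unfolding M'(4) using self[OF p] by blast
    qed
  qed (use C B eq zero M'(3) in auto)
qed

lemma nonzerodivisor_on_iff: "nonzerodivisor_on f M \<longleftrightarrow> (\<forall>p\<in>B. f * p \<in> A \<longrightarrow> p \<in> A)"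
  unfolding nonzerodivisor_on_def carrier_eq using ideal_mult[OF B] by (auto simp: pi_smult pi_eq_zero)

text \<open>The elements $s$ with $sB \subseteq A + f_1 B + \cdots$ form an ideal that contains the $f_i$.\<close>

lemma ideal_smult_eq:
  "ideal_smult polyring (Idl\<^bsub>polyring\<^esub> (set fs)) M = \<pi> ` ideal_plus_list fs A B"
proof
  let ?C = "ideal_plus_list fs A B"
  have C: "is_ideal ?C" "A \<subseteq> ?C" using is_ideal_plus_list[OF A B] ideal_plus_list_superset[OF A B] .
  have CB: "?C \<subseteq> B" by (rule ideal_plus_list_least[OF B A_sub]) (rule ideal_mult[OF B])
  have "is_ideal {s. \<forall>b\<in>B. s * b \<in> ?C}"
    by (rule is_idealI) (use ideal_0[OF C(1)] ideal_add[OF C(1)] ideal_mult[OF C(1)] in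
        \<open>auto simp: distrib_right mult.assoc\<close>)
  then have J: "Idl\<^bsub>polyring\<^esub> (set fs) \<subseteq> {s. \<forall>b\<in>B. s * b \<in> ?C}"
    by (rule Idl_least) (use ideal_plus_list_mult[OF A B] in auto)
  have "\<forall>s\<in>Idl\<^bsub>polyring\<^esub> (set fs). \<forall>x\<in>carrier M. s \<odot>\<^bsub>M\<^esub> x \<in> \<pi> ` ?C"
    using J unfolding carrier_eq by (auto simp: pi_smult)
  then show "ideal_smult polyring (Idl\<^bsub>polyring\<^esub> (set fs)) M \<subseteq> \<pi> ` ?C"
    unfolding ideal_smult_def using submodule_image[OF C(1) CB] by blast
  show "\<pi> ` ?C \<subseteq> ideal_smult polyring (Idl\<^bsub>polyring\<^esub> (set fs)) M"
    unfolding ideal_smult_def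
  proof (rule Inter_greatest, clarify)
    fix N p assume N: "submodule N polyring M" "\<forall>s\<in>Idl\<^bsub>polyring\<^esub> (set fs). \<forall>x\<in>carrier M. s \<odot>\<^bsub>M\<^esub> x \<in> N"
      and p: "p \<in> ?C"
    have "?C \<subseteq> {p \<in> B. \<pi> p \<in> N}"
    proof (rule ideal_plus_list_least[OF submodule_vimage(1,2)[OF N(1)]])
      fix f b assume fb: "f \<in> set fs" "b \<in> B"
      then have "f \<odot>\<^bsub>M\<^esub> \<pi> b \<in> N" using N(2) Idl_superset unfolding carrier_eq by blast
      then show "f * b \<in> {p \<in> B. \<pi> p \<in> N}" using fb ideal_mult[OF B] by (simp add: pi_smult)
    qed
    then show "\<pi> p \<in> N" using p by blast
  qed
qed

lemma regular_sequence_iff: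
  "regular_sequence polyring M fs \<longleftrightarrow> weakly_regular fs A B \<and> ideal_plus_list fs A B \<noteq> B"
proof -
  have C: "is_ideal (ideal_plus_list gs A B)" "A \<subseteq> ideal_plus_list gs A B" "ideal_plus_list gs A B \<subseteq> B" for gs
    using is_ideal_plus_list[OF A B] ideal_plus_list_superset[OF A B]
      ideal_plus_list_least[OF B A_sub] ideal_mult[OF B] by blast+
  have "nonzerodivisor_on f (quot_module M (ideal_smult polyring (Idl\<^bsub>polyring\<^esub> (set gs)) M)) \<longleftrightarrow>
      (\<forall>p\<in>B. f * p \<in> ideal_plus_list gs A B \<longrightarrow> p \<in> ideal_plus_list gs A B)" for f gs
  proof -
    interpret Q: presented "quot_module M (\<pi> ` ideal_plus_list gs A B)" "ideal_plus_list gs A B" B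
      "\<lambda>p. \<pi> ` ideal_plus_list gs A B +>\<^bsub>M\<^esub> \<pi> p"
      by (rule presented_quot[OF C]) (simp_all add: quot_module_def)
    show ?thesis unfolding ideal_smult_eq by (rule Q.nonzerodivisor_on_iff)
  qed
  moreover have "\<pi> ` ideal_plus_list fs A B = carrier M \<longleftrightarrow> ideal_plus_list fs A B = B"
    unfolding carrier_eq using image_ideal_mem_iff[OF C, of _ fs] C(3)[of fs] by blast
  ultimately show ?thesis
    unfolding regular_sequence_def weakly_regular_nth ideal_smult_eq by simp
qed

end

section \<open>Multigradings\<close>

definition multidegree :: "('n \<Rightarrow>\<^sub>0 nat) \<Rightarrow> 'n \<Rightarrow> int"
  where "multidegree v = (\<lambda>i. int (lookup v i))"

lemma multidegree_add: "multidegree (v + w) = multidegree v + multidegree w"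
  unfolding multidegree_def by (auto simp: lookup_add)

definition homogeneous :: "('n \<Rightarrow> int) \<Rightarrow> ('k::field, 'n::finite) mpoly set"
  where "homogeneous a = {p. \<forall>v\<in>keys p. multidegree v = a}"

lemma gr_polymod: "gr polymod a = homogeneous a"
  unfolding polymod_def homogeneous_def multidegree_def by simp

text \<open>The projection of a polynomial to the span of the monomials with exponents in $V$.\<close>

definition restrict_keys :: "('n \<Rightarrow>\<^sub>0 nat) set \<Rightarrow> ('k::field, 'n::finite) mpoly \<Rightarrow> ('k, 'n) mpoly"
  where "restrict_keys V p = Abs_poly_mapping (\<lambda>v. lookup p v when v \<in> V)"

lemma lookup_restrict_keys: "lookup (restrict_keys V p) v = (lookup p v when v \<in> V)"
proof -
  have "finite {v. (lookup p v when v \<in> V) \<noteq> 0}"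
    by (rule finite_subset[of _ "keys p"]) (auto simp: in_keys_iff)
  then show ?thesis unfolding restrict_keys_def by simp
qed

lemma keys_restrict_keys: "keys (restrict_keys V p) = keys p \<inter> V"
  by (auto simp: in_keys_iff lookup_restrict_keys)

lemma restrict_keys_add: "restrict_keys V (p + q) = restrict_keys V p + restrict_keys V q"
  by (rule poly_mapping_eqI) (simp add: lookup_restrict_keys lookup_add when_add_distrib)

lemma restrict_keys_diff: "restrict_keys V (p - q) = restrict_keys V p - restrict_keys V q"
  by (rule poly_mapping_eqI) (simp add: lookup_restrict_keys lookup_minus when_diff_distrib)

lemma restrict_keys_sum: "restrict_keys V (\<Sum>i\<in>F. p i) = (\<Sum>i\<in>F. restrict_keys V (p i))"
  by (rule poly_mapping_eqI) (auto simp: lookup_restrict_keys lookup_sum when_def)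

lemma restrict_keys_id: "keys p \<subseteq> V \<Longrightarrow> restrict_keys V p = p"
  by (rule poly_mapping_eqI) (auto simp: lookup_restrict_keys when_def in_keys_iff)

lemma restrict_keys_0: "keys p \<inter> V = {} \<Longrightarrow> restrict_keys V p = 0"
  by (rule poly_mapping_eqI) (auto simp: lookup_restrict_keys when_def in_keys_iff)

lemma restrict_keys_mono_ideal: "p \<in> mono_ideal U \<Longrightarrow> restrict_keys V p \<in> mono_ideal U"
  unfolding mono_ideal_def by (auto simp: keys_restrict_keys)

abbreviation component :: "('n \<Rightarrow> int) \<Rightarrow> ('k::field, 'n::finite) mpoly \<Rightarrow> ('k, 'n) mpoly"
  where "component a \<equiv> restrict_keys {v. multidegree v = a}"

lemma component_homogeneous [simp]: "component a p \<in> homogeneous a"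
  unfolding homogeneous_def by (auto simp: keys_restrict_keys)

lemma component_of_homogeneous: "p \<in> homogeneous b \<Longrightarrow> component a p = (if a = b then p else 0)"
  unfolding homogeneous_def by (auto intro!: restrict_keys_id restrict_keys_0)

lemma homogeneous_mult: "p \<in> homogeneous a \<Longrightarrow> q \<in> homogeneous b \<Longrightarrow> p * q \<in> homogeneous (a + b)"
  unfolding homogeneous_def using keys_mult[of p q] by (fastforce simp: multidegree_add)

lemma homogeneous_add: "p \<in> homogeneous a \<Longrightarrow> q \<in> homogeneous a \<Longrightarrow> p + q \<in> homogeneous a"
  unfolding homogeneous_def using keys_add[of p q] by blast

lemma homogeneous_monomial_mult:
  "single g 1 * s \<in> homogeneous b \<longleftrightarrow> s \<in> homogeneous (b - multidegree g)"
  unfolding homogeneous_def mem_Collect_eq keys_monomial_mult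
  by (auto simp: multidegree_add algebra_simps)

lemma component_monomial_mult:
  fixes s :: "('k::field, 'n::finite) mpoly"
  shows "component b (single g 1 * s) = single g 1 * component (b - multidegree g) s"
proof -
  have s: "s = component (b - multidegree g) s + restrict_keys {v. multidegree v \<noteq> b - multidegree g} s"
    (is "_ = ?c + ?r")
    by (rule poly_mapping_eqI) (auto simp: lookup_add lookup_restrict_keys when_def)
  have "component b (single g 1 * ?c) = single g 1 * ?c"
    using component_of_homogeneous[of "single g 1 * ?c" b b] by (simp add: homogeneous_monomial_mult)
  moreover have "component b (single g 1 * ?r) = 0"
    by (rule restrict_keys_0)
      (auto simp: keys_monomial_mult keys_restrict_keys multidegree_add algebra_simps)
  moreover have "component b (single g 1 * s) = component b (single g 1 * ?c) + component b (single g 1 * ?r)"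
    by (subst s) (simp only: distrib_left restrict_keys_add)
  ultimately show ?thesis by simp
qed

locale graded_presented =
  fixes M :: "(('k::field, 'n::finite) mpoly, 'm, 'n) gmodule"
    and U V :: "('n \<Rightarrow>\<^sub>0 nat) set" and \<pi> :: "('k, 'n) mpoly \<Rightarrow> 'm"
  assumes presented: "presented M (mono_ideal U) (mono_ideal V) \<pi>"
    and up_U: "up_closed U" and up_V: "up_closed V"
    and gr_eq: "gr M a = \<pi> ` (mono_ideal V \<inter> homogeneous a)"
begin

sublocale presented M "mono_ideal U" "mono_ideal V" \<pi> by (rule presented)

lemma subgroup_gr: "subgroup (gr M a) (add_monoid M)"
proof -
  interpret abelian_group M by (rule is_abelian_group)
  show ?thesis
  proof (rule add.subgroupI)
    show "gr M a \<subseteq> carrier M" unfolding gr_eq carrier_eq by auto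
    show "gr M a \<noteq> {}" unfolding gr_eq using ideal_0[OF B] by (auto simp: homogeneous_def)
    show "\<ominus>\<^bsub>M\<^esub> x \<in> gr M a" if x: "x \<in> gr M a" for x
    proof -
      obtain p where p: "p \<in> mono_ideal V" "p \<in> homogeneous a" "x = \<pi> p" using x unfolding gr_eq by auto
      then have "- p \<in> mono_ideal V \<inter> homogeneous a"
        using ideal_uminus[OF B] by (auto simp: homogeneous_def)
      then show ?thesis using p a_inv_pi unfolding gr_eq by auto
    qed
    show "x \<oplus>\<^bsub>M\<^esub> y \<in> gr M a" if x: "x \<in> gr M a" and y: "y \<in> gr M a" for x y
    proof -
      obtain p q where p: "p \<in> mono_ideal V" "p \<in> homogeneous a" "x = \<pi> p"
        and q: "q \<in> mono_ideal V" "q \<in> homogeneous a" "y = \<pi> q" using x y unfolding gr_eq by auto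
      have "p + q \<in> mono_ideal V \<inter> homogeneous a"
        using ideal_add[OF B p(1) q(1)] homogeneous_add[OF p(2) q(2)] by simp
      then show ?thesis using p q pi_add unfolding gr_eq by auto
    qed
  qed
qed

text \<open>A monomial ideal is closed under taking components, so two elements of the same class have
  components of the same class in every degree.\<close>

lemma graded_decomposition:
  assumes x: "x \<in> carrier M"
  shows "\<exists>!f. (\<forall>a. f a \<in> gr M a) \<and> finite {a. f a \<noteq> \<zero>\<^bsub>M\<^esub>} \<and>
    x = (\<Oplus>\<^bsub>M\<^esub>a\<in>{a. f a \<noteq> \<zero>\<^bsub>M\<^esub>}. f a)"
proof -
  obtain p where p: "p \<in> mono_ideal V" "x = \<pi> p" using x unfolding carrier_eq by auto
  define f0 where "f0 a = \<pi> (component a p)" for a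
  have cV: "component a p \<in> mono_ideal V" for a by (rule restrict_keys_mono_ideal[OF p(1)])
  have supp: "{a. f0 a \<noteq> \<zero>\<^bsub>M\<^esub>} \<subseteq> multidegree ` keys p"
  proof
    fix a assume "a \<in> {a. f0 a \<noteq> \<zero>\<^bsub>M\<^esub>}"
    then have "component a p \<noteq> 0" unfolding f0_def by (auto simp: pi_zero)
    then have "keys p \<inter> {v. multidegree v = a} \<noteq> {}" using restrict_keys_0 by blast
    then show "a \<in> multidegree ` keys p" by auto
  qed
  have fin: "finite {a. f0 a \<noteq> \<zero>\<^bsub>M\<^esub>}" by (rule finite_subset[OF supp]) simp
  let ?F = "{a. f0 a \<noteq> \<zero>\<^bsub>M\<^esub>}"
  have sum0: "(\<Oplus>\<^bsub>M\<^esub>a\<in>?F. f0 a) = \<pi> (\<Sum>a\<in>?F. component a p)"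
    unfolding f0_def[of "_"] by (rule finsum_pi) (use fin cV in \<open>simp_all add: f0_def\<close>)
  have "p - (\<Sum>a\<in>?F. component a p) \<in> mono_ideal U"
    unfolding mono_ideal_def mem_Collect_eq
  proof
    fix v assume v: "v \<in> keys (p - (\<Sum>a\<in>?F. component a p))"
    have "lookup (\<Sum>a\<in>?F. component a p) v = (\<Sum>a\<in>?F. if a = multidegree v then lookup p v else 0)"
      unfolding lookup_sum by (rule sum.cong) (auto simp: lookup_restrict_keys when_def)
    also have "\<dots> = (if multidegree v \<in> ?F then lookup p v else 0)" using fin by simp
    finally have v': "multidegree v \<notin> ?F" "lookup p v \<noteq> 0"
      using v by (auto simp: in_keys_iff lookup_minus split: if_splits)
    then have "component (multidegree v) p \<in> mono_ideal U"
      using pi_eq_zero[OF cV] unfolding f0_def by auto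
    moreover have "v \<in> keys (component (multidegree v) p)"
      using v'(2) by (simp add: keys_restrict_keys in_keys_iff)
    ultimately show "v \<in> U" unfolding mono_ideal_def by blast
  qed
  then have x0: "x = (\<Oplus>\<^bsub>M\<^esub>a\<in>?F. f0 a)"
    unfolding sum0 p(2) by (subst pi_eq[OF p(1) ideal_sum[OF B cV]])
  show ?thesis
  proof (rule ex1I[of _ f0], intro conjI allI)
    show "f0 a \<in> gr M a" for a unfolding f0_def gr_eq using cV by auto
    show "finite ?F" "x = (\<Oplus>\<^bsub>M\<^esub>a\<in>?F. f0 a)" by (fact fin, fact x0)
    fix f assume f: "(\<forall>a. f a \<in> gr M a) \<and> finite {a. f a \<noteq> \<zero>\<^bsub>M\<^esub>} \<and>
      x = (\<Oplus>\<^bsub>M\<^esub>a\<in>{a. f a \<noteq> \<zero>\<^bsub>M\<^esub>}. f a)"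
    let ?G = "{a. f a \<noteq> \<zero>\<^bsub>M\<^esub>}"
    have "\<forall>a. \<exists>q. q \<in> mono_ideal V \<and> q \<in> homogeneous a \<and> f a = \<pi> q" using f unfolding gr_eq by blast
    then obtain q where q: "\<And>a. q a \<in> mono_ideal V" "\<And>a. q a \<in> homogeneous a" "\<And>a. f a = \<pi> (q a)"
      by metis
    have "(\<Oplus>\<^bsub>M\<^esub>a\<in>?G. f a) = \<pi> (\<Sum>a\<in>?G. q a)"
      using finsum_pi[of ?G q] f q(1) by (simp add: q(3))
    then have "\<pi> p = \<pi> (\<Sum>a\<in>?G. q a)" using f p(2) by simp
    then have diff: "p - (\<Sum>a\<in>?G. q a) \<in> mono_ideal U"
      using pi_eq[OF p(1)] ideal_sum[OF B, of ?G q] q(1) by simp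
    show "f = f0"
    proof
      fix a
      have "component a (\<Sum>b\<in>?G. q b) = (\<Sum>b\<in>?G. if b = a then q a else 0)"
        unfolding restrict_keys_sum by (rule sum.cong) (use component_of_homogeneous[OF q(2)] in auto)
      also have "\<dots> = (if a \<in> ?G then q a else 0)" using f by simp
      finally have c: "component a p - (if a \<in> ?G then q a else 0) \<in> mono_ideal U"
        using restrict_keys_mono_ideal[OF diff, of "{v. multidegree v = a}"] by (simp add: restrict_keys_diff)
      have "component a p - q a \<in> mono_ideal U"
      proof (cases "a \<in> ?G")
        case False
        then have "q a \<in> mono_ideal U" using pi_eq_zero[OF q(1)] q(3) by auto
        then show ?thesis using c False ideal_diff[OF A] by simp
      qed (use c in simp)
      then show "f a = f0 a" using pi_eq[OF cV q(1), of a a] unfolding f0_def q(3) by simp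
    qed
  qed
qed

lemma is_graded_module: "graded_module M"
  unfolding graded_module_def
proof (intro conjI allI ballI)
  fix a b and p :: "('k, 'n) mpoly" and x assume p: "p \<in> gr polymod a" and x: "x \<in> gr M b"
  obtain q where q: "q \<in> mono_ideal V" "q \<in> homogeneous b" "x = \<pi> q" using x unfolding gr_eq by auto
  have "p * q \<in> mono_ideal V \<inter> homogeneous (a + b)"
    using ideal_mult[OF B q(1)] homogeneous_mult q(2) p unfolding gr_polymod by blast
  then show "p \<odot>\<^bsub>M\<^esub> x \<in> gr M (a + b)" unfolding gr_eq q(3) by (auto simp: pi_smult[OF q(1)])
qed (use is_module subgroup_gr graded_decomposition in auto)

lemma graded_presented_gsub:
  assumes W: "up_closed W" "U \<subseteq> W" "W \<subseteq> V"
  shows "graded_presented (gsub M (\<pi> ` mono_ideal W)) U W \<pi>"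
proof (rule graded_presented.intro)
  have sub: "mono_ideal U \<subseteq> (mono_ideal W :: ('k, 'n) mpoly set)"
    "mono_ideal W \<subseteq> (mono_ideal V :: ('k, 'n) mpoly set)"
    using W by (simp_all add: mono_ideal_subset_iff)
  show "presented (gsub M (\<pi> ` mono_ideal W)) (mono_ideal U) (mono_ideal W) \<pi>"
    by (rule presented_sub[OF is_ideal_mono_ideal[OF W(1)] sub]) (simp_all add: gsub_def)
  show "gr (gsub M (\<pi> ` mono_ideal W)) a = \<pi> ` (mono_ideal W \<inter> homogeneous a)" for a
  proof -
    have "gr (gsub M (\<pi> ` mono_ideal W)) a = \<pi> ` (mono_ideal V \<inter> homogeneous a) \<inter> \<pi> ` mono_ideal W"
      unfolding gsub_def by (simp add: gr_eq)
    also have "\<dots> = \<pi> ` (mono_ideal W \<inter> homogeneous a)"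
      using image_ideal_mem_iff[OF is_ideal_mono_ideal[OF W(1)] sub] sub by blast
    finally show ?thesis .
  qed
qed (use up_U W in auto)

lemma graded_presented_gquot:
  assumes W: "up_closed W" "U \<subseteq> W" "W \<subseteq> V"
  shows "graded_presented (gquot M (\<pi> ` mono_ideal W)) W V (\<lambda>p. \<pi> ` mono_ideal W +>\<^bsub>M\<^esub> \<pi> p)"
proof (rule graded_presented.intro)
  have sub: "mono_ideal U \<subseteq> (mono_ideal W :: ('k, 'n) mpoly set)"
    "mono_ideal W \<subseteq> (mono_ideal V :: ('k, 'n) mpoly set)"
    using W by (simp_all add: mono_ideal_subset_iff)
  show "presented (gquot M (\<pi> ` mono_ideal W)) (mono_ideal W) (mono_ideal V)
      (\<lambda>p. \<pi> ` mono_ideal W +>\<^bsub>M\<^esub> \<pi> p)"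
    by (rule presented_quot[OF is_ideal_mono_ideal[OF W(1)] sub])
      (simp_all add: gquot_def quot_module_def module.defs)
  show "gr (gquot M (\<pi> ` mono_ideal W)) a =
      (\<lambda>p. \<pi> ` mono_ideal W +>\<^bsub>M\<^esub> \<pi> p) ` (mono_ideal V \<inter> homogeneous a)" for a
    unfolding gquot_def by (simp add: module.defs gr_eq image_image)
qed (use up_V W in auto)

lemma graded_submodule_image:
  assumes W: "up_closed W" "U \<subseteq> W" "W \<subseteq> V"
  shows "graded_submodule M (\<pi> ` mono_ideal W)"
  unfolding graded_submodule_def
  using graded_presented.is_graded_module[OF graded_presented_gsub[OF W]]
    submodule_image[OF is_ideal_mono_ideal[OF W(1)]] W(3) by (simp add: mono_ideal_subset_iff)

end

lemma graded_presented_polymod: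
  "graded_presented (polymod :: (('k::field, 'n::finite) mpoly, ('k, 'n) mpoly, 'n) gmodule) {} UNIV (\<lambda>p. p)"
proof (rule graded_presented.intro)
  show "presented (polymod :: (('k, 'n) mpoly, ('k, 'n) mpoly, 'n) gmodule)
      (mono_ideal {}) (mono_ideal UNIV) (\<lambda>p. p)"
    by unfold_locales (simp_all add: polymod_def)
qed (simp_all add: gr_polymod up_closed_def)

lemma graded_presented_quotient:
  "up_closed U \<Longrightarrow> graded_presented (gquot polymod (mono_ideal U)) U UNIV (\<lambda>p. mono_ideal U +>\<^bsub>polymod\<^esub> p)"
  using graded_presented.graded_presented_gquot[OF graded_presented_polymod, of U] by simp

lemma graded_presented_ideal:
  "up_closed U \<Longrightarrow> graded_presented (gsub polymod (mono_ideal U)) {} U (\<lambda>p. p)"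
  using graded_presented.graded_presented_gsub[OF graded_presented_polymod, of U] by simp

text \<open>The isomorphism is inverse to $s \mapsto x^g s$. It respects degrees, because taking the
  component of degree $b$ commutes with multiplication by $x^g$ up to the shift.\<close>

lemma graded_iso_colon:
  fixes Q :: "(('k::field, 'n::finite) mpoly, 'm, 'n) gmodule"
    and R :: "(('k, 'n) mpoly, 'l, 'n) gmodule"
  assumes Q: "graded_presented Q W W' \<pi>1" and R: "graded_presented R (var_exponents T) UNIV \<pi>2"
    and up: "up_closed (W \<union> box g T)" "W \<inter> box g T = {}" and W': "W' = W \<union> box g T"
  shows "graded_iso Q (gshift R (multidegree g))"
proof -
  interpret Q: graded_presented Q W W' \<pi>1 by (rule Q)
  interpret R: graded_presented R "var_exponents T" UNIV \<pi>2 by (rule R)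
  let ?g = "single g 1 :: ('k, 'n) mpoly"
  define \<alpha> where "\<alpha> s = \<pi>1 (?g * s)" for s
  have W'_eq: "mono_ideal W' = ideal_plus (mono_ideal W) ?g UNIV"
    unfolding W' by (rule mono_ideal_Un_box[OF Q.up_U up(1)])
  have gs: "?g * s \<in> mono_ideal W'" for s
    unfolding W'_eq by (rule ideal_plus_mult[OF Q.A]) simp
  have colon: "?g * s \<in> mono_ideal W \<longleftrightarrow> s \<in> var_prime T" for s
    using mono_ideal_box_colon[OF up] by blast
  have \<alpha>_eq: "\<alpha> s = \<alpha> t \<longleftrightarrow> \<pi>2 s = \<pi>2 t" for s t
    unfolding \<alpha>_def using Q.pi_eq[OF gs gs, of s t] R.pi_eq[of s t] colon[of "s - t"]
    by (simp add: algebra_simps)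
  \<comment> \<open>independent of the choice of \<open>s\<close> by \<open>\<alpha>_eq\<close>\<close>
  define \<phi> where "\<phi> x = \<pi>2 (SOME s. \<alpha> s = x)" for x
  have \<phi>: "\<phi> (\<alpha> s) = \<pi>2 s" for s
    unfolding \<phi>_def using someI[of "\<lambda>t. \<alpha> t = \<alpha> s" s] \<alpha>_eq by blast
  have \<alpha>_cover: "\<pi>1 p = \<alpha> s" if "p \<in> mono_ideal W'" "p = c + ?g * s" "c \<in> mono_ideal W" for p c s
    unfolding \<alpha>_def using Q.pi_eq[OF that(1) gs, of s] that by simp
  have carr: "carrier Q = range \<alpha>"
  proof
    show "carrier Q \<subseteq> range \<alpha>"
    proof
      fix x assume "x \<in> carrier Q"
      then obtain p where p: "p \<in> mono_ideal W'" "x = \<pi>1 p" unfolding Q.carrier_eq by auto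
      obtain c s where "c \<in> mono_ideal W" "p = c + ?g * s"
        using p(1) unfolding W'_eq by (auto elim: ideal_plusE)
      then show "x \<in> range \<alpha>" using \<alpha>_cover p by blast
    qed
  qed (use gs in \<open>auto simp: \<alpha>_def Q.carrier_eq\<close>)
  have gr: "gr Q b = \<alpha> ` homogeneous (b - multidegree g)" for b
  proof
    show "gr Q b \<subseteq> \<alpha> ` homogeneous (b - multidegree g)"
    proof
      fix x assume "x \<in> gr Q b"
      then obtain p where p: "p \<in> mono_ideal W'" "p \<in> homogeneous b" "x = \<pi>1 p"
        unfolding Q.gr_eq by auto
      obtain c s where cs: "c \<in> mono_ideal W" "p = c + ?g * s"
        using p(1) unfolding W'_eq by (auto elim: ideal_plusE)
      have "p = component b c + ?g * component (b - multidegree g) s"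
        using component_of_homogeneous[OF p(2), of b] unfolding cs(2)
        by (simp add: restrict_keys_add component_monomial_mult)
      then have "x = \<alpha> (component (b - multidegree g) s)"
        using \<alpha>_cover[OF p(1)] restrict_keys_mono_ideal[OF cs(1)] p(3) by blast
      then show "x \<in> \<alpha> ` homogeneous (b - multidegree g)" by auto
    qed
    show "\<alpha> ` homogeneous (b - multidegree g) \<subseteq> gr Q b"
      unfolding Q.gr_eq \<alpha>_def using gs by (auto simp: homogeneous_monomial_mult)
  qed
  have "bij_betw \<phi> (carrier Q) (carrier R)"
    unfolding bij_betw_def inj_on_def carr R.carrier_eq using \<phi> \<alpha>_eq by (auto simp: image_image)
  moreover have "\<phi> (x \<oplus>\<^bsub>Q\<^esub> y) = \<phi> x \<oplus>\<^bsub>R\<^esub> \<phi> y" if xy: "x \<in> carrier Q" "y \<in> carrier Q" for x y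
  proof -
    obtain s t where st: "x = \<alpha> s" "y = \<alpha> t" using xy unfolding carr by auto
    have "x \<oplus>\<^bsub>Q\<^esub> y = \<alpha> (s + t)" unfolding st \<alpha>_def by (simp add: Q.pi_add gs distrib_left)
    then show ?thesis unfolding st \<phi> by (simp add: \<phi> R.pi_add)
  qed
  moreover have "\<phi> (s \<odot>\<^bsub>Q\<^esub> x) = s \<odot>\<^bsub>R\<^esub> \<phi> x" if x: "x \<in> carrier Q" for s x
  proof -
    obtain t where t: "x = \<alpha> t" using x unfolding carr by auto
    have "s \<odot>\<^bsub>Q\<^esub> x = \<alpha> (s * t)" unfolding t \<alpha>_def by (simp add: Q.pi_smult[OF gs] mult.left_commute)
    then show ?thesis unfolding t \<phi> by (simp add: \<phi> R.pi_smult)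
  qed
  moreover have "\<phi> ` gr Q b = gr R (b - multidegree g)" for b
    unfolding gr R.gr_eq by (auto simp: image_image \<phi>)
  ultimately show ?thesis
    unfolding graded_iso_def gshift_def by (intro exI[of _ \<phi>]) simp
qed

section \<open>Prime filtrations\<close>

definition nth_box :: "(('n \<Rightarrow>\<^sub>0 nat) \<times> 'n set) list \<Rightarrow> nat \<Rightarrow> ('n \<Rightarrow>\<^sub>0 nat) set"
  where "nth_box D i = box (fst (D ! i)) (snd (D ! i))"

text \<open>The union of $U$ with the first $i$ boxes; the stages are the exponent sets of the submodules in
  a filtration.\<close>

definition stage :: "('n \<Rightarrow>\<^sub>0 nat) set \<Rightarrow> (('n \<Rightarrow>\<^sub>0 nat) \<times> 'n set) list \<Rightarrow> nat \<Rightarrow> ('n \<Rightarrow>\<^sub>0 nat) set"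
  where "stage U D i = U \<union> (\<Union>j<i. nth_box D j)"

lemma stage_Suc: "stage U D (Suc i) = stage U D i \<union> nth_box D i"
  unfolding stage_def by (auto simp: lessThan_Suc)

lemma stage_mono: "i \<le> j \<Longrightarrow> stage U D i \<subseteq> stage U D j"
  unfolding stage_def by fastforce

lemma stage_0: "stage U D 0 = U"
  unfolding stage_def by simp

lemma stage_Cons: "stage U (b # D) (Suc i) = stage (U \<union> box (fst b) (snd b)) D i"
proof (induction i)
  case (Suc i)
  then show ?case by (subst (1 2) stage_Suc) (simp add: nth_box_def)
qed (simp add: stage_Suc stage_0 nth_box_def)

lemma box_filtration_stages:
  assumes "box_filtration U D V"
  shows "stage U D (length D) = V"
    and "i < length D \<Longrightarrow> stage U D i \<inter> nth_box D i = {} \<and> up_closed (stage U D (Suc i))"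
proof -
  have "stage U D (length D) = V \<and>
      (\<forall>i<length D. stage U D i \<inter> nth_box D i = {} \<and> up_closed (stage U D (Suc i)))"
    using assms
  proof (induction D arbitrary: U)
    case (Cons b D)
    obtain g T where b: "b = (g, T)" by force
    have U: "U \<inter> box g T = {}" "up_closed (U \<union> box g T)" "box_filtration (U \<union> box g T) D V"
      using Cons.prems unfolding b by auto
    note IH = Cons.IH[OF U(3)]
    have "stage U (b # D) i \<inter> nth_box (b # D) i = {} \<and> up_closed (stage U (b # D) (Suc i))"
      if "i < length (b # D)" for i
    proof (cases i)
      case 0
      then show ?thesis using U unfolding stage_Cons unfolding 0 stage_0 by (simp add: b nth_box_def)
    next
      case (Suc j)
      then have "nth_box (b # D) i = nth_box D j" unfolding nth_box_def by simp
      then show ?thesis using IH Suc that unfolding stage_Cons unfolding Suc stage_Cons by (simp add: b)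
    qed
    moreover have "stage U (b # D) (length (b # D)) = V"
      using IH by (simp only: length_Cons stage_Cons b fst_conv snd_conv)
    ultimately show ?case by blast
  qed (simp add: stage_0)
  then show "stage U D (length D) = V"
    and "i < length D \<Longrightarrow> stage U D i \<inter> nth_box D i = {} \<and> up_closed (stage U D (Suc i))" by auto
qed

lemma (in graded_presented) prime_filtration_of_boxes:
  assumes D: "box_filtration U D V"
  shows "\<exists>Ns as. prime_filtration M Ns (map (\<lambda>(g, T). var_prime T) D) as"
proof -
  let ?S = "stage U D"
  define Ns where "Ns = map (\<lambda>i. \<pi> ` mono_ideal (?S i)) [0..<Suc (length D)]"
  define Ps where "Ps = map (\<lambda>(g, T). var_prime T :: ('k, 'n) mpoly set) D"
  define as where "as = map (\<lambda>(g, T). multidegree g) D"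
  note stages = box_filtration_stages[OF D]
  have up: "up_closed (?S i)" if "i \<le> length D" for i
    using that up_U stages(2)[of "i - 1"] by (cases i) (auto simp: stage_0)
  have sub: "U \<subseteq> ?S i" "i \<le> length D \<Longrightarrow> ?S i \<subseteq> V" for i
    using stage_mono[of 0 i U D] stage_mono[of i "length D" U D] stages(1) by (auto simp: stage_0)
  have Ns: "Ns ! i = \<pi> ` mono_ideal (?S i)" if "i \<le> length D" for i
    using that unfolding Ns_def by (simp del: upt_Suc)
  have "\<pi> ` mono_ideal U = {\<zero>\<^bsub>M\<^esub>}"
    using A_sub pi_eq_zero ideal_0[OF A] by (auto simp: pi_zero)
  then have N0: "Ns ! 0 = {\<zero>\<^bsub>M\<^esub>}" using Ns[of 0] by (simp add: stage_0)
  have NV: "Ns ! length D = carrier M" using Ns[of "length D"] stages(1) by (simp add: carrier_eq)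
  have graded: "\<forall>N\<in>set Ns. graded_submodule M N"
    unfolding Ns_def using graded_submodule_image[OF up sub] by auto
  have step: "Ns ! i \<subset> Ns ! Suc i \<and> primeideal (Ps ! i) polyring \<and> monomial_ideal (Ps ! i) \<and>
      graded_iso (gquot (gsub M (Ns ! Suc i)) (Ns ! i)) (gshift (gquot polymod (Ps ! i)) (as ! i))"
    if i: "i < length D" for i
  proof -
    obtain g T where gT: "D ! i = (g, T)" by force
    have bx: "nth_box D i = box g T" unfolding nth_box_def gT by simp
    have Si: "?S (Suc i) = ?S i \<union> box g T" "?S i \<inter> box g T = {}" "up_closed (?S i \<union> box g T)"
      using stages(2)[OF i] unfolding stage_Suc bx by auto
    have Pi: "Ps ! i = var_prime T" "as ! i = multidegree g"
      unfolding Ps_def as_def using i gT by simp_all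
    have NN: "Ns ! i = \<pi> ` mono_ideal (?S i)" "Ns ! Suc i = \<pi> ` mono_ideal (?S (Suc i))"
      using Ns i by auto
    have "?S i \<subseteq> ?S (Suc i)" unfolding Si(1) by blast
    have "Ns ! i \<subset> Ns ! Suc i"
    proof
      show "Ns ! i \<subseteq> Ns ! Suc i"
        unfolding NN by (rule image_mono) (use \<open>?S i \<subseteq> ?S (Suc i)\<close> in \<open>simp add: mono_ideal_subset_iff\<close>)
      have g: "g \<in> ?S (Suc i)" "g \<notin> ?S i" using Si self_in_box[of g T] by auto
      have "g \<in> V" using g(1) sub(2)[of "Suc i"] i by auto
      have "\<pi> (single g 1) \<in> \<pi> ` mono_ideal (?S i) \<longleftrightarrow> single g 1 \<in> (mono_ideal (?S i) :: ('k, 'n) mpoly set)"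
        by (rule image_ideal_mem_iff)
          (use up[of i] sub[of i] i \<open>g \<in> V\<close> in \<open>auto simp: mono_ideal_subset_iff intro: is_ideal_mono_ideal\<close>)
      then have "\<pi> (single g 1) \<notin> Ns ! i" using g(2) unfolding NN by simp
      moreover have "\<pi> (single g 1) \<in> Ns ! Suc i" unfolding NN using g(1) by simp
      ultimately show "Ns ! i \<noteq> Ns ! Suc i" by blast
    qed
    moreover have "primeideal (Ps ! i) polyring"
      unfolding Pi by (simp add: primeideal_polyring_iff is_prime_var_prime)
    moreover have "monomial_ideal (Ps ! i)"
      unfolding Pi monomial_ideal_iff by (intro exI[of _ "var_exponents T"]) simp
    moreover have "graded_iso (gquot (gsub M (Ns ! Suc i)) (Ns ! i)) (gshift (gquot polymod (Ps ! i)) (as ! i))"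
      unfolding Pi NN
    proof (rule graded_iso_colon)
      have "graded_presented (gsub M (\<pi> ` mono_ideal (?S (Suc i)))) U (?S (Suc i)) \<pi>"
        using i by (intro graded_presented_gsub up sub) auto
      then show "graded_presented (gquot (gsub M (\<pi> ` mono_ideal (?S (Suc i)))) (\<pi> ` mono_ideal (?S i)))
          (?S i) (?S (Suc i)) (\<lambda>p. \<pi> ` mono_ideal (?S i) +>\<^bsub>gsub M (\<pi> ` mono_ideal (?S (Suc i)))\<^esub> \<pi> p)"
        using i \<open>?S i \<subseteq> ?S (Suc i)\<close>
        by (intro graded_presented.graded_presented_gquot[of _ U] up sub) auto
      show "graded_presented (gquot polymod (var_prime T)) (var_exponents T) UNIV
          (\<lambda>p. var_prime T +>\<^bsub>polymod\<^esub> p)"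
        by (rule graded_presented_quotient) simp
    qed (use Si in auto)
    ultimately show ?thesis by blast
  qed
  have "prime_filtration M Ns Ps as"
    unfolding prime_filtration_def using N0 NV graded step
    by (simp add: Ps_def as_def Ns_def del: upt_Suc)
  then show ?thesis unfolding Ps_def by blast
qed

text \<open>The preimage $g$ of the residue class of 1 generates the quotient, and $P$ is its annihilator.\<close>

lemma presented_iso_colon:
  fixes Q :: "(('k::field, 'n::finite) mpoly, 'm, 'n) gmodule"
    and R :: "(('k, 'n) mpoly, 'l, 'n) gmodule"
  assumes Q: "presented Q C C' \<pi>1" and R: "presented R P UNIV \<pi>2" and iso: "graded_iso Q (gshift R a)"
  obtains g where "C' = ideal_plus C g UNIV" "{s. g * s \<in> C} = P"
proof -
  interpret Q: presented Q C C' \<pi>1 by (rule Q)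
  interpret R: presented R P UNIV \<pi>2 by (rule R)
  obtain \<phi> where bij: "bij_betw \<phi> (carrier Q) (carrier R)"
    and smult: "\<And>s x. x \<in> carrier Q \<Longrightarrow> \<phi> (s \<odot>\<^bsub>Q\<^esub> x) = s \<odot>\<^bsub>R\<^esub> \<phi> x"
    using iso unfolding graded_iso_def gshift_def by auto
  have "\<pi>2 1 \<in> \<phi> ` carrier Q" using bij unfolding bij_betw_def R.carrier_eq by auto
  then obtain g where g: "g \<in> C'" "\<phi> (\<pi>1 g) = \<pi>2 1" unfolding Q.carrier_eq by auto
  have gs: "g * s \<in> C'" for s using ideal_mult2[OF Q.B g(1)] .
  have \<phi>: "\<phi> (\<pi>1 (g * s)) = \<pi>2 s" for s
    using smult[of "\<pi>1 g" s] g by (simp add: Q.carrier_eq Q.pi_smult R.pi_smult mult.commute)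
  have inj: "\<pi>1 p = \<pi>1 q \<longleftrightarrow> \<phi> (\<pi>1 p) = \<phi> (\<pi>1 q)" if "p \<in> C'" "q \<in> C'" for p q
    using inj_on_eq_iff[OF bij_betw_imp_inj_on[OF bij], of "\<pi>1 p" "\<pi>1 q"] that
    by (simp add: Q.carrier_eq)
  show thesis
  proof
    have "g * s \<in> C \<longleftrightarrow> s \<in> P" for s
      using inj[OF gs gs, of s 0] Q.pi_eq[OF gs gs, of s 0] R.pi_eq[of s 0] unfolding \<phi> by simp
    then show "{s. g * s \<in> C} = P" by blast
    show "C' = ideal_plus C g UNIV"
    proof
      show "ideal_plus C g UNIV \<subseteq> C'"
        by (rule ideal_plus_subset[OF Q.B Q.A_sub]) (rule gs)
      show "C' \<subseteq> ideal_plus C g UNIV"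
      proof
        fix p assume p: "p \<in> C'"
        have "\<phi> (\<pi>1 p) \<in> carrier R" using bij p unfolding bij_betw_def Q.carrier_eq by auto
        then obtain s where "\<phi> (\<pi>1 p) = \<pi>2 s" unfolding R.carrier_eq by auto
        then have "\<pi>1 p = \<pi>1 (g * s)" using inj[OF p gs] \<phi> by simp
        then have "p - g * s \<in> C" using Q.pi_eq[OF p gs] by simp
        then show "p \<in> ideal_plus C g UNIV" using ideal_plusI[of "p - g * s" C s UNIV g] by simp
      qed
    qed
  qed
qed

lemma (in koszul) acyclic_filtration:
  assumes "\<And>i. i \<le> m \<Longrightarrow> is_ideal (C i)"
    and "\<And>i. i < m \<Longrightarrow> \<exists>g. C (Suc i) = ideal_plus (C i) g UNIV \<and> acyclic_at j {s. g * s \<in> C i} UNIV"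
  shows "acyclic_at j (C 0) (C m) \<and> C 0 \<subseteq> C m"
  using assms
proof (induction m)
  case 0
  have "acyclic_at j (C 0) (C 0)"
    unfolding acyclic_at_def using ideal_0[OF 0(1)[of 0]]
    by (auto intro!: exI[of _ "\<lambda>_. 0"] simp: d_def)
  then show ?case by simp
next
  case (Suc m)
  have IH: "acyclic_at j (C 0) (C m)" "C 0 \<subseteq> C m" using Suc by auto
  obtain g where g: "C (Suc m) = ideal_plus (C m) g UNIV" "acyclic_at j {s. g * s \<in> C m} UNIV"
    using Suc.prems(2)[of m] by auto
  have sub: "C m \<subseteq> C (Suc m)" unfolding g(1) by (rule ideal_plus_superset) simp
  have "acyclic_at j (C m) (C (Suc m))"
    unfolding g(1) by (rule acyclic_colon[OF _ g(2)]) (use Suc.prems(1) in simp)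
  then show ?case
    using acyclic_extension[of "C 0" "C m" "C (Suc m)" j] IH sub Suc.prems(1) by auto
qed

lemma prime_filtration_chain:
  fixes N :: "(('k::field, 'n::finite) mpoly, 'm, 'n) gmodule"
  assumes M: "presented N A B \<pi>" and F: "prime_filtration N Ns Ps as"
  obtains C where "C 0 = A" "C (length Ps) = B" "\<And>i. i \<le> length Ps \<Longrightarrow> is_ideal (C i)"
    "\<And>i. i < length Ps \<Longrightarrow> \<exists>g. C (Suc i) = ideal_plus (C i) g UNIV \<and> {s. g * s \<in> C i} = Ps ! i"
proof -
  interpret N: presented N A B \<pi> by (rule M)
  define C where "C i = {p \<in> B. \<pi> p \<in> Ns ! i}" for i
  have len: "length Ns = Suc (length Ps)" using F unfolding prime_filtration_def by simp
  have subm: "submodule (Ns ! i) polyring N" if "i \<le> length Ps" for i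
    using F that len unfolding prime_filtration_def graded_submodule_def by (simp add: less_Suc_eq_le)
  have C: "is_ideal (C i)" "A \<subseteq> C i" "Ns ! i = \<pi> ` C i" "C i \<subseteq> B" if "i \<le> length Ps" for i
    using N.submodule_vimage[OF subm[OF that]] unfolding C_def by auto
  show thesis
  proof
    have "Ns ! 0 = {\<zero>\<^bsub>N\<^esub>}" "Ns ! length Ps = carrier N" using F unfolding prime_filtration_def by auto
    then show "C 0 = A" "C (length Ps) = B"
      unfolding C_def using N.pi_eq_zero N.A_sub by (auto simp: N.carrier_eq)
    fix i assume i: "i < length Ps"
    have sub: "C i \<subseteq> C (Suc i)" and iso: "graded_iso (gquot (gsub N (Ns ! Suc i)) (Ns ! i)) (gshift (gquot polymod (Ps ! i)) (as ! i))"
      and P: "primeideal (Ps ! i) polyring"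
      using F i unfolding prime_filtration_def C_def by auto
    have Ci: "is_ideal (C i)" "is_ideal (C (Suc i))" "A \<subseteq> C i" "A \<subseteq> C (Suc i)" "C (Suc i) \<subseteq> B"
      "Ns ! i = \<pi> ` C i" "Ns ! Suc i = \<pi> ` C (Suc i)"
      using C[of i] C[of "Suc i"] i by auto
    let ?S = "gsub N (Ns ! Suc i)"
    have S: "presented ?S A (C (Suc i)) \<pi>"
      by (rule N.presented_sub[OF Ci(2,4,5)]) (simp_all add: gsub_def Ci(7))
    interpret S: presented ?S A "C (Suc i)" \<pi> by (rule S)
    have Q: "presented (gquot ?S (Ns ! i)) (C i) (C (Suc i)) (\<lambda>p. \<pi> ` C i +>\<^bsub>?S\<^esub> \<pi> p)"
      unfolding Ci(6)
      by (rule S.presented_quot[OF Ci(1,3) sub]) (simp_all add: gquot_def quot_module_def module.defs)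
    interpret PM: presented polymod "{0}" UNIV "\<lambda>p. p"
      using graded_presented.presented[OF graded_presented_polymod] by simp
    have "is_ideal (Ps ! i)" using P unfolding primeideal_polyring_iff is_prime_def by simp
    then have R: "presented (gquot polymod (Ps ! i)) (Ps ! i) UNIV (\<lambda>p. (\<lambda>p. p) ` (Ps ! i) +>\<^bsub>polymod\<^esub> p)"
      by (intro PM.presented_quot)
        (auto simp: gquot_def quot_module_def module.defs ideal_0)
    show "\<exists>g. C (Suc i) = ideal_plus (C i) g UNIV \<and> {s. g * s \<in> C i} = Ps ! i"
      by (rule presented_iso_colon[OF Q R iso]) blast
  qed (use C in auto)
qed

section \<open>Stanley decompositions\<close>

lemma monomial_multiple_of_box:
  fixes p :: "('k::field, 'n::finite) mpoly"
  assumes "keys p \<subseteq> box g T"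
  obtains q where "q \<in> poly_subring (- T)" "p = single g 1 * q"
proof
  let ?q = "\<Sum>v\<in>keys p. single (v - g) (lookup p v)"
  have v: "keys (v - g) \<inter> T = {}" "g + (v - g) = v" if "v \<in> keys p" for v
  proof -
    obtain w where "v = g + w" "keys w \<inter> T = {}"
      using subsetD[OF assms \<open>v \<in> keys p\<close>] unfolding box_def by blast
    then show "keys (v - g) \<inter> T = {}" "g + (v - g) = v" by simp_all
  qed
  have "single g 1 * ?q = (\<Sum>v\<in>keys p. single v (lookup p v))"
    unfolding sum_distrib_left by (rule sum.cong) (auto simp: mult_single v(2))
  then show "p = single g 1 * ?q" by (simp flip: poly_mapping_sum_single)
  show "?q \<in> poly_subring (- T)"
    unfolding poly_subring_def mem_Collect_eq
  proof
    fix w assume "w \<in> keys ?q"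
    then obtain u where "u \<in> keys p" "w \<in> keys (single (u - g) (lookup p u))" using keys_sum by fast
    then have "u \<in> keys p" "w = u - g" by (auto split: if_splits)
    then show "keys w \<subseteq> - T" using v(1) by auto
  qed
qed

lemma poly_subring_keys:
  "q \<in> poly_subring (- T) \<longleftrightarrow> keys (single g (1 :: 'k::field) * q) \<subseteq> box g T"
  unfolding keys_monomial_mult poly_subring_def mem_Collect_eq image_subset_iff in_box_iff
  by (simp add: disjoint_eq_subset_Compl)

context graded_presented
begin

lemma stanley_span_eq:
  assumes "box g T \<subseteq> V"
  shows "stanley_span M (\<pi> (single g 1)) (- T) = \<pi> ` {p. keys p \<subseteq> box g T}"
proof
  interpret abelian_group M by (rule is_abelian_group)
  have inV: "p \<in> mono_ideal V" if "keys p \<subseteq> box g T" for p :: "('k, 'n) mpoly"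
    using that assms unfolding mono_ideal_def by auto
  have g: "single g 1 \<in> (mono_ideal V :: ('k, 'n) mpoly set)" by (rule inV) simp
  have "K_subspace M (\<pi> ` {p. keys p \<subseteq> box g T})"
    unfolding K_subspace_def
  proof (intro conjI allI ballI)
    show "subgroup (\<pi> ` {p. keys p \<subseteq> box g T}) (add_monoid M)"
    proof (rule add.subgroupI)
      show "\<pi> ` {p. keys p \<subseteq> box g T} \<subseteq> carrier M" using inV unfolding carrier_eq by auto
      show "\<pi> ` {p. keys p \<subseteq> box g T} \<noteq> {}" by (auto intro: exI[of _ 0])
      show "\<ominus>\<^bsub>M\<^esub> x \<in> \<pi> ` {p. keys p \<subseteq> box g T}" if "x \<in> \<pi> ` {p. keys p \<subseteq> box g T}" for x
        using that inV by (auto simp: a_inv_pi)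
      show "x \<oplus>\<^bsub>M\<^esub> y \<in> \<pi> ` {p. keys p \<subseteq> box g T}"
        if xy: "x \<in> \<pi> ` {p. keys p \<subseteq> box g T}" "y \<in> \<pi> ` {p. keys p \<subseteq> box g T}" for x y
      proof -
        obtain p q where pq: "keys p \<subseteq> box g T" "x = \<pi> p" "keys q \<subseteq> box g T" "y = \<pi> q" using xy by blast
        then have "x \<oplus>\<^bsub>M\<^esub> y = \<pi> (p + q)" using pi_add inV by simp
        moreover have "keys (p + q) \<subseteq> box g T" using keys_add[of p q] pq by blast
        ultimately show ?thesis by blast
      qed
    qed
    fix c x assume "x \<in> \<pi> ` {p. keys p \<subseteq> box g T}"
    then obtain p where p: "keys p \<subseteq> box g T" "x = \<pi> p" by blast
    have "keys (single 0 c * p) \<subseteq> box g T" using keys_mult[of "single 0 c" p] p(1) by (auto split: if_splits)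
    then show "single 0 c \<odot>\<^bsub>M\<^esub> x \<in> \<pi> ` {p. keys p \<subseteq> box g T}"
      using p inV by (auto simp: pi_smult)
  qed
  moreover have "v \<odot>\<^bsub>M\<^esub> \<pi> (single g 1) \<in> \<pi> ` {p. keys p \<subseteq> box g T}"
    if "v \<in> monomials \<inter> poly_subring (- T)" for v
    using that pi_smult[OF g] by (auto simp: poly_subring_keys[of v T g] mult.commute)
  ultimately show "stanley_span M (\<pi> (single g 1)) (- T) \<subseteq> \<pi> ` {p. keys p \<subseteq> box g T}"
    unfolding stanley_span_def by (intro Inter_lower) blast
  show "\<pi> ` {p. keys p \<subseteq> box g T} \<subseteq> stanley_span M (\<pi> (single g 1)) (- T)"
    unfolding stanley_span_def
  proof (rule Inter_greatest, clarify)
    fix W and p :: "('k, 'n) mpoly"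
    assume W: "K_subspace M W" "\<forall>v\<in>monomials \<inter> poly_subring (- T). v \<odot>\<^bsub>M\<^esub> \<pi> (single g 1) \<in> W"
      and p: "keys p \<subseteq> box g T"
    interpret W: subgroup W "add_monoid M" using W(1) unfolding K_subspace_def by simp
    have mono: "single v c \<in> mono_ideal V \<and> \<pi> (single v c) \<in> W" if v: "v \<in> box g T" for v and c :: 'k
    proof -
      obtain u where u: "v = g + u" "keys u \<inter> T = {}" using v unfolding box_def by blast
      then have "single u (1 :: 'k) \<in> monomials \<inter> poly_subring (- T)"
        unfolding monomials_def poly_subring_def by (simp add: disjoint_eq_subset_Compl)
      then have "single u 1 \<odot>\<^bsub>M\<^esub> \<pi> (single g 1) \<in> W" using W(2) by blast
      then have "\<pi> (single v 1) \<in> W" using pi_smult[OF g] u(1) by (simp add: mult_single add.commute)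
      then have "single 0 c \<odot>\<^bsub>M\<^esub> \<pi> (single v 1) \<in> W" using W(1) unfolding K_subspace_def by blast
      moreover have "single v (1 :: 'k) \<in> mono_ideal V" using that assms by auto
      ultimately show ?thesis using that assms by (auto simp: pi_smult mult_single mono_ideal_def)
    qed
    have "(\<Sum>v\<in>F. single v (lookup p v)) \<in> mono_ideal V \<and> \<pi> (\<Sum>v\<in>F. single v (lookup p v)) \<in> W"
      if "finite F" "F \<subseteq> box g T" for F
      using that
    proof (induction F rule: finite_induct)
      case empty
      then show ?case using W.one_closed ideal_0[OF B] by (simp add: pi_zero)
    next
      case (insert v F)
      have v: "single v (lookup p v) \<in> mono_ideal V" "\<pi> (single v (lookup p v)) \<in> W"
        using mono insert.prems by auto
      have F: "(\<Sum>v\<in>F. single v (lookup p v)) \<in> mono_ideal V" "\<pi> (\<Sum>v\<in>F. single v (lookup p v)) \<in> W"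
        using insert by auto
      show ?case
        using W.m_closed[OF v(2) F(2)] pi_add[OF v(1) F(1)] ideal_add[OF B v(1) F(1)] insert.hyps by simp
    qed
    from this[OF finite_keys p] show "\<pi> p \<in> W" by (simp flip: poly_mapping_sum_single)
  qed
qed

text \<open>The class of $x^g$ is a basis over $K[x_i : i \<notin> T]$: no monomial of the box lies in the
  ideal that is divided out.\<close>

lemma stanley_space_box:
  assumes V: "box g T \<subseteq> V" and U: "U \<inter> box g T = {}"
  shows "stanley_space M (\<pi> (single g 1)) (- T)"
proof -
  let ?u = "\<pi> (single g 1)"
  let ?S = "\<pi> ` {p. keys p \<subseteq> box g T}"
  let ?M' = "M\<lparr>carrier := ?S\<rparr>"
  let ?R = "polyring\<lparr>carrier := poly_subring (- T)\<rparr> :: ('k, 'n) mpoly ring"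
  interpret abelian_group M by (rule is_abelian_group)
  have inV: "p \<in> mono_ideal V" if "keys p \<subseteq> box g T" for p :: "('k, 'n) mpoly"
    using that V unfolding mono_ideal_def by auto
  have zero_iff: "\<pi> p = \<pi> q \<longleftrightarrow> p = q" if p: "keys p \<subseteq> box g T" and q: "keys q \<subseteq> box g T" for p q
  proof
    assume "\<pi> p = \<pi> q"
    then have "keys (p - q) \<subseteq> U" using pi_eq[OF inV[OF p] inV[OF q]] unfolding mono_ideal_def by simp
    moreover have "keys (p - q) \<subseteq> box g T" using keys_diff[of p q] p q by blast
    ultimately have "keys (p - q) = {}" using U by blast
    then show "p = q" by simp
  qed simp
  have g: "keys (single g (1 :: 'k)) \<subseteq> box g T" by simp
  have smult: "q \<odot>\<^bsub>M\<^esub> ?u = \<pi> (single g 1 * q)" for q using pi_smult[OF inV[OF g]] by (simp add: mult.commute)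
  have g0: "single g (1 :: 'k) \<noteq> 0" by (metis lookup_single_eq lookup_zero one_neq_zero)
  then have "\<pi> (single g 1) \<noteq> \<pi> 0" using zero_iff[OF g, of 0] by simp
  then have "?u \<noteq> \<zero>\<^bsub>M\<^esub>" by (simp add: pi_zero)
  moreover have "?u \<in> gr M (multidegree g)"
    unfolding gr_eq using inV[OF g] by (auto simp: homogeneous_def)
  moreover have "free_module ?R ?M'"
  proof -
    have add: "x \<oplus>\<^bsub>M\<^esub> y \<in> ?S" if xy: "x \<in> ?S" "y \<in> ?S" for x y
    proof -
      obtain p q where pq: "keys p \<subseteq> box g T" "x = \<pi> p" "keys q \<subseteq> box g T" "y = \<pi> q" using xy by blast
      then have "x \<oplus>\<^bsub>M\<^esub> y = \<pi> (p + q)" using pi_add inV by simp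
      moreover have "keys (p + q) \<subseteq> box g T" using keys_add[of p q] pq by blast
      ultimately show ?thesis by blast
    qed
    have zero: "\<zero>\<^bsub>M\<^esub> \<in> ?S" by (auto simp: pi_zero intro: exI[of _ 0])
    have S_carr: "x \<in> carrier M" if "x \<in> ?S" for x using that inV by (auto simp: carrier_eq)
    interpret M': abelian_monoid ?M'
      by (rule abelian_monoidI) (use add zero S_carr in \<open>auto intro: a_assoc a_comm\<close>)
    have uS: "?u \<in> ?S" using g by blast
    have sum: "(\<Oplus>\<^bsub>?M'\<^esub>b\<in>{b. c b \<noteq> \<zero>\<^bsub>?R\<^esub>}. c b \<odot>\<^bsub>?M'\<^esub> b) = \<pi> (single g 1 * c ?u)"
      if c: "range c \<subseteq> poly_subring (- T)" "{b. c b \<noteq> \<zero>\<^bsub>?R\<^esub>} \<subseteq> {?u}" for c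
    proof (cases "c ?u = 0")
      case True
      then have "{b. c b \<noteq> \<zero>\<^bsub>?R\<^esub>} = {}" using c(2) by auto
      then show ?thesis using True by (simp add: pi_zero)
    next
      case False
      then have "{b. c b \<noteq> \<zero>\<^bsub>?R\<^esub>} = {?u}" using c(2) by auto
      moreover have "c ?u \<odot>\<^bsub>M\<^esub> ?u \<in> ?S"
        unfolding smult using c(1) poly_subring_keys[of "c ?u" T g] by blast
      ultimately show ?thesis
        using M'.finsum_insert[of "{}" ?u "\<lambda>b. c b \<odot>\<^bsub>?M'\<^esub> b"] S_carr by (simp add: smult)
    qed
    show ?thesis
      unfolding free_module_def
    proof (intro exI[of _ "{?u}"] conjI ballI)
      show "{?u} \<subseteq> carrier ?M'" using uS by simp
      fix x assume "x \<in> carrier ?M'"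
      then obtain p where p: "keys p \<subseteq> box g T" "x = \<pi> p" by auto
      obtain q where q: "q \<in> poly_subring (- T)" "p = single g 1 * q"
        using monomial_multiple_of_box[OF p(1)] .
      have zero_sub: "0 \<in> poly_subring (- T)" unfolding poly_subring_def by simp
      show "\<exists>!c. range c \<subseteq> carrier ?R \<and> finite {b. c b \<noteq> \<zero>\<^bsub>?R\<^esub>} \<and> {b. c b \<noteq> \<zero>\<^bsub>?R\<^esub>} \<subseteq> {?u} \<and>
          x = (\<Oplus>\<^bsub>?M'\<^esub>b\<in>{b. c b \<noteq> \<zero>\<^bsub>?R\<^esub>}. c b \<odot>\<^bsub>?M'\<^esub> b)"
      proof (rule ex1I[of _ "\<lambda>b. if b = ?u then q else 0"])
        let ?c = "\<lambda>b. if b = ?u then q else 0"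
        have c: "range ?c \<subseteq> poly_subring (- T)" "{b. ?c b \<noteq> \<zero>\<^bsub>?R\<^esub>} \<subseteq> {?u}"
          using q(1) zero_sub by auto
        show "range ?c \<subseteq> carrier ?R \<and> finite {b. ?c b \<noteq> \<zero>\<^bsub>?R\<^esub>} \<and> {b. ?c b \<noteq> \<zero>\<^bsub>?R\<^esub>} \<subseteq> {?u} \<and>
            x = (\<Oplus>\<^bsub>?M'\<^esub>b\<in>{b. ?c b \<noteq> \<zero>\<^bsub>?R\<^esub>}. ?c b \<odot>\<^bsub>?M'\<^esub> b)"
          unfolding sum[OF c] using c finite_subset[OF c(2)] p(2) q(2) by simp
      next
        fix c assume c: "range c \<subseteq> carrier ?R \<and> finite {b. c b \<noteq> \<zero>\<^bsub>?R\<^esub>} \<and> {b. c b \<noteq> \<zero>\<^bsub>?R\<^esub>} \<subseteq> {?u} \<and>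
            x = (\<Oplus>\<^bsub>?M'\<^esub>b\<in>{b. c b \<noteq> \<zero>\<^bsub>?R\<^esub>}. c b \<odot>\<^bsub>?M'\<^esub> b)"
        then have "\<pi> (single g 1 * q) = \<pi> (single g 1 * c ?u)"
          using sum[of c] p(2) q(2) by simp
        moreover have "c ?u \<in> poly_subring (- T)" using c by auto
        ultimately have "single g 1 * q = single g 1 * c ?u"
          using zero_iff poly_subring_keys[of _ T g] q(1) by blast
        then have "single g 1 * (q - c ?u) = 0" by (simp add: algebra_simps)
        then have "c ?u = q" using mpoly_mult_eq_0[of "single g 1" "q - c ?u"] g0 by simp
        moreover have "c b = 0" if "b \<noteq> ?u" for b using c that by auto
        ultimately show "c = (\<lambda>b. if b = ?u then q else 0)" by auto
      qed
    qed
  qed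
  ultimately show ?thesis
    unfolding stanley_space_def stanley_span_eq[OF V] by blast
qed

text \<open>The boxes partition the exponents of $V$ outside $U$, so the components are obtained by
  restricting a representative to the boxes.\<close>

lemma stanley_decomposition_of_boxes:
  assumes D: "box_filtration U D V"
  shows "stanley_decomposition M (map (\<lambda>(g, T). (\<pi> (single g 1), - T)) D)"
proof -
  interpret abelian_group M by (rule is_abelian_group)
  let ?D = "map (\<lambda>(g, T). (\<pi> (single g 1), - T)) D" and ?b = "nth_box D" and ?I = "{..<length D}"
  note stages = box_filtration_stages[OF D]
  have V_eq: "V = U \<union> (\<Union>i<length D. ?b i)" using stages(1) unfolding stage_def by simp
  have bU: "U \<inter> ?b i = {}" "?b i \<subseteq> V" if "i < length D" for i
  proof -
    show "U \<inter> ?b i = {}" using stages(2)[OF that] unfolding stage_def by blast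
    show "?b i \<subseteq> V" unfolding V_eq using that by blast
  qed
  have disj: "?b i \<inter> ?b j = {}" if ij: "i < length D" "j < length D" "i \<noteq> j" for i j
  proof -
    have "?b i \<inter> ?b j = {}" if "i < j" "j < length D" for i j
      using stages(2)[OF that(2)] that(1) unfolding stage_def by blast
    then show ?thesis using ij by (metis Int_commute neqE)
  qed
  have span: "stanley_span M (fst (?D ! i)) (snd (?D ! i)) = \<pi> ` {p. keys p \<subseteq> ?b i}" if "i < length D" for i
    using stanley_span_eq[of "fst (D ! i)" "snd (D ! i)"] bU(2)[OF that] that
    unfolding nth_box_def by (simp add: split_beta)
  have spaces: "\<forall>(u, Z)\<in>set ?D. stanley_space M u Z"
  proof (clarsimp)
    fix g T assume "(g, T) \<in> set D"
    then obtain i where "i < length D" "D ! i = (g, T)" by (metis in_set_conv_nth)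
    then show "stanley_space M (\<pi> (single g 1)) (- T)"
      using bU[of i] stanley_space_box[of g T] unfolding nth_box_def by simp
  qed
  have inV: "p \<in> mono_ideal V" if "keys p \<subseteq> ?b i" "i < length D" for i and p :: "('k, 'n) mpoly"
    using that bU(2) unfolding mono_ideal_def by blast
  have "\<exists>!f. f \<in> (\<Pi>\<^sub>E i\<in>?I. \<pi> ` {p. keys p \<subseteq> ?b i}) \<and> x = (\<Oplus>\<^bsub>M\<^esub>i\<in>?I. f i)" if x: "x \<in> carrier M" for x
  proof -
    obtain p where p: "p \<in> mono_ideal V" "x = \<pi> p" using x unfolding carrier_eq by auto
    define r where "r i = restrict_keys (?b i) p" for i
    have r: "keys (r i) \<subseteq> ?b i" for i unfolding r_def keys_restrict_keys by blast
    define f0 where "f0 = (\<lambda>i\<in>?I. \<pi> (r i))"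
    have sum_eq: "(\<Oplus>\<^bsub>M\<^esub>i\<in>?I. f i) = \<pi> (\<Sum>i\<in>?I. q i)"
      if q: "\<And>i. i \<in> ?I \<Longrightarrow> keys (q i) \<subseteq> ?b i \<and> f i = \<pi> (q i)" for f q
    proof -
      have qV: "q i \<in> mono_ideal V" if "i \<in> ?I" for i using inV[of "q i" i] q[OF that] that by simp
      then have "(\<Oplus>\<^bsub>M\<^esub>i\<in>?I. f i) = (\<Oplus>\<^bsub>M\<^esub>i\<in>?I. \<pi> (q i))"
        by (intro finsum_cong') (use q in \<open>auto simp: carrier_eq\<close>)
      also have "\<dots> = \<pi> (\<Sum>i\<in>?I. q i)" by (rule finsum_pi) (use qV in auto)
      finally show ?thesis .
    qed
    show ?thesis
    proof (rule ex1I[of _ f0], intro conjI)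
      show "f0 \<in> (\<Pi>\<^sub>E i\<in>?I. \<pi> ` {p. keys p \<subseteq> ?b i})" unfolding f0_def using r by auto
      have "p - (\<Sum>i\<in>?I. r i) \<in> mono_ideal U"
        unfolding mono_ideal_def mem_Collect_eq
      proof (rule ccontr)
        assume "\<not> keys (p - (\<Sum>i\<in>?I. r i)) \<subseteq> U"
        then obtain v where v: "v \<in> keys (p - (\<Sum>i\<in>?I. r i))" "v \<notin> U" by blast
        have "p - (\<Sum>i\<in>?I. r i) \<in> mono_ideal V"
          by (intro ideal_diff[OF B p(1)] ideal_sum[OF B] inV[OF r]) simp
        then have "v \<in> V" using v(1) unfolding mono_ideal_def by blast
        then have "v \<in> (\<Union>i<length D. ?b i)" using v(2) V_eq by blast
        then obtain j where j: "j < length D" "v \<in> ?b j" by blast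
        have "v \<notin> ?b i" if "i < length D" "i \<noteq> j" for i using disj[OF that(1) j(1) that(2)] j(2) by blast
        then have "lookup (\<Sum>i\<in>?I. r i) v = (\<Sum>i\<in>?I. if i = j then lookup p v else 0)"
          unfolding lookup_sum r_def using j(2) by (intro sum.cong) (auto simp: lookup_restrict_keys)
        then show False using v(1) j(1) by (simp add: in_keys_iff lookup_minus)
      qed
      then have "\<pi> p = \<pi> (\<Sum>i\<in>?I. r i)"
        using pi_eq[OF p(1) ideal_sum[OF B, of ?I r]] inV[OF r] by simp
      also have "\<dots> = (\<Oplus>\<^bsub>M\<^esub>i\<in>?I. f0 i)" by (rule sum_eq[symmetric]) (use r in \<open>auto simp: f0_def\<close>)
      finally show "x = (\<Oplus>\<^bsub>M\<^esub>i\<in>?I. f0 i)" unfolding p(2) .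
      fix f assume f: "f \<in> (\<Pi>\<^sub>E i\<in>?I. \<pi> ` {p. keys p \<subseteq> ?b i}) \<and> x = (\<Oplus>\<^bsub>M\<^esub>i\<in>?I. f i)"
      then have "\<forall>i\<in>?I. \<exists>q. keys q \<subseteq> ?b i \<and> f i = \<pi> q" by (auto simp: PiE_iff)
      then obtain q where q: "\<And>i. i \<in> ?I \<Longrightarrow> keys (q i) \<subseteq> ?b i \<and> f i = \<pi> (q i)" by metis
      have "\<pi> p = \<pi> (\<Sum>i\<in>?I. q i)" using sum_eq[OF q] f p(2) by simp
      moreover have "q i \<in> mono_ideal V" if "i \<in> ?I" for i using inV[of "q i" i] q[OF that] that by simp
      ultimately have diff: "p - (\<Sum>i\<in>?I. q i) \<in> mono_ideal U"
        using pi_eq[OF p(1) ideal_sum[OF B, of ?I q]] by simp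
      have "f i = \<pi> (r i)" if i: "i \<in> ?I" for i
      proof -
        have "restrict_keys (?b i) (\<Sum>j\<in>?I. q j) = (\<Sum>j\<in>?I. if j = i then q i else 0)"
          unfolding restrict_keys_sum
        proof (rule sum.cong)
          fix j assume j: "j \<in> ?I"
          show "restrict_keys (?b i) (q j) = (if j = i then q i else 0)"
          proof (cases "j = i")
            case False
            then have "keys (q j) \<inter> ?b i = {}" using q[OF j] disj[of j i] i j by auto
            then show ?thesis using False restrict_keys_0 by simp
          qed (use q[OF i] restrict_keys_id in auto)
        qed simp
        then have "restrict_keys (?b i) (\<Sum>j\<in>?I. q j) = q i" using i by simp
        moreover have "restrict_keys (?b i) (p - (\<Sum>j\<in>?I. q j)) = 0"
          using diff bU(1)[of i] i unfolding mono_ideal_def by (intro restrict_keys_0) auto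
        ultimately have "q i = r i" unfolding r_def restrict_keys_diff by simp
        then show ?thesis using q[OF i] by simp
      qed
      then show "f = f0" using f unfolding f0_def by (intro ext) (auto simp: PiE_iff extensional_def)
    qed
  qed
  moreover have "(\<Pi>\<^sub>E i\<in>{..<length ?D}. stanley_span M (fst (?D ! i)) (snd (?D ! i))) =
      (\<Pi>\<^sub>E i\<in>?I. \<pi> ` {p. keys p \<subseteq> ?b i})"
    by (simp only: length_map) (rule PiE_cong, use span in auto)
  ultimately show ?thesis
    unfolding stanley_decomposition_def using spaces by (simp only: length_map) blast
qed

end

section \<open>Depth, fdepth and sdepth of modules filtered by boxes\<close>

lemma dvd_monomial_iff:
  fixes v w :: "'n::finite \<Rightarrow>\<^sub>0 nat"
  shows "single w (1 :: 'k::field) dvd single v 1 \<longleftrightarrow> (\<exists>x. v = w + x)"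
proof
  assume "single w (1 :: 'k) dvd single v 1"
  then obtain q where "single v (1 :: 'k) = single w 1 * q" by (auto elim: dvdE)
  then have "keys (single v (1 :: 'k)) = (+) w ` keys q" by (simp only: keys_monomial_mult)
  then have "v \<in> (+) w ` keys q" by (metis keys_single one_neq_zero singletonI)
  then show "\<exists>x. v = w + x" by blast
next
  assume "\<exists>x. v = w + x"
  then obtain x where "v = w + x" by blast
  then have "single v (1 :: 'k) = single w 1 * single x 1" by (simp add: mult_single)
  then show "single w (1 :: 'k) dvd single v 1" by simp
qed

lemma ideal_plus_list_monomials:
  "ideal_plus_list (map (\<lambda>v. single v 1) es) {0} UNIV =
    (mono_ideal (up_gen (set es)) :: ('k::field, 'n::finite) mpoly set)" (is "?L = ?R")
proof
  have R: "is_ideal ?R" by (intro is_ideal_mono_ideal) simp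
  show "?L \<subseteq> ?R"
  proof (rule ideal_plus_list_least[OF R])
    show "{0} \<subseteq> ?R" using ideal_0[OF R] by simp
    fix f b :: "('k, 'n) mpoly" assume "f \<in> set (map (\<lambda>v. single v 1) es)"
    then show "f * b \<in> ?R" by (auto intro!: ideal_mult2[OF R] up_gen_self)
  qed
  have L: "is_ideal ?L" by (simp add: is_ideal_plus_list)
  show "?R \<subseteq> ?L"
  proof
    fix p :: "('k, 'n) mpoly" assume p: "p \<in> ?R"
    show "p \<in> ?L"
    proof (rule in_ideal_if_monomials_in_ideal[OF L])
      fix v assume "v \<in> keys p"
      then obtain u w where uw: "u \<in> set es" "v = u + w" using p unfolding mono_ideal_def up_gen_def by blast
      have "single u 1 * single w 1 \<in> ?L" by (rule ideal_plus_list_mult) (use uw in auto)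
      then show "single v 1 \<in> ?L" using uw by (simp add: mult_single)
    qed
  qed
qed

text \<open>Descent on the total degree.\<close>

lemma up_gen_minimal:
  fixes U :: "('n::finite \<Rightarrow>\<^sub>0 nat) set"
  assumes U: "up_closed U"
  shows "up_gen {v \<in> U. \<forall>w\<in>U. (\<exists>x. v = w + x) \<longrightarrow> w = v} = U"
proof
  show "up_gen {v \<in> U. \<forall>w\<in>U. (\<exists>x. v = w + x) \<longrightarrow> w = v} \<subseteq> U"
    using up_closedD[OF U] unfolding up_gen_def by blast
  show "U \<subseteq> up_gen {v \<in> U. \<forall>w\<in>U. (\<exists>x. v = w + x) \<longrightarrow> w = v}"
  proof
    fix v assume "v \<in> U"
    then show "v \<in> up_gen {v \<in> U. \<forall>w\<in>U. (\<exists>x. v = w + x) \<longrightarrow> w = v}"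
    proof (induction "\<Sum>i\<in>UNIV. lookup v i" arbitrary: v rule: less_induct)
      case less
      show ?case
      proof (cases "\<forall>w\<in>U. (\<exists>x. v = w + x) \<longrightarrow> w = v")
        case True
        then show ?thesis using less.prems by (intro up_gen_self) simp
      next
        case False
        then obtain w x where w: "w \<in> U" "v = w + x" "w \<noteq> v" by blast
        then obtain i where "i \<in> keys x" by (metis keys_eq_empty ex_in_conv add.right_neutral)
        then have "(\<Sum>i\<in>UNIV. lookup w i) < (\<Sum>i\<in>UNIV. lookup v i)"
          unfolding w(2) lookup_add by (intro sum_strict_mono_ex1) (auto simp: in_keys_iff)
        from less.hyps[OF this w(1)] show ?thesis
          unfolding w(2) by (rule up_closedD[OF up_closed_up_gen])
      qed
    qed
  qed
qed

lemma (in graded_presented) depth_le: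
  assumes K: "koszul (idx :: 'n \<Rightarrow> nat)"
    and H: "\<not> koszul.acyclic_at (indet :: 'n \<Rightarrow> ('k, 'n) mpoly) idx j (mono_ideal U) (mono_ideal V)"
  shows "depth polyring max_ideal M \<le> enat (card (UNIV :: 'n set) - j)"
  unfolding depth_def
proof (rule Sup_least, clarify)
  fix fs assume fs: "set fs \<subseteq> max_ideal" "regular_sequence polyring M fs"
  have "j + length fs \<le> card (UNIV :: 'n set)"
  proof (rule koszul.weakly_regular_length_le[OF K A B _ _ H])
    show "weakly_regular fs (mono_ideal U) (mono_ideal V)" using fs(2) by (simp add: regular_sequence_iff)
    show "\<exists>c. f = (\<Sum>i\<in>UNIV. c i * indet i)" if "f \<in> set fs" for f
      using that fs(1) unfolding max_ideal_eq by (auto simp: var_prime_UNIV_eq)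
  qed
  then show "enat (length fs) \<le> enat (card (UNIV :: 'n set) - j)" by simp
qed

text \<open>The variables outside $T$ form a regular sequence on $S/P_T$; they are the linear forms of the
  forest in which all blocks are singletons in $T$.\<close>

lemma acyclic_var_prime:
  assumes K: "koszul (idx :: 'n::finite \<Rightarrow> nat)" and "card T < j"
  shows "koszul.acyclic_at (indet :: 'n \<Rightarrow> ('k::field, 'n) mpoly) idx j (var_prime T) UNIV"
proof (rule ccontr)
  interpret star_forest T "\<lambda>a. a" by unfold_locales auto
  obtain xs where xs: "set xs = - T" "distinct xs" using finite_distinct_list[of "- T"] by auto
  assume H: "\<not> koszul.acyclic_at (indet :: 'n \<Rightarrow> ('k, 'n) mpoly) idx j (var_prime T) UNIV"
  have roots: "roots = T" unfolding roots_def by auto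
  let ?fs = "map edge xs @ map indet [] :: ('k, 'n) mpoly list"
  have "j + length ?fs \<le> card (UNIV :: 'n set)"
  proof (rule koszul.weakly_regular_length_le[OF K _ _ _ _ H])
    show "weakly_regular ?fs (var_prime T) UNIV"
      by (rule edges_regular_on_var_prime) (use xs in \<open>auto simp: roots\<close>)
    show "\<exists>c. f = (\<Sum>i\<in>UNIV. c i * indet i)" if f: "f \<in> set ?fs" for f
    proof -
      obtain a where "a \<notin> T" "f = edge a" using f xs(1) by auto
      then have "f \<in> var_prime UNIV" unfolding edge_def by simp
      then show ?thesis by (simp add: var_prime_UNIV_eq)
    qed
  qed simp_all
  moreover have "length xs = card (UNIV :: 'n set) - card T"
    using distinct_card[OF xs(2)] unfolding xs(1) by (simp add: Compl_eq_Diff_UNIV card_Diff_subset)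
  moreover have "card T \<le> card (UNIV :: 'n set)" by (rule card_mono) simp_all
  ultimately show False using assms(2) by simp
qed

text \<open>If $H_j$ vanished on all the quotients $S/P_T$ of a filtration, it would vanish on $M$. So some
  quotient has $H_j(S/P_T) \<noteq> 0$, which forces $|T| \<ge> j$.\<close>

lemma (in graded_presented) fdepth_le:
  assumes K: "koszul (idx :: 'n \<Rightarrow> nat)"
    and H: "\<not> koszul.acyclic_at (indet :: 'n \<Rightarrow> ('k, 'n) mpoly) idx j (mono_ideal U) (mono_ideal V)"
  shows "fdepth M \<le> enat (card (UNIV :: 'n set) - j)"
  unfolding fdepth_def
proof (rule Sup_least, clarify)
  fix Ns and Ps :: "('k, 'n) mpoly set list" and as
  assume F: "prime_filtration M Ns Ps as"
  obtain C where C: "C 0 = mono_ideal U" "C (length Ps) = mono_ideal V"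
    "\<And>i. i \<le> length Ps \<Longrightarrow> is_ideal (C i)"
    "\<And>i. i < length Ps \<Longrightarrow> \<exists>g. C (Suc i) = ideal_plus (C i) g UNIV \<and> {s. g * s \<in> C i} = Ps ! i"
    using prime_filtration_chain[OF presented F] by blast
  have "\<exists>i<length Ps. \<not> koszul.acyclic_at (indet :: 'n \<Rightarrow> ('k, 'n) mpoly) idx j (Ps ! i) UNIV"
  proof (rule ccontr)
    assume "\<not> ?thesis"
    then have step: "\<exists>g. C (Suc i) = ideal_plus (C i) g UNIV \<and>
        koszul.acyclic_at (indet :: 'n \<Rightarrow> ('k, 'n) mpoly) idx j {s. g * s \<in> C i} UNIV" if "i < length Ps" for i
      using C(4)[OF that] that by auto
    have "koszul.acyclic_at indet idx j (C 0) (C (length Ps)) \<and> C 0 \<subseteq> C (length Ps)"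
      by (rule koszul.acyclic_filtration[OF K]) (fact C(3), fact step)
    then show False using C(1,2) H by simp
  qed
  then obtain i where i: "i < length Ps"
    "\<not> koszul.acyclic_at (indet :: 'n \<Rightarrow> ('k, 'n) mpoly) idx j (Ps ! i) UNIV" by blast
  have "primeideal (Ps ! i) polyring" "monomial_ideal (Ps ! i)"
    using F i(1) unfolding prime_filtration_def by auto
  then obtain T where T: "Ps ! i = var_prime T" by (rule monomial_prime_is_var_prime)
  then have "j \<le> card T" using acyclic_var_prime[OF K, where T = T and j = j] i(2) by (metis not_le)
  then have "krull_dim (polyring Quot (Ps ! i)) \<le> enat (card (UNIV :: 'n set) - j)"
    unfolding T krull_dim_quot_var_prime by simp
  moreover have "Min ((\<lambda>P. krull_dim (polyring Quot P)) ` set Ps) \<le> krull_dim (polyring Quot (Ps ! i))"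
    using i(1) by (intro Min_le) auto
  ultimately show "Min ((\<lambda>P. krull_dim (polyring Quot P)) ` set Ps) \<le> enat (card (UNIV :: 'n set) - j)"
    by simp
qed

lemma (in graded_presented) fdepth_sdepth_ge:
  assumes D: "box_filtration U D V" and UV: "U \<noteq> V"
    and T: "\<And>g T. (g, T) \<in> set D \<Longrightarrow> card T \<le> t"
  shows "enat (card (UNIV :: 'n set) - t) \<le> fdepth M" "enat (card (UNIV :: 'n set) - t) \<le> sdepth M"
proof -
  have D0: "D \<noteq> []" using D UV by auto
  let ?Ps = "map (\<lambda>(g, T). var_prime T :: ('k, 'n) mpoly set) D"
  obtain Ns as where F: "prime_filtration M Ns ?Ps as" using prime_filtration_of_boxes[OF D] by blast
  have "enat (card (UNIV :: 'n set) - t) \<le> Min ((\<lambda>P. krull_dim (polyring Quot P)) ` set ?Ps)"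
    using D0 T by (subst Min_ge_iff) (auto simp: krull_dim_quot_var_prime intro!: diff_le_mono2)
  also have "\<dots> \<le> fdepth M" unfolding fdepth_def using F by (intro Sup_upper) blast
  finally show "enat (card (UNIV :: 'n set) - t) \<le> fdepth M" .
  let ?D = "map (\<lambda>(g, T). (\<pi> (single g 1), - T)) D"
  have card: "card (- T) = card (UNIV :: 'n set) - card T" for T :: "'n set"
    by (simp add: Compl_eq_Diff_UNIV card_Diff_subset)
  have "enat (card (UNIV :: 'n set) - t) \<le> Min ((\<lambda>(u, Z). enat (card Z)) ` set ?D)"
    using D0 T by (subst Min_ge_iff) (auto simp: card intro!: diff_le_mono2)
  also have "\<dots> \<le> sdepth M"
    unfolding sdepth_def using stanley_decomposition_of_boxes[OF D] by (intro Sup_upper) blast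
  finally show "enat (card (UNIV :: 'n set) - t) \<le> sdepth M" .
qed

text \<open>The exponent $e$ belongs to a minimal generator of the module. Its class does not lie in the
  maximal ideal times the module, so the module is not exhausted by multiples of the sequence.\<close>

lemma (in graded_presented) depth_ge:
  fixes fs :: "('k, 'n) mpoly list"
  assumes D: "box_filtration U D V"
    and fs: "\<And>g T. (g, T) \<in> set D \<Longrightarrow> weakly_regular fs (var_prime T) UNIV"
    and max: "set fs \<subseteq> var_prime UNIV"
    and e: "e \<in> V" "e \<notin> U" "\<And>u w. u \<in> V \<Longrightarrow> e = u + w \<Longrightarrow> w = 0"
  shows "enat (length fs) \<le> depth polyring max_ideal M"
proof -
  \<comment> \<open>the exponents of $A + \mathfrak{m} B$\<close>
  let ?N = "U \<union> {u + w |u w. u \<in> V \<and> w \<noteq> 0}"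
  have add0: "w + x \<noteq> 0" if "w \<noteq> 0" for w x :: "'n \<Rightarrow>\<^sub>0 nat"
    using that keys_expo_add[of w x] by (metis Un_empty keys_eq_empty)
  have "up_closed {u + w |u w. u \<in> V \<and> w \<noteq> 0}"
    unfolding up_closed_def
  proof clarify
    fix u w x :: "'n \<Rightarrow>\<^sub>0 nat" assume "u \<in> V" "w \<noteq> 0"
    then show "\<exists>u' w'. u + w + x = u' + w' \<and> u' \<in> V \<and> w' \<noteq> 0"
      using add0[of w x] by (intro exI[of _ u] exI[of _ "w + x"]) (simp add: add.assoc)
  qed
  then have N: "is_ideal (mono_ideal ?N :: ('k, 'n) mpoly set)"
    by (intro is_ideal_mono_ideal up_closed_Un up_U)
  have "ideal_plus_list fs (mono_ideal U) (mono_ideal V) \<subseteq> mono_ideal ?N"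
  proof (rule ideal_plus_list_least[OF N])
    show "mono_ideal U \<subseteq> (mono_ideal ?N :: ('k, 'n) mpoly set)" by (simp add: mono_ideal_subset_iff)
    fix f b :: "('k, 'n) mpoly" assume f: "f \<in> set fs" and b: "b \<in> mono_ideal V"
    show "f * b \<in> mono_ideal ?N"
      unfolding mono_ideal_def mem_Collect_eq
    proof
      fix v assume "v \<in> keys (f * b)"
      then obtain w u where wu: "v = w + u" "w \<in> keys f" "u \<in> keys b" using keys_mult[of f b] by blast
      have "w \<in> var_exponents UNIV" using wu(2) f max unfolding mono_ideal_def by blast
      then have "w \<noteq> 0" unfolding var_exponents_def by auto
      moreover have "u \<in> V" using wu(3) b unfolding mono_ideal_def by blast
      moreover have "v = u + w" using wu(1) by (simp add: add.commute)
      ultimately show "v \<in> ?N" by blast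
    qed
  qed
  moreover have "e \<notin> ?N" using e by blast
  then have "single e (1 :: 'k) \<notin> mono_ideal ?N" "single e (1 :: 'k) \<in> mono_ideal V"
    using e(1) by simp_all
  ultimately have "ideal_plus_list fs (mono_ideal U) (mono_ideal V) \<noteq> mono_ideal V" by blast
  moreover have "weakly_regular fs (mono_ideal U) (mono_ideal V)"
    by (rule weakly_regular_box_filtration[OF D up_U fs])
  ultimately have "regular_sequence polyring M fs" by (simp add: regular_sequence_iff)
  then show ?thesis unfolding depth_def max_ideal_eq using max by (intro Sup_upper) blast
qed

section \<open>Monomial complete intersections\<close>

text \<open>Suppose that $x_k$ divides two generators $u_i$ and $u_j$ with $i < j$. Then $u_j (u_i / x_k) =
  u_i (u_j / x_k)$ lies in $(u_1, \ldots, u_{j - 1})$, and regularity puts $u_i / x_k$ into $I$.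
  This contradicts the minimality of $u_i$.\<close>

lemma monomial_complete_intersection_exponents:
  fixes I :: "('k::field, 'n::finite) mpoly set"
  assumes "monomial_complete_intersection I"
  obtains es where "I = mono_ideal (up_gen (set es))" "es \<noteq> []" "0 \<notin> set es" "coprime_exponents es"
    "\<And>e u w. e \<in> set es \<Longrightarrow> u \<in> up_gen (set es) \<Longrightarrow> e = u + w \<Longrightarrow> w = 0"
    "weakly_regular (map (\<lambda>v. single v (1 :: 'k)) es) {0} UNIV"
proof -
  obtain us where I: "monomial_ideal I" "I \<noteq> {0}" "I \<noteq> UNIV" and us: "distinct us"
    "set us = minimal_monomial_generators I" "regular_sequence polyring polymod us"
    using assms unfolding monomial_complete_intersection_def by blast
  obtain U where U: "up_closed U" "I = mono_ideal U" using I(1) unfolding monomial_ideal_iff by blast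
  define G where "G = {v \<in> U. \<forall>w\<in>U. (\<exists>x. v = w + x) \<longrightarrow> w = v}"
  have single_inj: "single v (1 :: 'k) = single w 1 \<longleftrightarrow> v = w" for v w :: "'n \<Rightarrow>\<^sub>0 nat"
    by (metis keys_single one_neq_zero singleton_inject)
  have "minimal_monomial_generators I = (\<lambda>v. single v 1) ` G"
  proof (intro equalityI subsetI)
    fix p assume "p \<in> minimal_monomial_generators I"
    then obtain v where v: "p = single v 1" "v \<in> U"
      and min: "\<And>q. q \<in> monomials \<Longrightarrow> q \<in> I \<Longrightarrow> q dvd p \<Longrightarrow> q = p"
      unfolding minimal_monomial_generators_def monomials_def U(2) by auto
    have "w = v" if "w \<in> U" "\<exists>x. v = w + x" for w
      using min[of "single w 1"] that unfolding monomials_def U(2) v(1)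
      by (simp add: dvd_monomial_iff single_inj)
    then show "p \<in> (\<lambda>v. single v 1) ` G" using v unfolding G_def by blast
  next
    fix p assume "p \<in> (\<lambda>v. single v (1 :: 'k)) ` G"
    then obtain v where v: "p = single v 1" "v \<in> U" "\<And>w. w \<in> U \<Longrightarrow> \<exists>x. v = w + x \<Longrightarrow> w = v"
      unfolding G_def by blast
    have "q = p" if q: "q \<in> monomials" "q \<in> I" "q dvd p" for q
    proof -
      obtain w where w: "q = single w 1" using q(1) unfolding monomials_def by blast
      then have "w \<in> U" "\<exists>x. v = w + x" using q(2,3) unfolding U(2) v(1) by (simp_all add: dvd_monomial_iff)
      then have "w = v" by (rule v(3))
      then show "q = p" using w v(1) by simp
    qed
    then show "p \<in> minimal_monomial_generators I"
      using v(1,2) unfolding minimal_monomial_generators_def monomials_def U(2) by auto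
  qed
  then have "set us = (\<lambda>v. single v 1) ` G" using us(2) by simp
  then obtain es where es: "us = map (\<lambda>v. single v 1) es" "set es = G"
  proof -
    assume a: "\<And>es. us = map (\<lambda>v. single v 1) es \<Longrightarrow> set es = G \<Longrightarrow> thesis"
      and s: "set us = (\<lambda>v. single v 1) ` G"
    let ?inv = "\<lambda>p. THE v. p = single v (1 :: 'k)"
    have inv: "?inv (single v 1) = v" for v :: "'n \<Rightarrow>\<^sub>0 nat" by (rule the_equality) (auto simp: single_inj)
    show thesis
    proof (rule a[of "map ?inv us"])
      have "single (?inv p) 1 = p" if "p \<in> set us" for p using that s inv by auto
      then show "us = map (\<lambda>v. single v 1) (map ?inv us)" by (simp add: map_idI)
      show "set (map ?inv us) = G" using s inv by (simp add: image_image)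
    qed
  qed
  have gen: "up_gen (set es) = U" unfolding es(2) G_def by (rule up_gen_minimal[OF U(1)])
  interpret P: presented polymod "{0}" UNIV "\<lambda>p :: ('k, 'n) mpoly. p"
    using graded_presented.presented[OF graded_presented_polymod] by simp
  have reg: "weakly_regular us {0} UNIV" using us(3) by (simp add: P.regular_sequence_iff)
  have min: "w = 0" if "e \<in> set es" "u \<in> U" "e = u + w" for e u w
  proof -
    have "u = e" using that unfolding es(2) G_def by blast
    then show ?thesis using that(3) by simp
  qed
  have cop: "keys (es ! i) \<inter> keys (es ! j) = {}" if ij: "i < j" "j < length es" for i j
  proof (rule ccontr)
    assume "\<not> ?thesis"
    then obtain k where k: "k \<in> keys (es ! i)" "k \<in> keys (es ! j)" by blast
    let ?k = "single k 1 :: 'n \<Rightarrow>\<^sub>0 nat"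
    let ?J = "mono_ideal (up_gen (set (take j es))) :: ('k, 'n) mpoly set"
    have take: "ideal_plus_list (take j us) {0} UNIV = ?J"
      unfolding es(1) take_map by (rule ideal_plus_list_monomials)
    have esi: "es ! i \<in> set (take j es)" using ij by (auto simp: in_set_conv_nth)
    have "es ! j + (es ! i - ?k) = (?k + (es ! j - ?k)) + (es ! i - ?k)"
      by (simp only: expo_minus_single[OF k(2), symmetric])
    also have "\<dots> = (?k + (es ! i - ?k)) + (es ! j - ?k)" by (simp only: add_ac)
    also have "\<dots> = es ! i + (es ! j - ?k)" by (simp only: expo_minus_single[OF k(1), symmetric])
    finally have "es ! j + (es ! i - ?k) \<in> up_gen (set (take j es))"
      using up_closedD[OF up_closed_up_gen up_gen_self[OF esi]] by simp
    then have "us ! j * single (es ! i - ?k) 1 \<in> ?J" using ij by (simp add: es(1) mult_single)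
    then have "single (es ! i - ?k) 1 \<in> ?J"
      using reg ij unfolding weakly_regular_nth by (auto simp: es(1) simp flip: take)
    then have "es ! i - ?k \<in> up_gen (set (take j es))" by simp
    then have "es ! i - ?k \<in> U" using gen set_take_subset[of j es] unfolding up_gen_def by blast
    moreover have "es ! i = (es ! i - ?k) + ?k" using expo_minus_single[OF k(1)] by (simp add: add.commute)
    moreover have "es ! i \<in> set es" using ij by simp
    ultimately have "?k = 0" using min[of "es ! i" "es ! i - ?k" ?k] by blast
    then show False by (metis keys_single keys_zero insert_not_empty one_neq_zero)
  qed
  show thesis
  proof
    show "I = mono_ideal (up_gen (set es))" unfolding gen by (rule U(2))
    show "es \<noteq> []"
    proof
      assume "es = []"
      then have "U = {}" using gen by simp
      then show False using I(2) U(2) by simp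
    qed
    show "0 \<notin> set es"
    proof
      assume "0 \<in> set es"
      then have "0 \<in> U" using gen up_gen_self by blast
      then have "v \<in> U" for v using up_closedD[OF U(1), of 0 v] by simp
      then have "U = UNIV" by blast
      then show False using I(3) U(2) by simp
    qed
    show "coprime_exponents es" unfolding sorted_wrt_iff_nth_less using cop by blast
    show "w = 0" if "e \<in> set es" "u \<in> up_gen (set es)" "e = u + w" for e u w
      using min that gen by blast
    show "weakly_regular (map (\<lambda>v. single v (1 :: 'k)) es) {0} UNIV" using reg unfolding es(1) .
  qed
qed

lemma card_le_blocks:
  assumes "T \<subseteq> (\<Union>u\<in>set us. keys u)" "\<And>u. u \<in> set us \<Longrightarrow> card (keys u \<inter> T) \<le> 1"
  shows "card T \<le> length us"
proof -
  have "T = (\<Union>u\<in>set us. keys u \<inter> T)" using assms(1) by blast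
  then have "card T \<le> (\<Sum>u\<in>set us. card (keys u \<inter> T))" using card_UN_le[of "set us" "\<lambda>u. keys u \<inter> T"] by simp
  also have "\<dots> \<le> (\<Sum>u\<in>set us. 1)" by (intro sum_mono assms(2))
  also have "\<dots> \<le> length us" by (simp add: card_length)
  finally show ?thesis .
qed

text \<open>The differences $x_a - x_r$ with $r$ the chosen variable of the support containing $a$, together
  with the variables outside all supports; \<open>c u\<close> is the chosen variable in the
  support of \<open>u\<close>.\<close>

lemma coprime_exponents_regular_sequence:
  fixes es :: "('n::finite \<Rightarrow>\<^sub>0 nat) list"
  assumes cop: "coprime_exponents es" and nz: "0 \<notin> set es"
  obtains fs :: "('k::field, 'n) mpoly list" and c :: "('n \<Rightarrow>\<^sub>0 nat) \<Rightarrow> 'n"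
  where "length fs + length es = card (UNIV :: 'n set)" "set fs \<subseteq> var_prime UNIV"
    "\<And>T. T \<subseteq> (\<Union>u\<in>set es. keys u) \<Longrightarrow> (\<And>u. u \<in> set es \<Longrightarrow> card (keys u \<inter> T) \<le> 1) \<Longrightarrow>
      weakly_regular fs (var_prime T) UNIV"
    "\<And>T u. T \<subseteq> (\<Union>u\<in>set es. keys u) \<Longrightarrow> (\<And>u. u \<in> set es \<Longrightarrow> card (keys u \<inter> T) \<le> 1) \<Longrightarrow>
      u \<in> set es \<Longrightarrow> keys u \<inter> T = {} \<Longrightarrow> weakly_regular (fs @ [indet (c u)]) (var_prime T) UNIV"
proof -
  define B where "B = (\<Union>u\<in>set es. keys u)"
  define c where "c u = (SOME i. i \<in> keys u)" for u :: "'n \<Rightarrow>\<^sub>0 nat"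
  have c: "c u \<in> keys u" if "u \<in> set es" for u
    unfolding c_def using that nz by (metis some_in_eq keys_eq_empty)
  have disj: "u = u'" if "u \<in> set es" "u' \<in> set es" "a \<in> keys u" "a \<in> keys u'" for u u' a
  proof -
    obtain i j where ij: "i < length es" "j < length es" "u = es ! i" "u' = es ! j"
      using \<open>u \<in> _\<close> \<open>u' \<in> _\<close> by (metis in_set_conv_nth)
    have "\<not> i < j" "\<not> j < i"
      using cop ij that(3,4) unfolding sorted_wrt_iff_nth_less by blast+
    then show ?thesis using ij by simp
  qed
  have dist: "distinct es"
    unfolding distinct_conv_nth
  proof (intro allI impI)
    fix i j assume ij: "i < length es" "j < length es" "i \<noteq> j"
    have "keys (es ! i) \<inter> keys (es ! j) = {}"
      using cop ij unfolding sorted_wrt_iff_nth_less by (metis Int_commute neqE)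
    moreover have "keys (es ! i) \<noteq> {}" using c[of "es ! i"] ij by auto
    ultimately show "es ! i \<noteq> es ! j" by auto
  qed
  define blk where "blk a = (THE u. u \<in> set es \<and> a \<in> keys u)" for a
  have blk: "blk a = u" if "u \<in> set es" "a \<in> keys u" for a u
    unfolding blk_def by (rule the_equality) (use that disj in blast)+
  interpret star_forest B "\<lambda>a. c (blk a)"
  proof
    fix a assume "a \<in> B"
    then obtain u where u: "u \<in> set es" "a \<in> keys u" unfolding B_def by blast
    then show "c (blk a) \<in> B" using c blk unfolding B_def by auto
    show "c (blk (c (blk a))) = c (blk a)" using u c blk by simp
  qed
  have roots: "roots = c ` set es"
  proof
    show "roots \<subseteq> c ` set es"
    proof
      fix a assume a: "a \<in> roots"
      then have "a \<in> B" unfolding roots_def by simp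
      then obtain u where u: "u \<in> set es" "a \<in> keys u" unfolding B_def by blast
      then have "a = c u" using a blk unfolding roots_def by auto
      then show "a \<in> c ` set es" using u by blast
    qed
    show "c ` set es \<subseteq> roots"
    proof clarify
      fix u assume u: "u \<in> set es"
      then have "c u \<in> B" using c unfolding B_def by auto
      then show "c u \<in> roots" using blk[OF u c[OF u]] unfolding roots_def by simp
    qed
  qed
  have "inj_on c (set es)" using c disj by (metis inj_onI)
  then have card_roots: "card roots = length es" unfolding roots by (simp add: card_image distinct_card[OF dist])
  obtain xs where xs: "set xs = - roots" "distinct xs" using finite_distinct_list[of "- roots"] by auto
  have inj: "inj_on (\<lambda>a. c (blk a)) T"
    if T: "T \<subseteq> B" "\<And>u. u \<in> set es \<Longrightarrow> card (keys u \<inter> T) \<le> 1" for T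
  proof (rule inj_onI)
    fix a b assume ab: "a \<in> T" "b \<in> T" "c (blk a) = c (blk b)"
    obtain u v where uv: "u \<in> set es" "a \<in> keys u" "v \<in> set es" "b \<in> keys v"
      using ab T(1) unfolding B_def by blast
    then have "c u = c v" using ab(3) blk by simp
    then have "u = v" using disj[OF uv(1,3), of "c u"] c uv by metis
    then have "{a, b} \<subseteq> keys u \<inter> T" using uv ab by auto
    then have "card {a, b} \<le> 1" using T(2)[OF uv(1)] card_mono[of "keys u \<inter> T" "{a, b}"] by simp
    then show "a = b" by (cases "a = b") auto
  qed
  show thesis
  proof (rule that[of "map edge xs" c])
    have "length xs = card (UNIV :: 'n set) - card roots"
      using distinct_card[OF xs(2)] unfolding xs(1) by (simp add: Compl_eq_Diff_UNIV card_Diff_subset)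
    moreover have "card roots \<le> card (UNIV :: 'n set)" by (rule card_mono) simp_all
    ultimately show "length (map edge xs :: ('k, 'n) mpoly list) + length es = card (UNIV :: 'n set)"
      using card_roots by simp
    have "edge a \<in> (var_prime UNIV :: ('k, 'n) mpoly set)" for a
      unfolding edge_def by (cases "a \<in> B") (auto intro!: ideal_diff[OF is_ideal_var_prime])
    then show "set (map edge xs) \<subseteq> (var_prime UNIV :: ('k, 'n) mpoly set)" by auto
    fix T assume T: "T \<subseteq> (\<Union>u\<in>set es. keys u)" "\<And>u. u \<in> set es \<Longrightarrow> card (keys u \<inter> T) \<le> 1"
    then have TB: "T \<subseteq> B" unfolding B_def by simp
    show "weakly_regular (map edge xs) (var_prime T :: ('k, 'n) mpoly set) UNIV"
      using edges_regular_on_var_prime[OF TB inj[OF TB T(2)] xs(2), of "[]"] xs(1) by simp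
    fix u assume u: "u \<in> set es" "keys u \<inter> T = {}"
    have "c u \<notin> (\<lambda>a. c (blk a)) ` T"
    proof
      assume "c u \<in> (\<lambda>a. c (blk a)) ` T"
      then obtain a where a: "a \<in> T" "c u = c (blk a)" by blast
      obtain v where v: "v \<in> set es" "a \<in> keys v" using a(1) TB unfolding B_def by blast
      then have "c u = c v" using a(2) blk by simp
      then have "u = v" using disj[OF u(1) v(1), of "c u"] c u(1) v(1) by metis
      then show False using u(2) a(1) v(2) by blast
    qed
    then show "weakly_regular (map edge xs @ [indet (c u)]) (var_prime T :: ('k, 'n) mpoly set) UNIV"
      using edges_regular_on_var_prime[OF TB inj[OF TB T(2)] xs(2), of "[c u]"] xs(1) u(1) roots by simp
  qed
qed

theorem proposition3p2:
  fixes I :: "('k::field, 'n::finite) mpoly set"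
  assumes "monomial_complete_intersection I"
  shows "fdepth (gquot polymod I) = depth polyring max_ideal (gquot polymod I) \<and>
    fdepth (gsub polymod I) = depth polyring max_ideal (gsub polymod I) \<and>
    depth polyring max_ideal (gquot polymod I) \<le> sdepth (gquot polymod I) \<and>
    depth polyring max_ideal (gsub polymod I) \<le> sdepth (gsub polymod I)"
proof -
  obtain es where I: "I = mono_ideal (up_gen (set es))" and ne: "es \<noteq> []" and nz: "0 \<notin> set es"
    and cop: "coprime_exponents es"
    and min: "\<And>e u w. e \<in> set es \<Longrightarrow> u \<in> up_gen (set es) \<Longrightarrow> e = u + w \<Longrightarrow> w = 0"
    and reg: "weakly_regular (map (\<lambda>v. single v (1 :: 'k)) es) {0} UNIV"
    using monomial_complete_intersection_exponents[OF assms] by blast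
  let ?U = "up_gen (set es)" and ?n = "card (UNIV :: 'n set)" and ?m = "length es"
  obtain vs u where es: "es = vs @ [u]" using ne by (metis rev_exhaust)
  have m: "?m = Suc (length vs)" unfolding es by simp
  have not0: "0 \<notin> ?U"
  proof
    assume "0 \<in> ?U"
    then obtain e w where "e \<in> set es" "0 = e + w" unfolding up_gen_def by blast
    then have "e = 0" by (metis Un_empty keys_eq_empty keys_expo_add)
    then show False using nz \<open>e \<in> set es\<close> by simp
  qed
  interpret Q: graded_presented "gquot polymod I" ?U UNIV "\<lambda>p. I +>\<^bsub>polymod\<^esub> p"
    unfolding I by (rule graded_presented_quotient) simp
  interpret J: graded_presented "gsub polymod I" "{}" ?U "\<lambda>p. p"
    unfolding I by (rule graded_presented_ideal) simp
  obtain idx :: "'n \<Rightarrow> nat" where "inj idx" using finite_imp_inj_to_nat_seg[of "UNIV :: 'n set"] by auto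
  then have K: "koszul idx" by unfold_locales
  let ?acyclic = "koszul.acyclic_at (indet :: 'n \<Rightarrow> ('k, 'n) mpoly) idx"
  have S0: "\<not> ?acyclic 0 {0} UNIV"
  proof
    assume "?acyclic 0 {0} UNIV"
    then obtain c where "1 - (\<Sum>i\<in>UNIV. c i * indet i) = (0 :: ('k, 'n) mpoly)"
      using koszul.acyclic_at_0[OF K ideal_zero] by auto
    then have "\<exists>c. (1 :: ('k, 'n) mpoly) = (\<Sum>i\<in>UNIV. c i * indet i)" by auto
    then have "(1 :: ('k, 'n) mpoly) \<in> var_prime UNIV" by (simp only: var_prime_UNIV_eq)
    then show False using is_prime_one[OF is_prime_var_prime] by blast
  qed
  \<comment> \<open>the generators are a regular sequence on $S$ of length $m$, so they raise $H_0(S) \<noteq> 0$ to degree $m$\<close>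
  have HQ: "\<not> ?acyclic ?m (mono_ideal ?U) (mono_ideal UNIV)"
  proof
    assume H: "?acyclic ?m (mono_ideal ?U) (mono_ideal UNIV)"
    have "?acyclic 0 {0} UNIV"
    proof (rule koszul.depth_sensitivity_list[OF K _ _ reg])
      show "?acyclic (0 + length (map (\<lambda>v. single v (1 :: 'k)) es))
          (ideal_plus_list (map (\<lambda>v. single v 1) es) {0} UNIV) UNIV"
        using H by (simp add: ideal_plus_list_monomials)
      show "\<exists>c. f = (\<Sum>i\<in>UNIV. c i * indet i)" if f: "f \<in> set (map (\<lambda>v. single v (1 :: 'k)) es)" for f
      proof -
        obtain e where "e \<in> set es" "f = single e 1" using f by auto
        then have "f \<in> var_prime UNIV" using nz by (auto simp: var_exponents_def)
        then show ?thesis by (simp only: var_prime_UNIV_eq)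
      qed
    qed simp_all
    then show False using S0 by simp
  qed
  \<comment> \<open>the homology moves down by one degree along the connecting map; $H_m(S) = 0$ because $m > 0$\<close>
  have HJ: "\<not> ?acyclic (length vs) (mono_ideal {}) (mono_ideal ?U)"
  proof
    assume "?acyclic (length vs) (mono_ideal {}) (mono_ideal ?U)"
    moreover have "?acyclic (Suc (length vs)) {0} UNIV"
      using acyclic_var_prime[OF K, where T = "{}" and j = "Suc (length vs)"] by simp
    ultimately have "?acyclic (Suc (length vs)) (mono_ideal ?U) UNIV"
      by (intro koszul.acyclic_connecting[OF K J.B]) simp_all
    then show False using HQ unfolding m by simp
  qed
  obtain fs :: "('k, 'n) mpoly list" and c where len: "length fs + ?m = ?n" and fs: "set fs \<subseteq> var_prime UNIV"
    and regQ: "\<And>T. T \<subseteq> (\<Union>u\<in>set es. keys u) \<Longrightarrow> (\<And>u. u \<in> set es \<Longrightarrow> card (keys u \<inter> T) \<le> 1) \<Longrightarrow>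
      weakly_regular fs (var_prime T) UNIV"
    and regJ: "\<And>T u. T \<subseteq> (\<Union>u\<in>set es. keys u) \<Longrightarrow> (\<And>u. u \<in> set es \<Longrightarrow> card (keys u \<inter> T) \<le> 1) \<Longrightarrow>
      u \<in> set es \<Longrightarrow> keys u \<inter> T = {} \<Longrightarrow> weakly_regular (fs @ [indet (c u)]) (var_prime T) UNIV"
    using coprime_exponents_regular_sequence[OF cop nz] by blast
  obtain D where D: "box_filtration ?U D UNIV"
    and TD: "\<And>g T. (g, T) \<in> set D \<Longrightarrow> T \<subseteq> (\<Union>u\<in>set es. keys u) \<and> (\<forall>u\<in>set es. card (keys u \<inter> T) = 1)"
    using box_filtration_quotient[OF cop, of "{}"] by fastforce
  have Q: "enat (?n - ?m) \<le> depth polyring max_ideal (gquot polymod I)"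
    "enat (?n - ?m) \<le> fdepth (gquot polymod I)" "enat (?n - ?m) \<le> sdepth (gquot polymod I)"
  proof -
    have "enat (length fs) \<le> depth polyring max_ideal (gquot polymod I)"
    proof (rule Q.depth_ge[OF D _ fs, of 0])
      show "weakly_regular fs (var_prime T) UNIV" if "(g, T) \<in> set D" for g T
        using TD[OF that] by (intro regQ) auto
      show "w = 0" if "0 = u + w" for u w :: "'n \<Rightarrow>\<^sub>0 nat"
        using that by (metis Un_empty keys_eq_empty keys_expo_add)
    qed (use not0 in auto)
    then show "enat (?n - ?m) \<le> depth polyring max_ideal (gquot polymod I)" using len by (metis add_diff_cancel_right')
    have "card T \<le> ?m" if "(g, T) \<in> set D" for g T using TD[OF that] by (intro card_le_blocks) auto
    then show "enat (?n - ?m) \<le> fdepth (gquot polymod I)" "enat (?n - ?m) \<le> sdepth (gquot polymod I)"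
      using Q.fdepth_sdepth_ge[OF D, of ?m] not0 by auto
  qed
  obtain E where E: "box_filtration {} E ?U"
    and TE: "\<And>g T. (g, T) \<in> set E \<Longrightarrow> T \<subseteq> (\<Union>v\<in>set vs. keys v) \<and> (\<forall>v\<in>set vs. card (keys v \<inter> T) \<le> 1)"
    using box_filtration_ideal[of vs u] cop unfolding es by fastforce
  have disj: "keys u \<inter> T = {}" if "T \<subseteq> (\<Union>v\<in>set vs. keys v)" for T
    using that cop unfolding es sorted_wrt_append by fastforce
  have J: "enat (?n - length vs) \<le> depth polyring max_ideal (gsub polymod I)"
    "enat (?n - length vs) \<le> fdepth (gsub polymod I)" "enat (?n - length vs) \<le> sdepth (gsub polymod I)"
  proof -
    have "enat (length (fs @ [indet (c u)])) \<le> depth polyring max_ideal (gsub polymod I)"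
    proof (rule J.depth_ge[OF E, of _ u])
      show "weakly_regular (fs @ [indet (c u)]) (var_prime T) UNIV" if gT: "(g, T) \<in> set E" for g T
      proof (rule regJ)
        have Tvs: "T \<subseteq> (\<Union>v\<in>set vs. keys v)" "\<And>v. v \<in> set vs \<Longrightarrow> card (keys v \<inter> T) \<le> 1"
          using TE[OF gT] by blast+
        show uT: "keys u \<inter> T = {}" by (rule disj[OF Tvs(1)])
        show "T \<subseteq> (\<Union>v\<in>set es. keys v)" using Tvs(1) unfolding es by auto
        show "card (keys v \<inter> T) \<le> 1" if "v \<in> set es" for v
          by (cases "v = u") (use that Tvs(2)[of v] uT in \<open>auto simp: es\<close>)
      qed (simp add: es)
      show "u \<in> ?U" unfolding es by (simp add: up_gen_self)
      show "w = 0" if "v \<in> ?U" "u = v + w" for v w using min[of u v w] that unfolding es by simp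
    qed (use fs in auto)
    moreover have "length (fs @ [indet (c u)]) = ?n - length vs" using len unfolding m by simp
    ultimately show "enat (?n - length vs) \<le> depth polyring max_ideal (gsub polymod I)" by simp
    have "card T \<le> length vs" if "(g, T) \<in> set E" for g T using TE[OF that] by (intro card_le_blocks) auto
    moreover have "{} \<noteq> ?U" using up_gen_self[of u "set es"] unfolding es by auto
    ultimately show "enat (?n - length vs) \<le> fdepth (gsub polymod I)" "enat (?n - length vs) \<le> sdepth (gsub polymod I)"
      using J.fdepth_sdepth_ge[OF E, of "length vs"] by auto
  qed
  have "depth polyring max_ideal (gquot polymod I) = enat (?n - ?m)"
    "fdepth (gquot polymod I) = enat (?n - ?m)"
    by (rule antisym[OF Q.depth_le[OF K HQ] Q(1)], rule antisym[OF Q.fdepth_le[OF K HQ] Q(2)])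
  moreover have "depth polyring max_ideal (gsub polymod I) = enat (?n - length vs)"
    "fdepth (gsub polymod I) = enat (?n - length vs)"
    by (rule antisym[OF J.depth_le[OF K HJ] J(1)], rule antisym[OF J.fdepth_le[OF K HJ] J(2)])
  ultimately show ?thesis using Q(3) J(3) by simp
qed

end
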